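(* Let $(L,\mathfrak m)$ be a (Noetherian) local ring with infinite residue field and $\mathfrak a=(a_1,\ldots,a_m)$ an ideal of $L$ with analytic spread $d$. Let $\mathcal Q$ be the ideal of $L[u]$ generated by the generic elements $b_1,\ldots,b_d$ of $\mathfrak a$, and let $\mathcal J\subseteq L[u]$ be the testing ideal for the minimal reductions of $\mathfrak a$. Then $$\mathfrak a^{br(\mathfrak a)+1}\subseteq(\mathcal Q:\mathcal J^\infty)\cap L\subseteq\operatorname{core}(\mathfrak a).$$
   Context: An ideal $\mathfrak q\subseteq\mathfrak a$ is a reduction of $\mathfrak a$ if $\mathfrak a^{n+1}=\mathfrak q\mathfrak a^n$ for some $n\ge0$; the least such $n$ is $r_{\mathfrak q}(\mathfrak a)$. Minimal reductions are reductions minimal with respect to inclusion. The big reduction number $br(\mathfrak a)$ is the maximum of $r_{\mathfrak q}(\mathfrak a)$ over all minimal reductions $\mathfrak q$ of $\mathfrak a$ (it is finite). $\operatorname{core}(\mathfrak a)$ is the intersection of all minimal reductions of $\mathfrak a$. The analytic spread of $\mathfrak a$ is $d=\dim\bigoplus_{n\ge0}\mathfrak a^n/\mathfrak m\mathfrak a^n$. Let $u=\{u_{ij}\mid 1\le i\le d,\ 1\le j\le m\}$ be indeterminates; the generic elements of $\mathfrak a$ are $b_i=\sum_{j=1}^m u_{ij}a_j\in L[u]$, $i=1,\ldots,d$. Testing ideal: fix a minimal basis of $\mathfrak a^{br(\mathfrak a)+1}$ consisting of monomials of degree $br(\mathfrak a)+1$ in $a_1,\ldots,a_m$. Write each element $b_ig$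 ($i=1,\ldots,d$, $g$ a monomial in $a_1,\ldots,a_m$ of degree $br(\mathfrak a)$) as a linear combination of the elements of this basis with coefficients in $L[u]$, and let $M$ be the matrix of these coefficients. Let $h$ be the minimal number of generators of $\mathfrak a^{br(\mathfrak a)+1}$. The testing ideal $\mathcal J$ is the ideal of $L[u]$ generated by the $h\times h$ minors of $M$. $\mathcal Q:\mathcal J^\infty=\bigcup_{n\ge1}(\mathcal Q:\mathcal J^n)$, an ideal of $L[u]$. *)

theory Defs
  imports
    "HOL-Library.Extended_Nat"
    "HOL-Library.Multiset"
    "HOL-Library.Poly_Mapping"
    "HOL-Algebra.QuotRing"
    "HOL-Algebra.Ideal_Product"
    "HOL-Algebra.Ring_Divisibility"
    "Jordan_Normal_Form.VS_Connect"
    "Jordan_Normal_Form.Determinant"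
    "Jordan_Normal_Form.DL_Submatrix"
begin

section \<open>Ideals, local rings, dimension\<close>

abbreviation ideal_power :: "('a, 'b) ring_scheme \<Rightarrow> 'a set \<Rightarrow> nat \<Rightarrow> 'a set" where
  "ideal_power R I n \<equiv> I [^]\<^bsub>ideals_set R\<^esub> n"

definition is_local_ring :: "('a, 'b) ring_scheme \<Rightarrow> 'a set \<Rightarrow> bool" where
  "is_local_ring R \<mm> \<longleftrightarrow> cring R \<and> {I. maximalideal I R} = {\<mm>}"

definition ideal_colon :: "('a, 'b) ring_scheme \<Rightarrow> 'a set \<Rightarrow> 'a set \<Rightarrow> 'a set" where
  "ideal_colon R I J = {x \<in> carrier R. \<forall>y\<in>J. x \<otimes>\<^bsub>R\<^esub> y \<in> I}"

definition ideal_saturation :: "('a, 'b) ring_scheme \<Rightarrow> 'a set \<Rightarrow> 'a set \<Rightarrow> 'a set" where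
  "ideal_saturation R I J = (\<Union>n\<in>{1..}. ideal_colon R I (ideal_power R J n))"

definition min_num_gens :: "('a, 'b) ring_scheme \<Rightarrow> 'a set \<Rightarrow> nat" where
  "min_num_gens R I = (LEAST n. \<exists>S \<subseteq> carrier R. finite S \<and> card S = n \<and> Idl\<^bsub>R\<^esub> S = I)"

definition minimal_basis :: "('a, 'b) ring_scheme \<Rightarrow> 'a set \<Rightarrow> 'a set \<Rightarrow> bool" where
  "minimal_basis R I B \<longleftrightarrow>
     B \<subseteq> carrier R \<and> Idl\<^bsub>R\<^esub> B = I \<and> (\<forall>B'. B' \<subset> B \<longrightarrow> Idl\<^bsub>R\<^esub> B' \<noteq> I)"

text \<open>Supremum of the lengths of strict chains of prime ideals (the zero ring gets 0).\<close>

definition krull_dim :: "('a, 'b) ring_scheme \<Rightarrow> enat" where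
  "krull_dim R = (SUP n \<in> {n. \<exists>P :: nat \<Rightarrow> 'a set.
      (\<forall>i\<le>n. primeideal (P i) R) \<and> (\<forall>i<n. P i \<subset> P (Suc i))}. enat n)"

text \<open>
  The graded ring $\bigoplus_n I^n / \mathfrak{m} I^n$. An element is a finitely supported
  family whose component in degree \<open>n\<close> is a coset \<open>\<mm> I^n + x\<close> with \<open>x \<in> I^n\<close>; since
  the zero of a component is the coset \<open>\<mm> I^n\<close> itself, this is what finite support refers to.
  The product is computed on representatives; the result does not depend on their choice, so
  that the set displayed is a single coset.
\<close>

definition fiber_ring :: "('a, 'b) ring_scheme \<Rightarrow> 'a set \<Rightarrow> 'a set \<Rightarrow> (nat \<Rightarrow> 'a set) ring" where
  "fiber_ring R \<mm> I =
    (let K = (\<lambda>n. \<mm> \<cdot>\<^bsub>R\<^esub> ideal_power R I n) in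
     \<lparr> carrier = {F. (\<forall>n. \<exists>x \<in> ideal_power R I n. F n = K n +>\<^bsub>R\<^esub> x) \<and> finite {n. F n \<noteq> K n}},
       monoid.mult = (\<lambda>F G n. {z. \<exists>x y. (\<forall>i. x i \<in> F i) \<and> (\<forall>i. y i \<in> G i) \<and>
                  z \<in> K n +>\<^bsub>R\<^esub> (\<Oplus>\<^bsub>R\<^esub>i\<in>{..n}. x i \<otimes>\<^bsub>R\<^esub> y (n - i))}),
       one = (\<lambda>n. if n = 0 then K 0 +>\<^bsub>R\<^esub> \<one>\<^bsub>R\<^esub> else K n),
       zero = K,
       add = (\<lambda>F G n. F n <+>\<^bsub>R\<^esub> G n) \<rparr>)"

definition analytic_spread :: "('a, 'b) ring_scheme \<Rightarrow> 'a set \<Rightarrow> 'a set \<Rightarrow> enat" where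
  "analytic_spread R \<mm> I = krull_dim (fiber_ring R \<mm> I)"

section \<open>Reductions\<close>

definition is_reduction :: "('a, 'b) ring_scheme \<Rightarrow> 'a set \<Rightarrow> 'a set \<Rightarrow> bool" where
  "is_reduction R I q \<longleftrightarrow> ideal q R \<and> q \<subseteq> I \<and>
     (\<exists>n. ideal_power R I (n + 1) = q \<cdot>\<^bsub>R\<^esub> ideal_power R I n)"

definition reduction_number :: "('a, 'b) ring_scheme \<Rightarrow> 'a set \<Rightarrow> 'a set \<Rightarrow> nat" where
  "reduction_number R I q =
     (LEAST n. ideal_power R I (n + 1) = q \<cdot>\<^bsub>R\<^esub> ideal_power R I n)"

definition minimal_reduction :: "('a, 'b) ring_scheme \<Rightarrow> 'a set \<Rightarrow> 'a set \<Rightarrow> bool" where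
  "minimal_reduction R I q \<longleftrightarrow>
     is_reduction R I q \<and> (\<forall>q'. is_reduction R I q' \<and> q' \<subseteq> q \<longrightarrow> q' = q)"

definition big_reduction_number :: "('a, 'b) ring_scheme \<Rightarrow> 'a set \<Rightarrow> nat" where
  "big_reduction_number R I = Max (reduction_number R I ` {q. minimal_reduction R I q})"

definition ideal_core :: "('a, 'b) ring_scheme \<Rightarrow> 'a set \<Rightarrow> 'a set" where
  "ideal_core R I = \<Inter>{q. minimal_reduction R I q}"

section \<open>Generic elements and the testing ideal\<close>

text \<open>
  The ground ring is a type of class \<open>comm_ring_1\<close>, seen as a ring record through
  \<open>class_ring\<close>. Polynomials are finitely supported functions on exponent vectors in the
  variables $u_{ij}$, $i, j$ natural numbers, and the ring of polynomials in
  $u_{ij}$, $1 \le i \le d$, $1 \le j \le m$, is the corresponding subring.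
\<close>

type_synonym 'a upoly = "((nat \<times> nat, nat) poly_mapping, 'a) poly_mapping"

definition upoly_ring :: "nat \<Rightarrow> nat \<Rightarrow> 'a::comm_ring_1 upoly ring" where
  "upoly_ring d m =
     class_ring\<lparr>carrier := {p. \<forall>e \<in> Poly_Mapping.keys p. Poly_Mapping.keys e \<subseteq> {1..d} \<times> {1..m}}\<rparr>"

definition uconst :: "'a::comm_ring_1 \<Rightarrow> 'a upoly" where
  "uconst c = Poly_Mapping.single 0 c"

definition uvar :: "nat \<Rightarrow> nat \<Rightarrow> 'a::comm_ring_1 upoly" where
  "uvar i j = Poly_Mapping.single (Poly_Mapping.single (i, j) 1) 1"

definition generic_element :: "(nat \<Rightarrow> 'a::comm_ring_1) \<Rightarrow> nat \<Rightarrow> nat \<Rightarrow> 'a upoly" where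
  "generic_element a m i = (\<Sum>j\<in>{1..m}. uvar i j * uconst (a j))"

text \<open>Formal monomials of degree \<open>r\<close> in \<open>a 1, \<dots>, a m\<close>, given by the multiset of their indices.\<close>

definition monomials :: "nat \<Rightarrow> nat \<Rightarrow> nat multiset set" where
  "monomials m r = {E. set_mset E \<subseteq> {1..m} \<and> size E = r}"

definition monomial_value :: "(nat \<Rightarrow> 'a::comm_ring_1) \<Rightarrow> nat multiset \<Rightarrow> 'a" where
  "monomial_value a E = (\<Prod>j\<in>#E. a j)"

text \<open>
  \<open>M\<close> is a matrix of coefficients of the elements \<open>b\<^sub>i g\<close>, \<open>g\<close> a monomial of degree \<open>r\<close>,
  with respect to some minimal basis of the \<open>(r+1)\<close>-st power of the ideal consisting of
  monomials of degree \<open>r + 1\<close>. The list \<open>cs\<close> enumerates the basis (columns), the list \<open>rs\<close>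
  the pairs \<open>(i, g)\<close> (rows). Neither the basis nor the coefficients are unique, hence a relation.
\<close>

definition testing_matrix ::
    "(nat \<Rightarrow> 'a::comm_ring_1) \<Rightarrow> nat \<Rightarrow> nat \<Rightarrow> nat \<Rightarrow> 'a upoly mat \<Rightarrow> bool" where
  "testing_matrix a m d r M \<longleftrightarrow> (\<exists>cs rs.
     distinct cs \<and> set cs \<subseteq> monomial_value a ` monomials m (r + 1) \<and>
     minimal_basis class_ring (ideal_power class_ring (Idl\<^bsub>class_ring\<^esub> (a ` {1..m})) (r + 1)) (set cs) \<and>
     distinct rs \<and> set rs = {1..d} \<times> monomials m r \<and>
     M \<in> carrier_mat (length rs) (length cs) \<and>
     (\<forall>k < length rs. \<forall>l < length cs. M $$ (k, l) \<in> carrier (upoly_ring d m)) \<and>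
     (\<forall>k < length rs.
        generic_element a m (fst (rs ! k)) * uconst (monomial_value a (snd (rs ! k)))
          = (\<Sum>l < length cs. M $$ (k, l) * uconst (cs ! l))))"

definition minors :: "nat \<Rightarrow> 'a::comm_ring_1 mat \<Rightarrow> 'a set" where
  "minors h M = {det (submatrix M I J) | I J.
     I \<subseteq> {..<dim_row M} \<and> J \<subseteq> {..<dim_col M} \<and> card I = h \<and> card J = h}"

definition testing_ideal ::
    "(nat \<Rightarrow> 'a::comm_ring_1) \<Rightarrow> nat \<Rightarrow> nat \<Rightarrow> 'a upoly set \<Rightarrow> bool" where
  "testing_ideal a m d \<J> \<longleftrightarrow>
     (let \<aa> = Idl\<^bsub>class_ring\<^esub> (a ` {1..m});
          r = big_reduction_number class_ring \<aa>;
          h = min_num_gens class_ring (ideal_power class_ring \<aa> (r + 1))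
      in \<exists>M. testing_matrix a m d r M \<and> \<J> = Idl\<^bsub>upoly_ring d m\<^esub> (minors h M))"

end

theory Submission
  imports Defs
begin

text \<open>
  First inclusion: by Nakayama a minimal basis of \<open>\<aa>\<^sup>r\<^sup>+\<^sup>1\<close> has \<open>h\<close> elements, so the adjugate of an
  \<open>h \<times> h\<close> submatrix of \<open>M\<close> shows that its determinant multiplies every basis element into \<open>\<Q>\<close>.

  Second inclusion: a minimal reduction \<open>q\<close> is generated by \<open>d\<close> elements, hence is a specialization
  of \<open>\<Q>\<close>; since \<open>q \<aa>\<^sup>r = \<aa>\<^sup>r\<^sup>+\<^sup>1\<close>, some minor specializes to a unit, and specializing
  \<open>x \<J>\<^sup>n \<subseteq> \<Q>\<close> gives \<open>x \<in> q\<close>.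

  That \<open>q\<close> has at most \<open>d\<close> generators: by minimality no form with a unit value vanishes at a
  minimal generating family of \<open>q\<close> modulo \<open>\<mm>\<close>, so the fiber ring is integral over a polynomial ring
  in these generators, and lifting the chain of primes generated by the variables bounds their number
  by the Krull dimension. That the reduction numbers are bounded (otherwise the maximum in the
  definition of \<open>br\<close> is a junk value): the parameters \<open>y\<close> for which \<open>q\<^sub>y \<aa>\<^sup>n = \<aa>\<^sup>n\<^sup>+\<^sup>1\<close> form an
  increasing sequence of Zariski open sets, which stabilizes by the Hilbert basis theorem.
\<close>

section \<open>Modules over subrings of a commutative ring\<close>

text \<open>In general neither \<open>L[u]\<close> nor the Rees algebra fills a type: they are
  subsets of polynomial types. Hence the ideal theory is done for subsets closed under the
  operations of an ambient ring type, and records are unfolded to such subsets at once. The residue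
  field is never formed as a coefficient ring. A polynomial over it is replaced by one over
  \<open>L\<close> whose values are tested for membership in \<open>\<mm>\<close>, so that "nonzero"
  means "has a value outside \<open>\<mm>\<close>"; this is faithful because the residue field is
  infinite. The elements of the fiber ring are families of cosets and awkward to compute with. The
  primes are therefore chained in the Rees algebra, above the extension of \<open>\<mm>\<close>, and
  pushed down only at the end. One determinant argument, \<open>det_mult_in_submod\<close>, gives
  Nakayama's lemma, the effect of the minors on the basis, the openness of the reduction condition
  and the integrality step for primes.\<close>

definition is_subring :: "'a::comm_ring_1 set \<Rightarrow> bool" where
  "is_subring S \<longleftrightarrow> 1 \<in> S \<and> (\<forall>x\<in>S. \<forall>y\<in>S. x - y \<in> S \<and> x * y \<in> S)"

text \<open>\<open>I\<close> is an \<open>S\<close>-submodule of the ambient ring; together with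
  \<open>I \<subseteq> S\<close> it is an ideal of \<open>S\<close>. The looser form also covers
  combinations, with coefficients in \<open>S\<close>, of arbitrary ring elements.\<close>

definition is_submod :: "'a::comm_ring_1 set \<Rightarrow> 'a set \<Rightarrow> bool" where
  "is_submod S I \<longleftrightarrow> 0 \<in> I \<and> (\<forall>x\<in>I. \<forall>y\<in>I. x + y \<in> I) \<and> (\<forall>s\<in>S. \<forall>x\<in>I. s * x \<in> I)"

lemma is_subringD:
  assumes "is_subring S"
  shows "0 \<in> S" "1 \<in> S" "x \<in> S \<Longrightarrow> y \<in> S \<Longrightarrow> x + y \<in> S" "x \<in> S \<Longrightarrow> - x \<in> S"
    "x \<in> S \<Longrightarrow> y \<in> S \<Longrightarrow> x - y \<in> S" "x \<in> S \<Longrightarrow> y \<in> S \<Longrightarrow> x * y \<in> S"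
proof -
  note a = assms[unfolded is_subring_def]
  show zero: "0 \<in> S" using a by (metis diff_self)
  show neg: "- x \<in> S" if "x \<in> S" for x using a zero that by (metis diff_0)
  show "x \<in> S \<Longrightarrow> y \<in> S \<Longrightarrow> x + y \<in> S" using a neg by (metis diff_minus_eq_add)
qed (use assms in \<open>auto simp: is_subring_def\<close>)

lemma is_subring_UNIV [simp]: "is_subring UNIV"
  by (simp add: is_subring_def)

lemma is_subring_power: "is_subring S \<Longrightarrow> x \<in> S \<Longrightarrow> x ^ n \<in> S"
  by (induction n) (auto intro: is_subringD)

lemma is_subring_sum: "is_subring S \<Longrightarrow> (\<And>i. i \<in> A \<Longrightarrow> f i \<in> S) \<Longrightarrow> sum f A \<in> S"
  by (induction A rule: infinite_finite_induct) (auto intro: is_subringD)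

lemma is_subring_prod: "is_subring S \<Longrightarrow> (\<And>i. i \<in> A \<Longrightarrow> f i \<in> S) \<Longrightarrow> prod f A \<in> S"
  by (induction A rule: infinite_finite_induct) (auto intro: is_subringD)

lemma is_submodD:
  assumes "is_submod S I"
  shows "0 \<in> I" "x \<in> I \<Longrightarrow> y \<in> I \<Longrightarrow> x + y \<in> I" "s \<in> S \<Longrightarrow> x \<in> I \<Longrightarrow> s * x \<in> I"
    "s \<in> S \<Longrightarrow> x \<in> I \<Longrightarrow> x * s \<in> I"
  using assms by (auto simp: is_submod_def mult.commute)

lemma is_submod_UNIV [simp]: "is_submod UNIV UNIV"
  by (simp add: is_submod_def)

lemma is_submod_neg: "is_submod S I \<Longrightarrow> is_subring S \<Longrightarrow> x \<in> I \<Longrightarrow> - x \<in> I"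
  using is_submodD(3)[of S I "-1" x] is_subringD(2,4) by fastforce

lemma is_submod_diff: "is_submod S I \<Longrightarrow> is_subring S \<Longrightarrow> x \<in> I \<Longrightarrow> y \<in> I \<Longrightarrow> x - y \<in> I"
  using is_submodD(2)[of S I x "-y"] is_submod_neg by fastforce

lemma is_submod_sum: "is_submod S I \<Longrightarrow> (\<And>i. i \<in> A \<Longrightarrow> f i \<in> I) \<Longrightarrow> sum f A \<in> I"
  by (induction A rule: infinite_finite_induct) (auto intro: is_submodD)

lemma is_submod_cancel:
  "is_submod S I \<Longrightarrow> is_subring S \<Longrightarrow> x - y \<in> I \<Longrightarrow> x \<in> I \<longleftrightarrow> y \<in> I"
  by (metis add_diff_cancel_left' add.commute diff_add_cancel is_submodD(2) is_submod_diff)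

lemma is_submod_diff_trans:
  "is_submod S I \<Longrightarrow> x - y \<in> I \<Longrightarrow> y - z \<in> I \<Longrightarrow> x - z \<in> I"
  using is_submodD(2)[of S I "x - y" "y - z"] by simp

lemma is_submod_mult_cong:
  assumes I: "is_submod S I" and "x' \<in> S" "y \<in> S" "x - x' \<in> I" "y - y' \<in> I"
  shows "x * y - x' * y' \<in> I"
proof -
  have "x * y - x' * y' = (x - x') * y + x' * (y - y')" by (simp add: algebra_simps)
  then show ?thesis using assms by (simp add: is_submodD(2)[OF I] is_submodD(3)[OF I] is_submodD(4)[OF I])
qed

lemma is_submod_prod_cong:
  assumes "is_submod S I" "is_subring S" "\<And>i. i \<in> A \<Longrightarrow> f i \<in> S" "\<And>i. i \<in> A \<Longrightarrow> g i \<in> S"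
    and "\<And>i. i \<in> A \<Longrightarrow> f i - g i \<in> I"
  shows "prod f A - prod g A \<in> I"
  using assms
proof (induction A rule: infinite_finite_induct)
  case (insert a A)
  then show ?case
    by (auto intro!: is_submod_mult_cong is_subring_prod)
qed (auto intro: is_submodD)

lemma is_submod_power_cong:
  assumes "is_submod S I" "is_subring S" "x \<in> S" "y \<in> S" "x - y \<in> I"
  shows "x ^ n - y ^ n \<in> I"
  using is_submod_prod_cong[OF assms(1,2), of "{..<n}" "\<lambda>_. x" "\<lambda>_. y"] assms by simp

lemma is_submod_sum_cong:
  assumes "is_submod S I" "\<And>i. i \<in> A \<Longrightarrow> f i - g i \<in> I"
  shows "sum f A - sum g A \<in> I"
  using is_submod_sum[OF assms(1), of A "\<lambda>i. f i - g i"] assms(2) by (simp add: sum_subtractf)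

section \<open>Subrings and ideals as records\<close>

text \<open>Both \<open>class_ring\<close> (with \<open>S = UNIV\<close>) and
  \<open>upoly_ring\<close> (by \<open>upoly_ring_eq\<close>) have this shape, so facts on generated
  ideals are proved once.\<close>

abbreviation (input) subring_rec :: "'a::comm_ring_1 set \<Rightarrow> 'a ring" where
  "subring_rec S \<equiv> \<lparr>carrier = S, monoid.mult = (*), one = 1, zero = 0, add = (+)\<rparr>"

lemma cring_subring_rec:
  assumes "is_subring S"
  shows "cring (subring_rec S :: 'a::comm_ring_1 ring)"
proof (rule cringI)
  show "abelian_group ((subring_rec S))"
    by (rule abelian_groupI) (use is_subringD[OF assms] in \<open>auto simp: add.assoc add.commute intro: exI[of _ "- x" for x]\<close>,
        metis add.right_inverse add.commute)
  show "Group.comm_monoid ((subring_rec S))"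
    by (rule comm_monoidI) (use is_subringD[OF assms] in \<open>auto simp: ac_simps\<close>)
qed (use is_subringD[OF assms] in \<open>auto simp: algebra_simps\<close>)

lemma ideal_subring_rec_iff:
  assumes S: "is_subring S"
  shows "ideal I (subring_rec S :: 'a::comm_ring_1 ring) \<longleftrightarrow> I \<subseteq> S \<and> is_submod S I"
proof -
  let ?R = "subring_rec S :: 'a ring"
  interpret R: cring ?R by (rule cring_subring_rec[OF S])
  have ainv: "\<ominus>\<^bsub>?R\<^esub> x = - x" if "x \<in> S" for x
    by (rule R.minus_equality) (use that is_subringD[OF S] in auto)
  show ?thesis
  proof
    assume "ideal I ?R"
    then interpret ideal I ?R .
    show "I \<subseteq> S \<and> is_submod S I"
      using a_subset zero_closed a_closed I_l_closed by (auto simp: is_submod_def)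
  next
    assume I: "I \<subseteq> S \<and> is_submod S I"
    show "ideal I ?R"
    proof (rule idealI[OF R.ring_axioms])
      show "subgroup I (add_monoid ?R)"
        by (rule R.add.subgroupI)
          (use I ainv is_submodD[of S I] is_submod_neg[OF _ S, of I] in \<open>auto simp: a_inv_def\<close>)
    qed (use I is_submodD[of S I] in auto)
  qed
qed

lemma ideal_class_ring_iff: "ideal I (class_ring :: 'a::comm_ring_1 ring) \<longleftrightarrow> is_submod UNIV I"
  using ideal_subring_rec_iff[of UNIV I] by simp

lemma Idl_subring_rec_minimal:
  assumes "is_subring S" "is_submod S I" "I \<subseteq> S" "A \<subseteq> I"
  shows "Idl\<^bsub>(subring_rec S)\<^esub> A \<subseteq> I"
  using assms by (auto simp: genideal_def ideal_subring_rec_iff)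

lemma is_submod_Idl_subring_rec:
  assumes "is_subring S" "A \<subseteq> S"
  shows "is_submod S (Idl\<^bsub>(subring_rec S)\<^esub> A)" "A \<subseteq> Idl\<^bsub>(subring_rec S)\<^esub> A"
    "Idl\<^bsub>(subring_rec S)\<^esub> A \<subseteq> S"
proof -
  interpret R: cring "subring_rec S :: 'a ring"
    by (rule cring_subring_rec[OF assms(1)])
  have "ideal (Idl\<^bsub>(subring_rec S)\<^esub> A) ((subring_rec S))"
    by (rule R.genideal_ideal) (use assms in simp)
  then show "is_submod S (Idl\<^bsub>(subring_rec S)\<^esub> A)" "Idl\<^bsub>(subring_rec S)\<^esub> A \<subseteq> S"
    by (auto simp: ideal_subring_rec_iff[OF assms(1)])
qed (auto simp: genideal_def)

text \<open>Generators form a family rather than a set, so repetitions and zeros do no harm when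
  they are padded or specialized. With an ideal in place of the subring \<open>S\<close> this is the
  product of that ideal with the ideal generated by the family, see
  \<open>iprod_lin_combs\<close>.\<close>

definition lin_combs :: "'b::comm_ring_1 set \<Rightarrow> 'i set \<Rightarrow> ('i \<Rightarrow> 'b) \<Rightarrow> 'b set" where
  "lin_combs S A e = {\<Sum>i\<in>A. c i * e i | c. \<forall>i\<in>A. c i \<in> S}"

lemma is_submod_self: "is_subring S \<Longrightarrow> is_submod S S"
  using is_subringD[of S] by (auto simp: is_submod_def)

lemma is_submod_lin_combs:
  assumes S: "is_submod S T"
  shows "is_submod S (lin_combs T A e)"
  unfolding is_submod_def
proof (intro conjI ballI)
  show "0 \<in> lin_combs T A e"
    unfolding lin_combs_def using is_submodD(1)[OF S] by (force intro: exI[of _ "\<lambda>_. 0"])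
  fix x y assume "x \<in> lin_combs T A e" "y \<in> lin_combs T A e"
  then obtain c c' where "x = (\<Sum>i\<in>A. c i * e i)" "\<forall>i\<in>A. c i \<in> T"
    "y = (\<Sum>i\<in>A. c' i * e i)" "\<forall>i\<in>A. c' i \<in> T" unfolding lin_combs_def by blast
  then have "x + y = (\<Sum>i\<in>A. (c i + c' i) * e i) \<and> (\<forall>i\<in>A. c i + c' i \<in> T)"
    using is_submodD(2)[OF S] by (auto simp: sum.distrib algebra_simps)
  then show "x + y \<in> lin_combs T A e"
    unfolding lin_combs_def by (auto intro!: exI[of _ "\<lambda>i. c i + c' i"])
next
  fix s x assume "s \<in> S" "x \<in> lin_combs T A e"
  then obtain c where "x = (\<Sum>i\<in>A. c i * e i)" "\<forall>i\<in>A. c i \<in> T" unfolding lin_combs_def by blast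
  then have "s * x = (\<Sum>i\<in>A. (s * c i) * e i) \<and> (\<forall>i\<in>A. s * c i \<in> T)"
    using is_submodD(3)[OF S] \<open>s \<in> S\<close> by (auto simp: sum_distrib_left mult.assoc)
  then show "s * x \<in> lin_combs T A e"
    unfolding lin_combs_def by (auto intro!: exI[of _ "\<lambda>i. s * c i"])
qed

lemma lin_combs_minimal:
  assumes "is_submod S I" "\<And>i. i \<in> A \<Longrightarrow> e i \<in> I"
  shows "lin_combs S A e \<subseteq> I"
  unfolding lin_combs_def using assms by (auto intro!: is_submod_sum[OF assms(1)] is_submodD(3)[OF assms(1)])

lemma gen_in_lin_combs:
  assumes "is_subring S" "finite A" "i \<in> A"
  shows "e i \<in> lin_combs S A e"
proof -
  have "e i = (\<Sum>j\<in>A. (if j = i then 1 else 0) * e j)"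
    using assms by (simp add: if_distrib[of "\<lambda>x. x * _"] cong: if_cong)
  moreover have "\<forall>j\<in>A. (if j = i then 1 else 0) \<in> S" using is_subringD(1,2)[OF assms(1)] by auto
  ultimately show ?thesis unfolding lin_combs_def by (blast intro: exI[of _ "\<lambda>j. if j = i then 1 else 0"])
qed

lemma Idl_image_eq_lin_combs:
  assumes "finite A"
  shows "Idl\<^bsub>class_ring\<^esub> (e ` A) = lin_combs UNIV A e"
proof
  show "Idl\<^bsub>class_ring\<^esub> (e ` A) \<subseteq> lin_combs UNIV A e"
    using assms by (intro Idl_subring_rec_minimal) (auto intro!: is_submod_lin_combs gen_in_lin_combs)
  show "lin_combs UNIV A e \<subseteq> Idl\<^bsub>class_ring\<^esub> (e ` A)"
    using is_submod_Idl_subring_rec[of UNIV "e ` A"] by (intro lin_combs_minimal) auto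
qed

section \<open>Determinants\<close>

lemma det_in_subring:
  assumes "is_subring S" "A \<in> carrier_mat n n" "\<And>i j. i < n \<Longrightarrow> j < n \<Longrightarrow> A $$ (i, j) \<in> S"
  shows "det (A :: 'a::comm_ring_1 mat) \<in> S"
proof -
  have sg: "signof p \<in> S" for p
    using is_subringD[OF assms(1)] by (auto simp: sign_def)
  show ?thesis
    unfolding det_def'[OF assms(2)]
    by (intro is_subring_sum[OF assms(1)] is_subringD(6)[OF assms(1)] sg is_subring_prod[OF assms(1)] assms(3))
       (auto simp: permutes_def dest: permutes_in_image)
qed

lemma det_cong_mod:
  fixes A B :: "'a::comm_ring_1 mat"
  assumes I: "is_submod UNIV I" and "A \<in> carrier_mat n n" "B \<in> carrier_mat n n"
    and "\<And>i j. i < n \<Longrightarrow> j < n \<Longrightarrow> A $$ (i, j) - B $$ (i, j) \<in> I"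
  shows "det A - det B \<in> I"
  unfolding det_def'[OF assms(2)] det_def'[OF assms(3)]
  by (intro is_submod_sum_cong[OF I] is_submod_mult_cong[OF I] is_submod_prod_cong[OF I])
    (use assms(4) is_submodD(1)[OF I] in \<open>auto simp: permutes_in_image[where S = "{0..<n}", simplified]\<close>)

text \<open>Cramer's rule: \<open>adj_mat A * A\<close> is \<open>det A\<close> times the identity,
  and the cofactors are again determinants with entries in \<open>S\<close>, so applying
  \<open>adj_mat A\<close> to a vector over \<open>I\<close> stays in \<open>I\<close>.\<close>

lemma det_mult_in_submod:
  assumes S: "is_subring S" and I: "is_submod S I" and A: "A \<in> carrier_mat n n"
    and AS: "\<And>i j. i < n \<Longrightarrow> j < n \<Longrightarrow> A $$ (i, j) \<in> S"
    and Ae: "\<And>i. i < n \<Longrightarrow> (\<Sum>j<n. A $$ (i, j) * e j) \<in> I" and "k < n"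
  shows "det A * e k \<in> I"
proof -
  have adj: "adj_mat A \<in> carrier_mat n n" "adj_mat A * A = det A \<cdot>\<^sub>m 1\<^sub>m n" using adj_mat[OF A] by auto
  have adjS: "adj_mat A $$ (i, j) \<in> S" if "i < n" "j < n" for i j
  proof -
    have "det (mat_delete A j i) \<in> S"
      by (rule det_in_subring[OF S mat_delete_carrier[OF A]])
        (use A that AS in \<open>auto simp: mat_delete_def\<close>)
    moreover have "(-1) ^ (j + i) \<in> S" by (intro is_subring_power[OF S]) (use is_subringD[OF S] in auto)
    ultimately show ?thesis
      using that A is_subringD(6)[OF S] by (auto simp: adj_mat_def cofactor_def)
  qed
  have "det A * e k = (\<Sum>j<n. (det A \<cdot>\<^sub>m 1\<^sub>m n) $$ (k, j) * e j)"
    using \<open>k < n\<close> by (simp add: if_distrib[of "\<lambda>x. x * _"] if_distrib[of "\<lambda>x. det A * x"] cong: if_cong)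
  also have "\<dots> = (\<Sum>j<n. (\<Sum>i<n. adj_mat A $$ (k, i) * A $$ (i, j)) * e j)"
    unfolding adj(2)[symmetric] using \<open>k < n\<close> A adj(1)
    by (intro sum.cong) (auto simp: scalar_prod_def lessThan_atLeast0)
  also have "\<dots> = (\<Sum>i<n. adj_mat A $$ (k, i) * (\<Sum>j<n. A $$ (i, j) * e j))"
    unfolding sum_distrib_right sum_distrib_left by (subst sum.swap) (simp add: mult.assoc)
  also have "\<dots> \<in> I"
    by (intro is_submod_sum[OF I] is_submodD(3)[OF I] adjS Ae) (use \<open>k < n\<close> in auto)
  finally show ?thesis .
qed

text \<open>A weak Cauchy-Binet formula. Expanding every row of the product multilinearly leaves
  determinants of selections of \<open>n\<close> rows of \<open>N\<close>, and a repeated row gives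
  zero. For \<open>n > K\<close> there is no injective selection and the hypothesis on minors is
  void.\<close>

lemma det_mult_rows_in_ideal:
  fixes r N :: "nat \<Rightarrow> nat \<Rightarrow> 'a::comm_ring_1"
  assumes I: "is_submod UNIV I"
    and minors: "\<And>f. inj_on f {0..<n} \<Longrightarrow> f ` {0..<n} \<subseteq> {..<K} \<Longrightarrow> det (mat n n (\<lambda>(i, j). N (f i) j)) \<in> I"
  shows "det (mat n n (\<lambda>(i, j). \<Sum>k<K. r i k * N k j)) \<in> I"
proof -
  let ?a = "\<lambda>i k. vec n (\<lambda>j. r i k * N k j)"
  let ?F = "{f. (\<forall>i\<in>{0..<n}. f i \<in> {..<K}) \<and> (\<forall>i. i \<notin> {0..<n} \<longrightarrow> f i = i)}"
  have fs: "finsum_vec TYPE('a) n (?a i) {..<K} = vec n (\<lambda>j. \<Sum>k<K. r i k * N k j)" if "i < n" for i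
    by (intro eq_vecI) (auto simp: index_finsum_vec finsum_vec_closed)
  have "det (mat n n (\<lambda>(i, j). \<Sum>k<K. r i k * N k j))
      = det (mat\<^sub>r n n (\<lambda>i. finsum_vec TYPE('a) n (?a i) {..<K}))"
    by (rule arg_cong[of _ _ det]) (auto simp: fs intro!: eq_matI)
  also have "\<dots> = (\<Sum>f\<in>?F. det (mat\<^sub>r n n (\<lambda>i. ?a i (f i))))"
    by (rule det_linear_rows_sum) auto
  also have "\<dots> \<in> I"
  proof (rule is_submod_sum[OF I])
    fix f assume f: "f \<in> ?F"
    have "det (mat\<^sub>r n n (\<lambda>i. ?a i (f i))) = det (mat\<^sub>r n n (\<lambda>i. r i (f i) \<cdot>\<^sub>v vec n (\<lambda>j. N (f i) j)))"
      by (rule arg_cong[of _ _ det]) (auto intro!: eq_matI)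
    also have "\<dots> = (\<Prod>i\<in>{0..<n}. r i (f i)) * det (mat\<^sub>r n n (\<lambda>i. vec n (\<lambda>j. N (f i) j)))"
      by (rule det_rows_mul) auto
    also have "mat\<^sub>r n n (\<lambda>i. vec n (\<lambda>j. N (f i) j)) = mat n n (\<lambda>(i, j). N (f i) j)"
      by (auto intro!: eq_matI)
    finally have e: "det (mat\<^sub>r n n (\<lambda>i. ?a i (f i)))
      = (\<Prod>i\<in>{0..<n}. r i (f i)) * det (mat n n (\<lambda>(i, j). N (f i) j))" .
    have "det (mat n n (\<lambda>(i, j). N (f i) j)) \<in> I"
    proof (cases "inj_on f {0..<n}")
      case True
      then show ?thesis using f by (intro minors) auto
    next
      case False
      then obtain i j where ij: "i < n" "j < n" "i \<noteq> j" "f i = f j" by (auto simp: inj_on_def)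
      have "det (mat n n (\<lambda>(i, j). N (f i) j)) = 0"
        by (rule det_identical_rows[of _ n i j]) (use ij in \<open>auto intro!: eq_vecI\<close>)
      then show ?thesis using is_submodD(1)[OF I] by simp
    qed
    then show "det (mat\<^sub>r n n (\<lambda>i. ?a i (f i))) \<in> I" unfolding e by (intro is_submodD(3)[OF I]) auto
  qed
  finally show ?thesis .
qed

section \<open>Ideals maximal away from a set, and prime ideals\<close>

lemma exists_maximal_submod_disjoint:
  assumes S: "is_subring S" and I: "is_submod S I" "I \<subseteq> S" "I \<inter> W = {}"
  shows "\<exists>P. is_submod S P \<and> I \<subseteq> P \<and> P \<subseteq> S \<and> P \<inter> W = {} \<and>
    (\<forall>J. is_submod S J \<longrightarrow> P \<subseteq> J \<longrightarrow> J \<subseteq> S \<longrightarrow> J \<inter> W = {} \<longrightarrow> J = P)"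
proof -
  let ?X = "{J. is_submod S J \<and> I \<subseteq> J \<and> J \<subseteq> S \<and> J \<inter> W = {}}"
  have "\<exists>P\<in>?X. \<forall>J\<in>?X. P \<subseteq> J \<longrightarrow> J = P"
  proof (rule subset_Zorn_nonempty)
    show "?X \<noteq> {}" using I by auto
    fix C assume C: "C \<noteq> {}" "subset.chain ?X C"
    have "is_submod S (\<Union>C)"
      unfolding is_submod_def
    proof (intro conjI ballI)
      show "0 \<in> \<Union>C" using C by (fastforce simp: subset_chain_def dest: is_submodD(1))
      fix x y assume "x \<in> \<Union>C" "y \<in> \<Union>C"
      then obtain J K where JK: "J \<in> C" "x \<in> J" "K \<in> C" "y \<in> K" by blast
      then have "J \<subseteq> K \<or> K \<subseteq> J" using C(2) by (auto simp: subset_chain_def)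
      then obtain L where "L \<in> C" "x \<in> L" "y \<in> L" using JK by blast
      then show "x + y \<in> \<Union>C" using C(2) by (auto simp: subset_chain_def intro: is_submodD(2))
    next
      fix s x assume "s \<in> S" "x \<in> \<Union>C"
      then show "s * x \<in> \<Union>C" using C(2) by (auto simp: subset_chain_def intro: is_submodD(3))
    qed
    moreover obtain J where "J \<in> C" using C(1) by blast
    moreover from this have "I \<subseteq> J" using C(2) by (auto simp: subset_chain_def)
    ultimately show "\<Union>C \<in> ?X" using C(2) by (auto simp: subset_chain_def)
  qed
  then obtain P where P: "P \<in> ?X" "\<forall>J\<in>?X. P \<subseteq> J \<longrightarrow> J = P" by (rule bexE)
  have "\<forall>J. is_submod S J \<longrightarrow> P \<subseteq> J \<longrightarrow> J \<subseteq> S \<longrightarrow> J \<inter> W = {} \<longrightarrow> J = P"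
  proof (intro allI impI)
    fix J assume "is_submod S J" "P \<subseteq> J" "J \<subseteq> S" "J \<inter> W = {}"
    then show "J = P" using P(1) by (intro P(2)[rule_format]) auto
  qed
  then show ?thesis using P(1) by (intro exI[of _ P]) simp
qed

lemma is_submod_add_multiples:
  assumes S: "is_subring S" and P: "is_submod S P" and x: "x \<in> S"
  shows "is_submod S {p + s * x |p s. p \<in> P \<and> s \<in> S}"
  unfolding is_submod_def
proof (intro conjI ballI)
  show "0 \<in> {p + s * x |p s. p \<in> P \<and> s \<in> S}"
    using is_submodD(1)[OF P] is_subringD(1)[OF S] by (intro CollectI exI[of _ 0]) auto
  fix a b assume "a \<in> {p + s * x |p s. p \<in> P \<and> s \<in> S}" "b \<in> {p + s * x |p s. p \<in> P \<and> s \<in> S}"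
  then obtain p s p' s' where "a = p + s * x" "p \<in> P" "s \<in> S" "b = p' + s' * x" "p' \<in> P" "s' \<in> S"
    by auto
  then show "a + b \<in> {p + s * x |p s. p \<in> P \<and> s \<in> S}"
    using is_submodD(2)[OF P] is_subringD(3)[OF S]
    by (intro CollectI exI[of _ "p + p'"] exI[of _ "s + s'"]) (auto simp: algebra_simps)
next
  fix t a assume "t \<in> S" "a \<in> {p + s * x |p s. p \<in> P \<and> s \<in> S}"
  then obtain p s where "a = p + s * x" "p \<in> P" "s \<in> S" by auto
  then show "t * a \<in> {p + s * x |p s. p \<in> P \<and> s \<in> S}"
    using is_submodD(3)[OF P] is_subringD(6)[OF S] \<open>t \<in> S\<close>
    by (intro CollectI exI[of _ "t * p"] exI[of _ "t * s"]) (auto simp: distrib_left mult.assoc)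
qed

text \<open>An ideal maximal among those disjoint from a multiplicative set is prime: if neither
  factor is in \<open>P\<close>, both enlarged ideals meet \<open>W\<close>, and the product of the
  two elements found there would lie in \<open>P\<close>.\<close>

lemma exists_prime_disjoint:
  assumes S: "is_subring S" and I: "is_submod S I" "I \<subseteq> S" "I \<inter> W = {}"
    and W: "1 \<in> W" "\<And>x y. x \<in> W \<Longrightarrow> y \<in> W \<Longrightarrow> x * y \<in> W"
  obtains P where "is_submod S P" "I \<subseteq> P" "P \<subseteq> S" "P \<inter> W = {}"
    "\<And>x y. x \<in> S \<Longrightarrow> y \<in> S \<Longrightarrow> x * y \<in> P \<Longrightarrow> x \<in> P \<or> y \<in> P"
proof -
  obtain P where "is_submod S P \<and> I \<subseteq> P \<and> P \<subseteq> S \<and> P \<inter> W = {} \<and>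
    (\<forall>J. is_submod S J \<longrightarrow> P \<subseteq> J \<longrightarrow> J \<subseteq> S \<longrightarrow> J \<inter> W = {} \<longrightarrow> J = P)"
    using exists_maximal_submod_disjoint[OF S I] by (rule exE)
  then have P: "is_submod S P" "I \<subseteq> P" "P \<subseteq> S" "P \<inter> W = {}"
    "\<And>J. is_submod S J \<Longrightarrow> P \<subseteq> J \<Longrightarrow> J \<subseteq> S \<Longrightarrow> J \<inter> W = {} \<Longrightarrow> J = P"
    by simp_all
  have meet: "\<exists>p\<in>P. \<exists>s\<in>S. p + s * x \<in> W" if "x \<in> S" "x \<notin> P" for x
  proof (rule ccontr)
    assume no: "\<not> ?thesis"
    let ?J = "{p + s * x |p s. p \<in> P \<and> s \<in> S}"
    have "p \<in> ?J" if "p \<in> P" for p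
      using that is_subringD(1)[OF S] by (intro CollectI exI[of _ p] exI[of _ 0]) auto
    moreover have "x \<in> ?J"
      using is_submodD(1)[OF P(1)] is_subringD(2)[OF S] by (intro CollectI exI[of _ 0] exI[of _ 1]) auto
    moreover have "?J \<subseteq> S"
      using P(3) is_subringD[OF S] \<open>x \<in> S\<close> by auto
    moreover have "?J \<inter> W = {}" using no by auto
    ultimately have "?J = P"
      using is_submod_add_multiples[OF S P(1) \<open>x \<in> S\<close>] by (intro P(5)) auto
    then show False using \<open>x \<in> ?J\<close> \<open>x \<notin> P\<close> by simp
  qed
  have "x \<in> P \<or> y \<in> P" if xy: "x \<in> S" "y \<in> S" "x * y \<in> P" for x y
  proof (rule ccontr)
    assume "\<not> ?thesis"
    then have nx: "x \<notin> P" and ny: "y \<notin> P" by simp_all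
    obtain p s where 1: "p \<in> P" "s \<in> S" "p + s * x \<in> W" using meet[OF xy(1) nx] by (elim bexE)
    obtain p' s' where 2: "p' \<in> P" "s' \<in> S" "p' + s' * y \<in> W" using meet[OF xy(2) ny] by (elim bexE)
    note ps = 1 2
    have "(p + s * x) * (p' + s' * y) = (p' + s' * y) * p + (s * x) * p' + (s * s') * (x * y)"
      by (simp add: algebra_simps)
    also have "\<dots> \<in> P"
    proof -
      have "p' + s' * y \<in> S" "s * x \<in> S" "s * s' \<in> S"
        using ps xy P(3) by (meson is_subringD[OF S] subsetD)+
      then show ?thesis
        by (intro is_submodD(2)[OF P(1)]; intro is_submodD(3)[OF P(1) _ ps(1)] is_submodD(3)[OF P(1) _ ps(4)]
            is_submodD(3)[OF P(1) _ xy(3)])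
    qed
    finally show False using W(2)[OF ps(3,6)] P(4) by auto
  qed
  then show ?thesis by (rule that[OF P(1-4)])
qed

section \<open>Products and powers of ideals\<close>

abbreviation iprod :: "'a::comm_ring_1 set \<Rightarrow> 'a set \<Rightarrow> 'a set" where
  "iprod I J \<equiv> I \<cdot>\<^bsub>class_ring\<^esub> J"

abbreviation ipow :: "'a::comm_ring_1 set \<Rightarrow> nat \<Rightarrow> 'a set" where
  "ipow I n \<equiv> ideal_power class_ring I n"

lemmas class_ring_cring = cring_subring_rec[OF is_subring_UNIV]
lemmas class_ring_ring = cring.axioms(1)[OF class_ring_cring]

lemma iprodI: "x \<in> I \<Longrightarrow> y \<in> J \<Longrightarrow> x * y \<in> iprod I J"
  using ideal_prod.prod[of x I y J class_ring] by simp

lemma iprod_minimal: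
  assumes "is_submod UNIV K" "\<And>x y. x \<in> I \<Longrightarrow> y \<in> J \<Longrightarrow> x * y \<in> K"
  shows "iprod I J \<subseteq> K"
proof
  fix x assume "x \<in> iprod I J"
  then show "x \<in> K"
    by (induction rule: ideal_prod.induct) (use assms is_submodD(2)[OF assms(1)] in auto)
qed

lemma is_submod_iprod: "is_submod UNIV I \<Longrightarrow> is_submod UNIV J \<Longrightarrow> is_submod UNIV (iprod I J)"
  using ring.ideal_prod_is_ideal[OF class_ring_ring, of I J] by (simp add: ideal_class_ring_iff)

lemma iprod_commute: "is_submod UNIV I \<Longrightarrow> is_submod UNIV J \<Longrightarrow> iprod I J = iprod J I"
  using cring.ideal_prod_commute[OF class_ring_cring, of I J] by (simp add: ideal_class_ring_iff)

lemma iprod_assoc: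
  "is_submod UNIV I \<Longrightarrow> is_submod UNIV J \<Longrightarrow> is_submod UNIV K \<Longrightarrow>
    iprod (iprod I J) K = iprod I (iprod J K)"
  using ring.ideal_prod_assoc[OF class_ring_ring, of I J K] by (simp add: ideal_class_ring_iff)

lemma iprod_mono: "I \<subseteq> I' \<Longrightarrow> J \<subseteq> J' \<Longrightarrow> is_submod UNIV I' \<Longrightarrow> is_submod UNIV J' \<Longrightarrow> iprod I J \<subseteq> iprod I' J'"
  by (intro iprod_minimal is_submod_iprod) (auto intro: iprodI)

lemma iprod_UNIV: "is_submod UNIV I \<Longrightarrow> iprod I UNIV = I"
  using ring.ideal_prod_one[OF class_ring_ring, of I] by (simp add: ideal_class_ring_iff)

lemma iprod_subset: "is_submod UNIV J \<Longrightarrow> iprod I J \<subseteq> J"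
  by (intro iprod_minimal) (auto intro: is_submodD)

lemma ideals_set_simps [simp]:
  "monoid.mult (ideals_set R) = ideal_prod R" "one (ideals_set R) = carrier R"
  by (simp_all add: ideals_set_def)

lemma ipow_Suc: "ipow I (Suc n) = iprod (ipow I n) I"
  by simp

lemma is_submod_ipow: "is_submod UNIV I \<Longrightarrow> is_submod UNIV (ipow I n)"
  by (induction n) (auto simp: ipow_Suc is_submod_UNIV intro: is_submod_iprod)

lemma ipow_add: "is_submod UNIV I \<Longrightarrow> ipow I (n + k) = iprod (ipow I n) (ipow I k)"
proof (induction k)
  case 0
  then show ?case by (simp add: iprod_UNIV is_submod_ipow)
next
  case (Suc k)
  then show ?case by (simp add: ipow_Suc iprod_assoc is_submod_ipow)
qed

lemma ipow_mult: "is_submod UNIV I \<Longrightarrow> x \<in> ipow I n \<Longrightarrow> y \<in> ipow I k \<Longrightarrow> x * y \<in> ipow I (n + k)"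
  by (simp add: ipow_add iprodI)

lemma iprod_lin_combs:
  assumes "is_submod UNIV J" "finite A"
  shows "iprod (lin_combs UNIV A e) J = {\<Sum>i\<in>A. e i * y i | y. \<forall>i\<in>A. y i \<in> J}"
proof
  have eq: "{\<Sum>i\<in>A. e i * y i | y. \<forall>i\<in>A. y i \<in> J} = lin_combs J A e"
    by (simp add: lin_combs_def mult.commute)
  have "x * y \<in> lin_combs J A e" if x: "x \<in> lin_combs UNIV A e" and "y \<in> J" for x y
  proof -
    obtain c where "x = (\<Sum>i\<in>A. c i * e i)" using x by (auto simp: lin_combs_def)
    then have "x * y = (\<Sum>i\<in>A. (c i * y) * e i)" unfolding \<open>x = _\<close> sum_distrib_right
      by (intro sum.cong) (auto simp: algebra_simps)
    moreover have "\<forall>i\<in>A. c i * y \<in> J" using that is_submodD(3)[OF assms(1)] by auto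
    ultimately show ?thesis unfolding lin_combs_def by (blast intro: exI[of _ "\<lambda>i. c i * y"])
  qed
  then show "iprod (lin_combs UNIV A e) J \<subseteq> {\<Sum>i\<in>A. e i * y i | y. \<forall>i\<in>A. y i \<in> J}"
    unfolding eq by (intro iprod_minimal is_submod_lin_combs assms)
  have "is_submod UNIV (iprod (lin_combs UNIV A e) J)"
    by (intro is_submod_iprod is_submod_lin_combs assms is_submod_UNIV)
  then show "{\<Sum>i\<in>A. e i * y i | y. \<forall>i\<in>A. y i \<in> J} \<subseteq> iprod (lin_combs UNIV A e) J"
    using gen_in_lin_combs[OF is_subring_UNIV assms(2), of _ e]
    by (auto intro!: is_submod_sum iprodI)
qed

section \<open>Noetherian local rings\<close>

text \<open>The hypotheses in the form in which they are used. Locality becomes invertibility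
  outside \<open>\<mm>\<close>. Infinity of the residue field says that finitely many residue
  classes never exhaust the ring; it later yields a point of a line where two polynomials are both
  units.\<close>

locale noeth_local =
  fixes \<mm> :: "'a::comm_ring_1 set"
  assumes m_submod: "is_submod UNIV \<mm>"
    and one_notin_m: "1 \<notin> \<mm>"
    and unit_outside_m: "x \<notin> \<mm> \<Longrightarrow> x dvd 1"
    and residue_infinite: "finite F \<Longrightarrow> \<exists>x. \<forall>y\<in>F. x - y \<notin> \<mm>"
    and finitely_generated: "is_submod UNIV (I :: 'a set) \<Longrightarrow> \<exists>n e. I = lin_combs UNIV {..<n::nat} e"

lemma noeth_localI:
  fixes \<mm> :: "'a::comm_ring_1 set"
  assumes N: "noetherian_ring (class_ring :: 'a ring)" and L: "is_local_ring class_ring \<mm>"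
    and inf: "infinite (carrier (class_ring Quot \<mm>))"
  shows "noeth_local \<mm>"
proof
  have max: "maximalideal \<mm> class_ring" and uniq: "\<And>I. maximalideal I class_ring \<Longrightarrow> I = \<mm>"
    using L unfolding is_local_ring_def by auto
  interpret M: maximalideal \<mm> "class_ring :: 'a ring" by (rule max)
  show m: "is_submod UNIV \<mm>" using M.ideal_axioms by (simp add: ideal_class_ring_iff)
  show one: "1 \<notin> \<mm>"
    using M.I_notcarr is_submodD(3)[OF m, of _ 1] by auto
  show "x dvd 1" if x: "x \<notin> \<mm>" for x
  proof (rule ccontr)
    assume nd: "\<not> x dvd 1"
    \<comment> \<open>If \<open>x\<close> is no unit, its multiples form an ideal without 1; an
      ideal maximal among those without 1 is a maximal ideal, hence equal to
      \<open>\<mm>\<close>.\<close>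
    have 1: "is_submod UNIV {y. x dvd y}" by (auto simp: is_submod_def)
    have "{y. x dvd y} \<inter> {1} = {}" using nd by auto
    from exists_maximal_submod_disjoint[OF is_subring_UNIV 1 subset_UNIV this]
    obtain P where "is_submod UNIV P \<and> {y. x dvd y} \<subseteq> P \<and> P \<subseteq> UNIV \<and> P \<inter> {1} = {} \<and>
      (\<forall>J. is_submod UNIV J \<longrightarrow> P \<subseteq> J \<longrightarrow> J \<subseteq> UNIV \<longrightarrow> J \<inter> {1} = {} \<longrightarrow> J = P)"
      by (rule exE)
    then have P: "is_submod UNIV P" "{y. x dvd y} \<subseteq> P" "P \<inter> {1} = {}"
      "\<And>J. is_submod UNIV J \<Longrightarrow> P \<subseteq> J \<Longrightarrow> J \<inter> {1} = {} \<Longrightarrow> J = P"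
      by simp_all
    have "maximalideal P class_ring"
    proof (rule maximalidealI)
      show "ideal P class_ring" using P by (simp add: ideal_class_ring_iff)
      show "carrier class_ring \<noteq> P" using P by auto
      fix J :: "'a set" assume J: "ideal J class_ring" "P \<subseteq> J"
      show "J = P \<or> J = carrier class_ring"
      proof (cases "1 \<in> J")
        case True
        then have "y \<in> J" for y using is_submodD(3)[of UNIV J y 1] J by (simp add: ideal_class_ring_iff)
        then show ?thesis by auto
      next
        case False
        then show ?thesis using P(4)[of J] J by (auto simp: ideal_class_ring_iff)
      qed
    qed
    then have "P = \<mm>" by (rule uniq)
    then have "x \<in> \<mm>" using P(2) by (metis dvd_refl mem_Collect_eq subsetD)
    then show False using x by blast
  qed
  show "\<exists>x. \<forall>y\<in>F. x - y \<notin> \<mm>" if "finite F" for F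
  proof (rule ccontr)
    assume "\<not> ?thesis"
    then have *: "\<forall>x. \<exists>y\<in>F. x - y \<in> \<mm>" by blast
    have "carrier (class_ring Quot \<mm>) \<subseteq> (\<lambda>y. \<mm> +>\<^bsub>class_ring\<^esub> y) ` F"
    proof
      fix X assume "X \<in> carrier (class_ring Quot \<mm>)"
      then obtain x where X: "X = \<mm> +>\<^bsub>class_ring\<^esub> x"
        by (auto simp: FactRing_def A_RCOSETS_def')
      obtain y where y: "y \<in> F" "x - y \<in> \<mm>" using * by blast
      have "\<mm> +>\<^bsub>class_ring\<^esub> x = \<mm> +>\<^bsub>class_ring\<^esub> y"
      proof -
        have "\<exists>h'\<in>\<mm>. h + x = h' + y" if "h \<in> \<mm>" for h
          using is_submodD(2)[OF m that y(2)] by (intro bexI[of _ "h + (x - y)"]) auto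
        moreover have "\<exists>h'\<in>\<mm>. h + y = h' + x" if "h \<in> \<mm>" for h
          using is_submod_diff[OF m is_subring_UNIV that y(2)] by (intro bexI[of _ "h - (x - y)"]) auto
        ultimately show ?thesis by (auto simp: a_r_coset_def')
      qed
      then show "X \<in> (\<lambda>y. \<mm> +>\<^bsub>class_ring\<^esub> y) ` F" using X y by auto
    qed
    then show False using inf that finite_surj by blast
  qed
  show "\<exists>n e. I = lin_combs UNIV {..<n::nat} e" if I: "is_submod UNIV I" for I :: "'a set"
  proof -
    obtain A where A: "finite A" "I = Idl\<^bsub>class_ring\<^esub> A"
      using noetherian_ring.finetely_gen[OF N, of I] I by (auto simp: ideal_class_ring_iff)
    obtain n and e :: "nat \<Rightarrow> 'a" where "A = e ` {..<n}"
      using A(1) by (metis finite_imp_nat_seg_image_inj_on lessThan_def)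
    then show ?thesis using A Idl_image_eq_lin_combs[of "{..<n}" e] by blast
  qed
qed

context noeth_local
begin

lemma m_prime: "x * y \<in> \<mm> \<longleftrightarrow> x \<in> \<mm> \<or> y \<in> \<mm>"
proof
  assume xy: "x * y \<in> \<mm>"
  show "x \<in> \<mm> \<or> y \<in> \<mm>"
  proof (rule disjCI)
    assume "y \<notin> \<mm>"
    then obtain z where "1 = y * z" using unit_outside_m by (metis dvdE)
    then have "x * (y * z) = x" by simp
    then have "x = z * (x * y)" by (simp add: ac_simps)
    then show "x \<in> \<mm>" using is_submodD(3)[OF m_submod _ xy, of z] by simp
  qed
qed (auto intro: is_submodD[OF m_submod])

lemma m_prime_power: "x \<notin> \<mm> \<Longrightarrow> x ^ n \<notin> \<mm>"
  by (induction n) (auto simp: m_prime one_notin_m)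

lemma unit_cancel: "is_submod UNIV I \<Longrightarrow> u \<notin> \<mm> \<Longrightarrow> u * x \<in> I \<Longrightarrow> x \<in> I"
proof -
  assume *: "is_submod UNIV I" "u \<notin> \<mm>" "u * x \<in> I"
  then obtain z where "1 = u * z" using unit_outside_m by (metis dvdE)
  then have "x * (u * z) = x" by simp
  then have "x = z * (u * x)" by (simp add: ac_simps)
  then show "x \<in> I" using is_submodD(3)[OF *(1) _ *(3), of z] by simp
qed

text \<open>The determinant trick: modulo \<open>N'\<close> the generators of \<open>N\<close> solve
  a homogeneous square system whose matrix is congruent to the identity modulo \<open>\<mm>\<close>,
  so Cramer's rule multiplies each of them into \<open>N'\<close> by a unit.\<close>

lemma nakayama:
  assumes N: "is_submod UNIV N" and N': "is_submod UNIV N'"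
    and sub: "\<And>x. x \<in> N \<Longrightarrow> \<exists>y\<in>N'. x - y \<in> iprod \<mm> N"
  shows "N \<subseteq> N'"
proof -
  obtain n and e :: "nat \<Rightarrow> 'a" where Ne: "N = lin_combs UNIV {..<n} e" using finitely_generated[OF N] by blast
  have gen: "e i \<in> N" if "i < n" for i using that gen_in_lin_combs[of UNIV "{..<n}" i e] by (simp add: Ne)
  have "iprod \<mm> N = {\<Sum>i<n. e i * y i | y. \<forall>i<n. y i \<in> \<mm>}"
    using iprod_lin_combs[OF m_submod, of "{..<n}" e] iprod_commute[OF m_submod N] by (simp add: Ne Ball_def)
  then have "\<exists>c. (\<forall>j<n. c j \<in> \<mm>) \<and> e i - (\<Sum>j<n. e j * c j) \<in> N'" if i: "i < n" for i
  proof -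
    assume *: "iprod \<mm> N = {\<Sum>i<n. e i * y i | y. \<forall>i<n. y i \<in> \<mm>}"
    obtain y where y: "y \<in> N'" "e i - y \<in> iprod \<mm> N" using sub[OF gen[OF i]] by blast
    then obtain c where "\<forall>j<n. c j \<in> \<mm>" "e i - y = (\<Sum>j<n. e j * c j)" using * by auto
    then show ?thesis using y by (intro exI[of _ c]) (auto simp: algebra_simps)
  qed
  then obtain c where c: "\<And>i j. i < n \<Longrightarrow> j < n \<Longrightarrow> c i j \<in> \<mm>"
    "\<And>i. i < n \<Longrightarrow> e i - (\<Sum>j<n. e j * c i j) \<in> N'" by metis
  define A where "A = mat n n (\<lambda>(i, j). (if i = j then 1 else 0) - c i j)"
  have A: "A \<in> carrier_mat n n" by (simp add: A_def)
  have Ae: "(\<Sum>j<n. A $$ (i, j) * e j) \<in> N'" if "i < n" for i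
  proof -
    have "(\<Sum>j<n. A $$ (i, j) * e j) = (\<Sum>j<n. (if i = j then e j else 0) - e j * c i j)"
      using that by (intro sum.cong) (auto simp: A_def algebra_simps)
    also have "\<dots> = e i - (\<Sum>j<n. e j * c i j)"
      using that by (simp add: sum_subtractf)
    finally show ?thesis using c(2)[OF that] by simp
  qed
  have "det A - det (1\<^sub>m n) \<in> \<mm>"
    by (rule det_cong_mod[OF m_submod A])
      (use c(1) is_submod_neg[OF m_submod is_subring_UNIV] in \<open>auto simp: A_def\<close>)
  then have "det A \<notin> \<mm>"
    using is_submod_cancel[OF m_submod is_subring_UNIV] one_notin_m by fastforce
  then have "e k \<in> N'" if "k < n" for k
    using det_mult_in_submod[OF is_subring_UNIV N' A _ Ae that] unit_cancel[OF N'] by simp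
  then show ?thesis unfolding Ne by (intro lin_combs_minimal N') auto
qed

text \<open>A relation with a unit coefficient could be solved for that basis element, which would
  then be redundant. This is the linear independence of the basis in
  \<open>I / \<mm> I\<close>.\<close>

lemma minimal_basis_relation:
  fixes cs :: "'a list"
  assumes mb: "minimal_basis class_ring I (set cs)" and d: "distinct cs"
    and rel: "(\<Sum>l<length cs. c l * cs ! l) = 0" and l: "l < length cs"
  shows "c l \<in> \<mm>"
proof (rule ccontr)
  assume "c l \<notin> \<mm>"
  let ?B = "set cs - {cs ! l}"
  let ?J = "Idl\<^bsub>class_ring\<^esub> ?B"
  have J: "is_submod UNIV ?J" "?B \<subseteq> ?J" using is_submod_Idl_subring_rec[of UNIV ?B] by auto
  have "c l * cs ! l = - (\<Sum>k\<in>{..<length cs} - {l}. c k * cs ! k)"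
    using rel l by (simp add: sum.remove[of _ l] eq_neg_iff_add_eq_0)
  also have "\<dots> \<in> ?J"
  proof (intro is_submod_neg[OF J(1) is_subring_UNIV] is_submod_sum[OF J(1)])
    fix k assume "k \<in> {..<length cs} - {l}"
    then have "cs ! k \<in> ?B" using d l by (auto simp: nth_eq_iff_index_eq)
    then show "c k * cs ! k \<in> ?J" using J by (auto intro: is_submodD(3)[OF J(1)])
  qed
  finally have "cs ! l \<in> ?J" using unit_cancel[OF J(1) \<open>c l \<notin> \<mm>\<close>] by simp
  then have "set cs \<subseteq> ?J" using J by auto
  then have "Idl\<^bsub>class_ring\<^esub> (set cs) \<subseteq> ?J"
    using J Idl_subring_rec_minimal[of UNIV ?J "set cs"] by auto
  moreover have "?J \<subseteq> Idl\<^bsub>class_ring\<^esub> (set cs)"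
    using is_submod_Idl_subring_rec[of UNIV "set cs"] by (intro Idl_subring_rec_minimal) auto
  moreover have "Idl\<^bsub>class_ring\<^esub> (set cs) = I" using mb unfolding minimal_basis_def by blast
  ultimately have "?J = I" by (simp only: subset_antisym)
  moreover have "?B \<subset> set cs" using nth_mem[OF l] by (intro psubsetI) auto
  then have "?J \<noteq> I" using mb unfolding minimal_basis_def by blast
  ultimately show False by contradiction
qed

text \<open>The rows of \<open>A - 1\<close> are relations among the \<open>e l\<close>, so their
  entries lie in \<open>\<mm>\<close> and \<open>det A\<close> is 1 modulo
  \<open>\<mm>\<close>.\<close>

lemma det_notin_m_of_identity:
  fixes e :: "nat \<Rightarrow> 'a"
  assumes A: "A \<in> carrier_mat n n"
    and rel: "\<And>c l. (\<Sum>l<n. c l * e l) = 0 \<Longrightarrow> l < n \<Longrightarrow> c l \<in> \<mm>"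
    and id: "\<And>i. i < n \<Longrightarrow> (\<Sum>j<n. A $$ (i, j) * e j) = e i"
  shows "det A \<notin> \<mm>"
proof -
  have "A $$ (i, j) - 1\<^sub>m n $$ (i, j) \<in> \<mm>" if "i < n" "j < n" for i j
  proof -
    have "(\<Sum>l<n. (A $$ (i, l) - 1\<^sub>m n $$ (i, l)) * e l) = (\<Sum>l<n. A $$ (i, l) * e l) - (\<Sum>l<n. if i = l then e l else 0)"
      unfolding sum_subtractf[symmetric] using that by (intro sum.cong) (auto simp: algebra_simps)
    also have "\<dots> = 0" using that id by simp
    finally show ?thesis using rel[of "\<lambda>l. A $$ (i, l) - 1\<^sub>m n $$ (i, l)" j] that(2) by simp
  qed
  then have "det A - det (1\<^sub>m n) \<in> \<mm>"
    by (intro det_cong_mod[OF m_submod A]) auto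
  then show ?thesis
    using is_submod_cancel[OF m_submod is_subring_UNIV] one_notin_m by fastforce
qed

text \<open>This replaces the dimension of \<open>I / \<mm> I\<close>: expressing the basis through
  \<open>n\<close> generators, and these back through the basis, factors a matrix of unit
  determinant through \<open>n\<close> rows, which is impossible when \<open>n\<close> is below the
  length of the basis.\<close>

lemma length_minimal_basis:
  fixes cs :: "'a list"
  assumes mb: "minimal_basis class_ring I (set cs)" and d: "distinct cs"
  shows "min_num_gens class_ring I = length cs"
  unfolding min_num_gens_def
proof (rule Least_equality)
  have I: "I = lin_combs UNIV {..<length cs} ((!) cs)"
    using mb Idl_image_eq_lin_combs[of "{..<length cs}" "(!) cs"]
    by (simp add: minimal_basis_def nth_image flip: atLeast0LessThan)
  show "\<exists>S\<subseteq>carrier class_ring. finite S \<and> card S = length cs \<and> Idl\<^bsub>class_ring\<^esub> S = I"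
    using mb d by (intro exI[of _ "set cs"]) (auto simp: distinct_card minimal_basis_def)
  fix n assume "\<exists>S\<subseteq>carrier class_ring. finite S \<and> card S = n \<and> Idl\<^bsub>class_ring\<^esub> S = I"
  then obtain S where S: "finite S" "card S = n" "Idl\<^bsub>class_ring\<^esub> S = I" by blast
  then obtain e where e: "S = e ` {..<n}"
    using ex_bij_betw_nat_finite[OF S(1)] by (auto simp: bij_betw_def atLeast0LessThan)
  have Ie: "I = lin_combs UNIV {..<n} e" using S Idl_image_eq_lin_combs[of "{..<n}" e] by (simp add: e)
  show "length cs \<le> n"
  proof (rule ccontr)
    assume less: "\<not> length cs \<le> n"
    let ?h = "length cs"
    have "\<exists>r. cs ! i = (\<Sum>k<n. r k * e k)" if "i < ?h" for i
      using gen_in_lin_combs[of UNIV "{..<?h}" i "(!) cs"] that I Ie by (auto simp: lin_combs_def)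
    then obtain r where r: "\<And>i. i < ?h \<Longrightarrow> cs ! i = (\<Sum>k<n. r i k * e k)" by metis
    have "\<exists>N. e k = (\<Sum>j<?h. N j * cs ! j)" if "k < n" for k
      using gen_in_lin_combs[of UNIV "{..<n}" k e] that I Ie by (auto simp: lin_combs_def)
    then obtain N where N: "\<And>k. k < n \<Longrightarrow> e k = (\<Sum>j<?h. N k j * cs ! j)" by metis
    let ?A = "mat ?h ?h (\<lambda>(i, j). \<Sum>k<n. r i k * N k j)"
    have "det ?A \<in> \<mm>"
    proof (rule det_mult_rows_in_ideal[OF m_submod])
      fix f assume "inj_on f {0..<?h}" "f ` {0..<?h} \<subseteq> {..<n}"
      then have "?h \<le> n" using card_inj_on_le[of f "{0..<?h}" "{..<n}"] by simp
      then show "det (mat ?h ?h (\<lambda>(i, j). N (f i) j)) \<in> \<mm>" using less by simp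
    qed
    moreover have "det ?A \<notin> \<mm>"
    proof (rule det_notin_m_of_identity[where e = "(!) cs"])
      show "c l \<in> \<mm>" if "(\<Sum>l<?h. c l * cs ! l) = 0" "l < ?h" for c l
        by (rule minimal_basis_relation[OF mb d that])
      fix i assume i: "i < ?h"
      have "(\<Sum>j<?h. ?A $$ (i, j) * cs ! j) = (\<Sum>j<?h. \<Sum>k<n. r i k * N k j * cs ! j)"
        using i by (simp add: sum_distrib_right)
      also have "\<dots> = (\<Sum>k<n. r i k * (\<Sum>j<?h. N k j * cs ! j))"
        by (subst sum.swap) (simp add: sum_distrib_left mult.assoc)
      also have "\<dots> = cs ! i" using N r[OF i] by simp
      finally show "(\<Sum>j<?h. ?A $$ (i, j) * cs ! j) = cs ! i" .
    qed simp
    ultimately show False by simp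
  qed
qed

end

section \<open>Evaluation of polynomials\<close>

definition mon_eval :: "('v \<Rightarrow> 'b::comm_ring_1) \<Rightarrow> ('v \<Rightarrow>\<^sub>0 nat) \<Rightarrow> 'b" where
  "mon_eval y e = (\<Prod>v\<in>Poly_Mapping.keys e. y v ^ Poly_Mapping.lookup e v)"

text \<open>The coefficient map \<open>h\<close> allows values in another ring: \<open>L\<close>
  itself for specialization, and \<open>'a poly\<close> both for recording degrees and for
  restricting a polynomial to a line.\<close>

definition poly_eval ::
    "('a::comm_ring_1 \<Rightarrow> 'b::comm_ring_1) \<Rightarrow> ('v \<Rightarrow> 'b) \<Rightarrow> (('v \<Rightarrow>\<^sub>0 nat) \<Rightarrow>\<^sub>0 'a) \<Rightarrow> 'b" where
  "poly_eval h y f = (\<Sum>e\<in>Poly_Mapping.keys f. h (Poly_Mapping.lookup f e) * mon_eval y e)"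

lemma mon_eval_superset:
  assumes "finite V" "Poly_Mapping.keys e \<subseteq> V"
  shows "mon_eval y e = (\<Prod>v\<in>V. y v ^ Poly_Mapping.lookup e v)"
  unfolding mon_eval_def using assms by (intro prod.mono_neutral_left) (auto simp: in_keys_iff)

lemma mon_eval_add: "mon_eval y (e + e') = mon_eval y e * mon_eval y e'"
proof -
  let ?V = "Poly_Mapping.keys e \<union> Poly_Mapping.keys e'"
  have "Poly_Mapping.keys (e + e') \<subseteq> ?V" by (rule keys_add)
  then show ?thesis
    by (simp add: mon_eval_superset[of ?V] lookup_add power_add prod.distrib)
qed

lemma mon_eval_0 [simp]: "mon_eval y 0 = 1"
  by (simp add: mon_eval_def)

lemma mon_eval_single [simp]: "mon_eval y (Poly_Mapping.single v n) = y v ^ n"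
  by (simp add: mon_eval_def)

lemma poly_mapping_eq_sum_single:
  "f = (\<Sum>k\<in>Poly_Mapping.keys f. Poly_Mapping.single k (Poly_Mapping.lookup f k))"
proof (rule poly_mapping_eqI)
  fix k
  have "(\<Sum>x\<in>Poly_Mapping.keys f. Poly_Mapping.lookup (Poly_Mapping.single x (Poly_Mapping.lookup f x)) k)
      = (\<Sum>x\<in>Poly_Mapping.keys f. if x = k then Poly_Mapping.lookup f k else 0)"
    by (intro sum.cong) (auto simp: lookup_single when_def)
  then show "Poly_Mapping.lookup f k
      = Poly_Mapping.lookup (\<Sum>k\<in>Poly_Mapping.keys f. Poly_Mapping.single k (Poly_Mapping.lookup f k)) k"
    by (simp add: lookup_sum in_keys_iff)
qed

context comm_ring_hom
begin

lemma poly_eval_add: "poly_eval hom y (f + g) = poly_eval hom y f + poly_eval hom y g"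
  unfolding poly_eval_def
  using setsum_keys_plus_distrib[of "\<lambda>e c. hom c * mon_eval y e" f g]
  by (simp add: hom_add distrib_right)

lemma poly_eval_single [simp]: "poly_eval hom y (Poly_Mapping.single e c) = hom c * mon_eval y e"
  by (cases "c = 0") (simp_all add: poly_eval_def)

lemma poly_eval_0 [simp]: "poly_eval hom y 0 = 0"
  by (simp add: poly_eval_def)

lemma poly_eval_1 [simp]: "poly_eval hom y 1 = 1"
  by (simp add: poly_eval_def)

lemma poly_eval_sum: "poly_eval hom y (sum f A) = (\<Sum>i\<in>A. poly_eval hom y (f i))"
  by (induction A rule: infinite_finite_induct) (auto simp: poly_eval_add)

lemma poly_eval_mult: "poly_eval hom y (f * g) = poly_eval hom y f * poly_eval hom y g"
proof -
  let ?s = "\<lambda>f k. Poly_Mapping.single k (Poly_Mapping.lookup f k)"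
  have "f * g = (\<Sum>k\<in>Poly_Mapping.keys f. ?s f k) * (\<Sum>l\<in>Poly_Mapping.keys g. ?s g l)"
    by (metis poly_mapping_eq_sum_single)
  also have "\<dots> = (\<Sum>k\<in>Poly_Mapping.keys f. \<Sum>l\<in>Poly_Mapping.keys g. ?s f k * ?s g l)"
    by (rule sum_product)
  finally have "poly_eval hom y (f * g) = (\<Sum>k\<in>Poly_Mapping.keys f. \<Sum>l\<in>Poly_Mapping.keys g.
      poly_eval hom y (?s f k) * poly_eval hom y (?s g l))"
    by (simp add: poly_eval_sum mult_single hom_mult mon_eval_add mult_ac)
  also have "\<dots> = poly_eval hom y f * poly_eval hom y g"
    by (simp add: sum_product poly_eval_def[of hom y f] poly_eval_def[of hom y g])
  finally show ?thesis .
qed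

lemma comm_ring_hom_poly_eval: "comm_ring_hom (poly_eval hom y)"
  by unfold_locales (auto simp: poly_eval_add poly_eval_mult)

end

lemma poly_eval_hom_comp:
  assumes "comm_ring_hom g"
  shows "g (poly_eval h y f) = poly_eval (\<lambda>c. g (h c)) (\<lambda>v. g (y v)) f"
proof -
  interpret comm_ring_hom g by (rule assms)
  show ?thesis by (simp add: poly_eval_def mon_eval_def hom_sum hom_mult hom_prod hom_power)
qed

lemma poly_eval_in_subring:
  assumes "is_subring S" "\<And>c. h c \<in> S" "\<And>v. y v \<in> S"
  shows "poly_eval h y f \<in> S"
  unfolding poly_eval_def mon_eval_def
  by (intro is_subring_sum is_subringD(6) is_subring_prod is_subring_power assms)

lemma poly_eval_cong_mod:
  assumes I: "is_submod S I" and S: "is_subring S" and "\<And>c. h c \<in> S" "\<And>v. y v \<in> S" "\<And>v. z v \<in> S"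
    and "\<And>v. y v - z v \<in> I"
  shows "poly_eval h y f - poly_eval h z f \<in> I"
  unfolding poly_eval_def mon_eval_def
  by (intro is_submod_sum_cong[OF I] is_submod_mult_cong[OF I] is_submod_prod_cong[OF I S]
      is_submod_power_cong[OF I S] is_subring_prod[OF S] is_subring_power[OF S] assms)
    (simp_all add: is_submodD(1)[OF I])

lemma comm_ring_hom_ident: "comm_ring_hom (\<lambda>x::'a::comm_ring_1. x)"
  by unfold_locales auto

lemma comm_ring_hom_const_poly: "comm_ring_hom (\<lambda>c::'a::comm_ring_1. [:c:])"
  by unfold_locales (auto simp: one_pCons)

lemma comm_ring_hom_poly: "comm_ring_hom (\<lambda>p. poly p (t::'a::comm_ring_1))"
  by unfold_locales auto

section \<open>The polynomial ring in the \<open>u\<^sub>i\<^sub>j\<close>\<close>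

definition upolys :: "nat \<Rightarrow> nat \<Rightarrow> 'a::comm_ring_1 upoly set" where
  "upolys d m = {p. \<forall>e\<in>Poly_Mapping.keys p. Poly_Mapping.keys e \<subseteq> {1..d} \<times> {1..m}}"

lemma upoly_ring_eq: "upoly_ring d m = subring_rec (upolys d m)"
  by (simp add: upoly_ring_def upolys_def)

lemma is_subring_upolys: "is_subring (upolys d m)"
  unfolding is_subring_def
proof (intro conjI ballI)
  show "1 \<in> upolys d m" by (simp add: upolys_def)
  fix x y :: "'a upoly" assume xy: "x \<in> upolys d m" "y \<in> upolys d m"
  have "Poly_Mapping.keys (x - y) \<subseteq> Poly_Mapping.keys x \<union> Poly_Mapping.keys y"
    by (auto simp: in_keys_iff lookup_minus)
  then show "x - y \<in> upolys d m" using xy by (auto simp: upolys_def)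
  show "x * y \<in> upolys d m"
    unfolding upolys_def
  proof (intro CollectI ballI)
    fix e assume "e \<in> Poly_Mapping.keys (x * y)"
    then obtain k l where "e = k + l" "k \<in> Poly_Mapping.keys x" "l \<in> Poly_Mapping.keys y"
      using keys_mult[of x y] by blast
    moreover from this have "Poly_Mapping.keys k \<subseteq> {1..d} \<times> {1..m}" "Poly_Mapping.keys l \<subseteq> {1..d} \<times> {1..m}"
      using xy by (simp_all add: upolys_def)
    ultimately show "Poly_Mapping.keys e \<subseteq> {1..d} \<times> {1..m}" using keys_add[of k l] by blast
  qed
qed

lemma uconst_in_upolys [simp]: "uconst c \<in> upolys d m"
  by (simp add: uconst_def upolys_def)

lemma generic_element_in_upolys: "i \<in> {1..d} \<Longrightarrow> generic_element a m i \<in> upolys d m"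
  unfolding generic_element_def
  by (intro is_subring_sum is_subringD(6) is_subring_upolys uconst_in_upolys)
    (auto simp: uvar_def upolys_def)

lemma uconst_hom: "comm_ring_hom uconst"
  by unfold_locales (auto simp: uconst_def single_add mult_single)

abbreviation specialize :: "(nat \<times> nat \<Rightarrow> 'a::comm_ring_1) \<Rightarrow> 'a upoly \<Rightarrow> 'a" where
  "specialize \<equiv> poly_eval (\<lambda>c. c)"

lemma specialize_hom: "comm_ring_hom (specialize y)"
  using comm_ring_hom.comm_ring_hom_poly_eval[OF comm_ring_hom_ident] .

lemma specialize_uconst [simp]: "specialize y (uconst c) = c"
  by (simp add: uconst_def comm_ring_hom.poly_eval_single[OF comm_ring_hom_ident])

lemma specialize_uvar [simp]: "specialize y (uvar i j) = y (i, j)"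
  by (simp add: uvar_def comm_ring_hom.poly_eval_single[OF comm_ring_hom_ident])

lemma specialize_generic_element: "specialize y (generic_element a m i) = (\<Sum>j\<in>{1..m}. y (i, j) * a j)"
proof -
  interpret comm_ring_hom "specialize y" by (rule specialize_hom)
  show ?thesis by (simp add: generic_element_def hom_sum hom_mult)
qed

section \<open>Minors\<close>

lemma pick_lessThan: "j < h \<Longrightarrow> pick {..<h} j = j"
proof -
  assume "j < h"
  then have "{a \<in> {..<h}. a < j} = {..<j}" by auto
  then show ?thesis using pick_card_in_set[of j "{..<h}"] \<open>j < h\<close> by simp
qed

lemma submatrix_all_columns:
  assumes "I \<subseteq> {..<dim_row M}" "card I = h" "dim_col M = h"
  shows "submatrix M I {..<h} = mat h h (\<lambda>(k, l). M $$ (pick I k, l))"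
proof -
  have 1: "{i. i < dim_row M \<and> i \<in> I} = I" "{j. j < dim_col M \<and> j \<in> {..<h}} = {..<h}" using assms by auto
  show ?thesis unfolding submatrix_def 1 using assms by (intro eq_matI) (auto simp: pick_lessThan)
qed

lemma pick_less:
  assumes "I \<subseteq> {..<n::nat}" "k < card I"
  shows "pick I k < n"
proof -
  have "{i. i < n \<and> i \<in> I} = I" using assms by auto
  then show ?thesis using pick_le[of k n I] assms by simp
qed

lemma minors_all_columns:
  assumes "dim_col M = h"
  shows "minors h M = {det (mat h h (\<lambda>(k, l). M $$ (pick I k, l))) | I. I \<subseteq> {..<dim_row M} \<and> card I = h}"
proof -
  have "J = {..<h}" if "J \<subseteq> {..<h}" "card J = h" for J
    using that card_subset_eq[of "{..<h}" J] by simp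
  then have "minors h M = {det (submatrix M I {..<h}) | I. I \<subseteq> {..<dim_row M} \<and> card I = h}"
    unfolding minors_def using assms by (auto, metis card_lessThan order_refl)
  also have "\<dots> = {det (mat h h (\<lambda>(k, l). M $$ (pick I k, l))) | I. I \<subseteq> {..<dim_row M} \<and> card I = h}"
    using submatrix_all_columns[of _ M h] assms by (intro Collect_cong ex_cong1) auto
  finally show ?thesis .
qed

text \<open>\<open>minors\<close> lists the selected rows in increasing order, whereas a multilinear
  expansion produces injective selections in any order; sorting them costs only the sign
  \<open>s\<close>.\<close>

lemma det_select_rows_eq_minor:
  fixes N :: "nat \<Rightarrow> nat \<Rightarrow> 'a::comm_ring_1"
  assumes f: "inj_on f {0..<h}" "f ` {0..<h} \<subseteq> {..<K}"
  shows "\<exists>I s. I \<subseteq> {..<K} \<and> card I = h \<and>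
    det (mat h h (\<lambda>(i, j). N (f i) j)) = s * det (mat h h (\<lambda>(i, j). N (pick I i) j))"
proof -
  define I where "I = f ` {0..<h}"
  have I: "finite I" "card I = h" using f by (auto simp: I_def card_image)
  \<comment> \<open>\<open>c i\<close> is the rank of \<open>i\<close> within \<open>I\<close>,
    inverse to \<open>pick I\<close>; \<open>p\<close> is the identity from \<open>h\<close> on
    because \<open>permutes\<close> demands it.\<close>
  define c where "c i = card {a \<in> I. a < i}" for i
  define p where "p i = (if i < h then c (f i) else i)" for i
  have pick_c: "pick I (c i) = i" if "i \<in> I" for i unfolding c_def by (rule pick_card_in_set[OF that])
  have c_less: "c i < h" if "i \<in> I" for i
    unfolding c_def I(2)[symmetric] using that I by (intro psubset_card_mono) auto
  have "inj_on p {0..<h}"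
  proof (rule inj_onI)
    fix i j assume "i \<in> {0..<h}" "j \<in> {0..<h}" "p i = p j"
    then have "f i = f j" using pick_c[of "f i"] pick_c[of "f j"] by (auto simp: p_def I_def)
    then show "i = j" using f \<open>i \<in> _\<close> \<open>j \<in> _\<close> by (auto dest: inj_onD)
  qed
  moreover have "p ` {0..<h} \<subseteq> {0..<h}" using c_less by (auto simp: p_def I_def)
  ultimately have "bij_betw p {0..<h} {0..<h}"
    by (simp add: bij_betw_def endo_inj_surj)
  then have p: "p permutes {0..<h}" by (rule bij_imp_permutes) (simp add: p_def)
  let ?B = "mat h h (\<lambda>(i, j). N (pick I i) j)"
  have "mat h h (\<lambda>(i, j). N (f i) j) = mat h h (\<lambda>(i, j). ?B $$ (p i, j))"
    using pick_c c_less by (intro eq_matI) (auto simp: p_def I_def)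
  moreover have "det (mat h h (\<lambda>(i, j). ?B $$ (p i, j))) = signof p * det ?B"
    by (rule det_permute_rows[OF _ p]) simp
  ultimately have "det (mat h h (\<lambda>(i, j). N (f i) j)) = signof p * det ?B" by simp
  moreover have "I \<subseteq> {..<K}" using f by (auto simp: I_def)
  ultimately show ?thesis using I(2) by (intro exI[of _ I] exI[of _ "signof p"]) simp
qed

section \<open>Products of generating families\<close>

lemma mult_lin_combs_in:
  assumes K: "is_submod UNIV K" and "\<And>i j. i \<in> A \<Longrightarrow> j \<in> B \<Longrightarrow> e i * f j \<in> K"
    and x: "x \<in> lin_combs UNIV A e" and y: "y \<in> lin_combs UNIV B f"
  shows "x * y \<in> K"
proof -
  obtain c where x: "x = (\<Sum>i\<in>A. c i * e i)" using x by (auto simp: lin_combs_def)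
  obtain b where y: "y = (\<Sum>j\<in>B. b j * f j)" using y by (auto simp: lin_combs_def)
  have "x * y = (\<Sum>i\<in>A. \<Sum>j\<in>B. (c i * b j) * (e i * f j))"
    unfolding x y sum_product by (intro sum.cong) (auto simp: mult_ac)
  also have "\<dots> \<in> K"
    by (intro is_submod_sum[OF K] is_submodD(3)[OF K] assms(2)) auto
  finally show ?thesis .
qed

lemma finite_monomials: "finite (monomials m r)"
proof -
  have "monomials m r \<subseteq> mset ` {xs. set xs \<subseteq> {1..m} \<and> length xs = r}"
  proof
    fix E assume E: "E \<in> monomials m r"
    obtain xs where "mset xs = E" using ex_mset by blast
    then show "E \<in> mset ` {xs. set xs \<subseteq> {1..m} \<and> length xs = r}"
      using E by (auto simp: monomials_def intro!: image_eqI[of _ _ xs])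
  qed
  then show ?thesis using finite_lists_length_eq[of "{1..m}" r] by (auto intro: finite_subset)
qed

lemma ipow_subset_monomials:
  "ipow (lin_combs UNIV {1..m} a) r \<subseteq> lin_combs UNIV (monomials m r) (monomial_value a)"
proof (induction r)
  case 0
  have "monomials m 0 = {{#}}" by (auto simp: monomials_def)
  moreover have "x = (\<Sum>E\<in>{{#}}. x * monomial_value a E)" for x
    by (simp add: monomial_value_def)
  ultimately have "x \<in> lin_combs UNIV (monomials m 0) (monomial_value a)" for x
    unfolding lin_combs_def by (intro CollectI exI[of _ "\<lambda>_. x"]) simp
  then show ?case by auto
next
  case (Suc r)
  let ?K = "lin_combs UNIV (monomials m (Suc r)) (monomial_value a)"
  have K: "is_submod UNIV ?K" by (rule is_submod_lin_combs) simp
  have "x * y \<in> ?K" if "x \<in> ipow (lin_combs UNIV {1..m} a) r" "y \<in> lin_combs UNIV {1..m} a" for x y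
  proof (rule mult_lin_combs_in[OF K])
    show "x \<in> lin_combs UNIV (monomials m r) (monomial_value a)" using that Suc by auto
    fix E j assume "E \<in> monomials m r" "j \<in> {1..m}"
    then have "add_mset j E \<in> monomials m (Suc r)" by (auto simp: monomials_def)
    then have "monomial_value a (add_mset j E) \<in> ?K"
      by (intro gen_in_lin_combs finite_monomials) simp_all
    then show "monomial_value a E * a j \<in> ?K" by (simp add: monomial_value_def mult.commute)
  qed (use that in auto)
  then show ?case unfolding ipow_Suc by (intro iprod_minimal[OF K])
qed

section \<open>Minors of the testing matrix\<close>

lemma uconst_mult_minor_in_generic_ideal:
  fixes a :: "nat \<Rightarrow> 'a::comm_ring_1" and M :: "'a upoly mat"
  assumes \<aa>: "\<aa> = Idl\<^bsub>class_ring\<^esub> (a ` {1..m})"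
    and Q: "Q = Idl\<^bsub>upoly_ring d m\<^esub> (generic_element a m ` {1..d})"
    and tm: "testing_matrix a m d r M" "dim_col M = h"
    and x: "x \<in> ipow \<aa> (r + 1)" and f: "f \<in> minors h M"
  shows "uconst x * f \<in> Q"
proof -
  let ?S = "upolys d m :: 'a upoly set"
  interpret U: comm_ring_hom "uconst :: 'a \<Rightarrow> 'a upoly" by (rule uconst_hom)
  obtain cs rs where mb: "minimal_basis class_ring (ipow \<aa> (r + 1)) (set cs)"
    and rs: "set rs = {1..d} \<times> monomials m r"
    and M: "M \<in> carrier_mat (length rs) (length cs)"
    and MS: "\<And>k l. k < length rs \<Longrightarrow> l < length cs \<Longrightarrow> M $$ (k, l) \<in> ?S"
    and Me: "\<And>k. k < length rs \<Longrightarrow> generic_element a m (fst (rs ! k)) * uconst (monomial_value a (snd (rs ! k)))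
          = (\<Sum>l<length cs. M $$ (k, l) * uconst (cs ! l))"
    using tm(1) unfolding testing_matrix_def \<aa>[symmetric] upoly_ring_eq by auto
  have h: "length cs = h" using M tm(2) by auto
  have gs: "generic_element a m ` {1..d} \<subseteq> ?S" using generic_element_in_upolys by blast
  have Qs: "is_submod ?S Q" "generic_element a m ` {1..d} \<subseteq> Q"
    unfolding Q upoly_ring_eq using is_submod_Idl_subring_rec[OF is_subring_upolys gs] by simp_all
  obtain I where I: "I \<subseteq> {..<length rs}" "card I = h" and feq: "f = det (mat h h (\<lambda>(k, l). M $$ (pick I k, l)))"
    using f M unfolding minors_all_columns[OF tm(2)] by auto
  let ?A = "mat h h (\<lambda>(k, l). M $$ (pick I k, l))"
  have pick: "pick I k < length rs" if "k < h" for k using pick_less[OF I(1)] I(2) that by simp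
  have fe: "f * uconst (cs ! l) \<in> Q" if "l < h" for l
    unfolding feq
  proof (rule det_mult_in_submod[OF is_subring_upolys Qs(1), of ?A])
    show "?A $$ (i, j) \<in> ?S" if "i < h" "j < h" for i j
      using that pick h by (auto intro: MS)
    \<comment> \<open>Row \<open>k\<close> applied to the basis is a generic element times a
      monomial, and generic elements generate \<open>Q\<close>.\<close>
    fix k assume k: "k < h"
    have "rs ! pick I k \<in> {1..d} \<times> monomials m r" using nth_mem[OF pick[OF k]] rs by simp
    then have "generic_element a m (fst (rs ! pick I k)) \<in> Q" using Qs(2) by auto
    then have "generic_element a m (fst (rs ! pick I k)) * uconst (monomial_value a (snd (rs ! pick I k))) \<in> Q"
      by (intro is_submodD(4)[OF Qs(1)]) auto
    then show "(\<Sum>j<h. ?A $$ (k, j) * uconst (cs ! j)) \<in> Q"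
      using Me[OF pick[OF k]] k h by simp
  qed (use that in auto)
  have "x \<in> lin_combs UNIV {..<h} ((!) cs)"
    using x mb Idl_image_eq_lin_combs[of "{..<h}" "(!) cs"] h
    by (simp add: minimal_basis_def nth_image flip: atLeast0LessThan)
  then obtain c where "x = (\<Sum>l<h. c l * cs ! l)" by (auto simp: lin_combs_def)
  then have "uconst x * f = (\<Sum>l<h. uconst (c l) * (f * uconst (cs ! l)))"
    by (simp add: U.hom_mult U.hom_sum sum_distrib_left sum_distrib_right mult_ac)
  also have "\<dots> \<in> Q" by (intro is_submod_sum[OF Qs(1)] is_submodD(3)[OF Qs(1)] fe) auto
  finally show ?thesis .
qed

text \<open>Let \<open>g\<close> list the generators of \<open>q\<close> times the monomials of
  degree \<open>r\<close>. Specialized, the rows of the matrix say \<open>g = N cs\<close>, and the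
  reduction equation gives \<open>cs = s g\<close>. So \<open>s N\<close> fixes the basis, its
  determinant is outside \<open>\<mm>\<close>, and by the row expansion so is the determinant of
  some \<open>h\<close> rows of \<open>N\<close>.\<close>

lemma (in noeth_local) exists_minor_notin_m:
  fixes a :: "nat \<Rightarrow> 'a" and M :: "'a upoly mat"
  assumes \<aa>: "\<aa> = Idl\<^bsub>class_ring\<^esub> (a ` {1..m})"
    and tm: "testing_matrix a m d r M" "dim_col M = h"
    and q: "q = lin_combs UNIV {1..d} (\<lambda>i. \<Sum>j\<in>{1..m}. y (i, j) * a j)"
    and red: "ipow \<aa> (r + 1) \<subseteq> iprod q (ipow \<aa> r)"
  shows "\<exists>f\<in>minors h M. specialize y f \<notin> \<mm>"
proof -
  obtain cs rs where d: "distinct cs" and mb: "minimal_basis class_ring (ipow \<aa> (r + 1)) (set cs)"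
    and rs: "distinct rs" "set rs = {1..d} \<times> monomials m r"
    and M: "M \<in> carrier_mat (length rs) (length cs)"
    and Me: "\<And>k. k < length rs \<Longrightarrow> generic_element a m (fst (rs ! k)) * uconst (monomial_value a (snd (rs ! k)))
          = (\<Sum>l<length cs. M $$ (k, l) * uconst (cs ! l))"
    using tm(1) unfolding testing_matrix_def \<aa>[symmetric] upoly_ring_eq by auto
  have h: "length cs = h" using M tm(2) by auto
  interpret sp: comm_ring_hom "specialize y" by (rule specialize_hom)
  define c where "c i = (\<Sum>j\<in>{1..m}. y (i, j) * a j)" for i
  define N where "N k l = specialize y (M $$ (k, l))" for k l
  define K where "K = length rs"
  define g where "g k = c (fst (rs ! k)) * monomial_value a (snd (rs ! k))" for k
  have Ne: "g k = (\<Sum>l<h. N k l * cs ! l)" if "k < K" for k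
    using arg_cong[OF Me[of k], of "specialize y"] that
    by (simp add: K_def sp.hom_mult sp.hom_sum specialize_generic_element h N_def g_def c_def)
  have "iprod q (ipow \<aa> r) \<subseteq> lin_combs UNIV {..<K} g"
  proof (rule iprod_minimal)
    show sm: "is_submod UNIV (lin_combs UNIV {..<K} g)" by (rule is_submod_lin_combs) simp
    fix s t assume s: "s \<in> q" and t: "t \<in> ipow \<aa> r"
    have t': "t \<in> lin_combs UNIV (monomials m r) (monomial_value a)"
      using t ipow_subset_monomials[of m a r] by (auto simp: \<aa> Idl_image_eq_lin_combs)
    show "s * t \<in> lin_combs UNIV {..<K} g"
    proof (rule mult_lin_combs_in[OF sm _ s[unfolded q] t'])
      fix i E assume "i \<in> {1..d}" "E \<in> monomials m r"
      then have "(i, E) \<in> set rs" using rs by simp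
      then obtain k where "k < K" "rs ! k = (i, E)" by (auto simp: in_set_conv_nth K_def)
      then show "(\<Sum>j\<in>{1..m}. y (i, j) * a j) * monomial_value a E \<in> lin_combs UNIV {..<K} g"
        using gen_in_lin_combs[of UNIV "{..<K}" k g] by (simp add: g_def c_def)
    qed
  qed
  moreover have "cs ! l \<in> ipow \<aa> (r + 1)" if "l < h" for l
  proof -
    have "Idl\<^bsub>class_ring\<^esub> (set cs) = ipow \<aa> (r + 1)" using mb by (simp add: minimal_basis_def)
    moreover have "cs ! l \<in> Idl\<^bsub>class_ring\<^esub> (set cs)"
      using is_submod_Idl_subring_rec(2)[of UNIV "set cs"] nth_mem[of l cs] that h by auto
    ultimately show ?thesis by simp
  qed
  ultimately have "\<exists>s. cs ! l = (\<Sum>k<K. s k * g k)" if "l < h" for l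
    using red that by (force simp: lin_combs_def)
  then obtain s where s: "\<And>l. l < h \<Longrightarrow> cs ! l = (\<Sum>k<K. s l k * g k)" by metis
  let ?A = "mat h h (\<lambda>(i, j). \<Sum>k<K. s i k * N k j)"
  have "det ?A \<notin> \<mm>"
  proof (rule det_notin_m_of_identity[where e = "(!) cs"])
    show "b l \<in> \<mm>" if "(\<Sum>l<h. b l * cs ! l) = 0" "l < h" for b l
      using minimal_basis_relation[OF mb d, of b l] that h by simp
    fix i assume i: "i < h"
    have "(\<Sum>j<h. ?A $$ (i, j) * cs ! j) = (\<Sum>j<h. \<Sum>k<K. s i k * N k j * cs ! j)"
      using i by (simp add: sum_distrib_right)
    also have "\<dots> = (\<Sum>k<K. s i k * (\<Sum>j<h. N k j * cs ! j))"
      by (subst sum.swap) (simp add: sum_distrib_left mult.assoc)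
    also have "\<dots> = cs ! i" using Ne s[OF i] by simp
    finally show "(\<Sum>j<h. ?A $$ (i, j) * cs ! j) = cs ! i" .
  qed simp
  then obtain f where f: "inj_on f {0..<h}" "f ` {0..<h} \<subseteq> {..<K}"
    "det (mat h h (\<lambda>(i, j). N (f i) j)) \<notin> \<mm>"
    using det_mult_rows_in_ideal[OF m_submod, of h K N s] by metis
  then obtain I t where I: "I \<subseteq> {..<K}" "card I = h"
    "det (mat h h (\<lambda>(i, j). N (f i) j)) = t * det (mat h h (\<lambda>(i, j). N (pick I i) j))"
    using det_select_rows_eq_minor[OF f(1,2), of N] by metis
  have "det (mat h h (\<lambda>(i, j). N (pick I i) j)) \<notin> \<mm>" using f(3) I(3) m_prime by simp
  moreover have "mat h h (\<lambda>(i, j). N (pick I i) j) = map_mat (specialize y) (mat h h (\<lambda>(k, l). M $$ (pick I k, l)))"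
    by (intro eq_matI) (auto simp: N_def)
  ultimately have "specialize y (det (mat h h (\<lambda>(k, l). M $$ (pick I k, l)))) \<notin> \<mm>"
    by (simp only: sp.hom_det not_False_eq_True)
  moreover have "det (mat h h (\<lambda>(k, l). M $$ (pick I k, l))) \<in> minors h M"
    unfolding minors_all_columns[OF tm(2)] using I M by (auto simp: K_def)
  ultimately show ?thesis by blast
qed

section \<open>The Hilbert basis theorem\<close>

text \<open>The chain condition rather than finite generation: it passes to homomorphic images by
  pulling chains back, and its final use is on an explicit chain of ideals.\<close>

definition noetherian_set :: "'a::comm_ring_1 set \<Rightarrow> bool" where
  "noetherian_set S \<longleftrightarrow> (\<forall>I :: nat \<Rightarrow> 'a set. (\<forall>n. is_submod S (I n) \<and> I n \<subseteq> S) \<longrightarrow> mono I \<longrightarrow>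
     (\<exists>N. \<forall>n\<ge>N. I n = I N))"

lemma noetherian_setD:
  fixes I :: "nat \<Rightarrow> 'a::comm_ring_1 set"
  assumes "noetherian_set S" "\<And>n. is_submod S (I n)" "\<And>n. I n \<subseteq> S" "mono I"
  obtains N where "\<And>n. n \<ge> N \<Longrightarrow> I n = I N"
proof -
  have "\<exists>N. \<forall>n\<ge>N. I n = I N" using assms unfolding noetherian_set_def by simp
  then obtain N where "\<forall>n\<ge>N. I n = I N" by (rule exE)
  then show ?thesis by (intro that[of N]) (rule allE, assumption, erule mp)
qed

lemma is_subring_polys:
  assumes S: "is_subring S"
  shows "is_subring {p. \<forall>i. coeff p i \<in> S}"
  unfolding is_subring_def
  by (auto simp: coeff_1 coeff_mult is_subringD[OF S] intro!: is_subring_sum[OF S] is_subringD(6)[OF S])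

text \<open>\<open>L n i\<close> collects the coefficients in degree \<open>i\<close> of the
  elements of \<open>I n\<close> of degree at most \<open>i\<close>, a family of ideals of
  \<open>S\<close> increasing in both indices. Once it is constant in \<open>n\<close> from
  \<open>K\<close> on, for all \<open>i\<close> simultaneously, an element of \<open>I n\<close> is
  reduced into \<open>I K\<close> degree by degree.\<close>

lemma hilbert_basis:
  assumes S: "is_subring S" and N: "noetherian_set S"
  shows "noetherian_set {p. \<forall>i. coeff p i \<in> S}"
  unfolding noetherian_set_def
proof (intro allI impI)
  let ?R = "{p. \<forall>i. coeff p i \<in> S}"
  fix I :: "nat \<Rightarrow> 'a poly set" assume I: "\<forall>n. is_submod ?R (I n) \<and> I n \<subseteq> ?R" and "mono I"
  have Is: "is_submod ?R (I n)" for n using I by blast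
  have IR: "coeff p i \<in> S" if "p \<in> I n" for p n i using I that by blast
  have R: "is_subring ?R" by (rule is_subring_polys[OF S])
  define L where "L n i = {coeff p i | p. p \<in> I n \<and> degree p \<le> i}" for n i :: nat
  have LS: "L n i \<subseteq> S" for n i using IR by (auto simp: L_def)
  have Ls: "is_submod S (L n i)" for n i
    unfolding is_submod_def
  proof (intro conjI ballI)
    show "0 \<in> L n i" using is_submodD(1)[OF Is[of n]] by (auto simp: L_def intro!: exI[of _ 0])
    fix x y assume "x \<in> L n i" "y \<in> L n i"
    then obtain p q where "x = coeff p i" "p \<in> I n" "degree p \<le> i" "y = coeff q i" "q \<in> I n" "degree q \<le> i"
      by (auto simp: L_def)
    then show "x + y \<in> L n i"
      using is_submodD(2)[OF Is[of n]] by (auto simp: L_def intro!: exI[of _ "p + q"] degree_add_le)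
  next
    fix s x assume "s \<in> S" "x \<in> L n i"
    then obtain p where p: "x = coeff p i" "p \<in> I n" "degree p \<le> i" by (auto simp: L_def)
    have "[:s:] \<in> ?R" using \<open>s \<in> S\<close> is_subringD(1)[OF S] by (auto simp: coeff_pCons split: nat.split)
    then have "[:s:] * p \<in> I n" using is_submodD(3)[OF Is[of n]] p by blast
    moreover have "degree ([:s:] * p) \<le> i" using p degree_smult_le[of s p] by simp
    ultimately show "s * x \<in> L n i" using p by (auto simp: L_def intro!: exI[of _ "[:s:] * p"])
  qed
  have L_mono: "L n i \<subseteq> L n' i'" if "n \<le> n'" "i \<le> i'" for n n' i i'
  proof
    fix x assume "x \<in> L n i"
    then obtain p where p: "x = coeff p i" "p \<in> I n" "degree p \<le> i" by (auto simp: L_def)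
    have "monom 1 (i' - i) \<in> ?R" using is_subringD(1,2)[OF S] by auto
    then have "monom 1 (i' - i) * p \<in> I n'"
      using is_submodD(3)[OF Is[of n']] p(2) monoD[OF \<open>mono I\<close> that(1)] by blast
    moreover have "degree (monom 1 (i' - i) * p) \<le> i'"
      using degree_mult_le[of "monom 1 (i' - i)" p] degree_monom_le[of "1::'a" "i' - i"] p(3) that(2) by linarith
    moreover have "coeff (monom 1 (i' - i) * p) i' = x"
      using that p by (simp add: coeff_monom_mult)
    ultimately show "x \<in> L n' i'" by (auto simp: L_def)
  qed
  \<comment> \<open>The diagonal controls all \<open>i \<ge> N0\<close> at once; each of the
    finitely many remaining \<open>i\<close> gets its own bound \<open>Nf i\<close>.\<close>
  obtain N0 where N0: "\<And>n. n \<ge> N0 \<Longrightarrow> L n n = L N0 N0"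
    by (rule noetherian_setD[OF N, of "\<lambda>n. L n n"]) (auto simp: Ls LS[THEN subsetD] mono_def L_mono[THEN subsetD])
  have "\<exists>Ni. \<forall>n\<ge>Ni. L n i = L Ni i" for i
    by (rule noetherian_setD[OF N, of "\<lambda>n. L n i"]) (auto simp: Ls LS[THEN subsetD] mono_def subsetD[OF L_mono[OF _ order_refl]])
  then obtain Nf where Nf: "\<And>i n. n \<ge> Nf i \<Longrightarrow> L n i = L (Nf i) i" by metis
  define K where "K = Max (insert N0 (Nf ` {..<N0}))"
  have K0: "N0 \<le> K" unfolding K_def by (intro Max_ge) auto
  have KN: "Nf i \<le> K" if "i < N0" for i unfolding K_def using that by (intro Max_ge) auto
  have stab: "L n i \<subseteq> L K i" if "n \<ge> K" for n i
  proof (cases "i < N0")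
    case True
    then show ?thesis using Nf[of i n] Nf[of i K] KN[of i] that by simp
  next
    case False
    have "L n i \<subseteq> L (max n i) (max n i)" by (intro L_mono) auto
    also have "\<dots> = L N0 N0" using N0[of "max n i"] False by simp
    also have "\<dots> \<subseteq> L K i" using K0 False by (intro L_mono) auto
    finally show ?thesis .
  qed
  have eq: "p \<in> I K" if "n \<ge> K" "p \<in> I n" "degree p < k" for n p k
    using that
  proof (induction k arbitrary: p)
    case (Suc k)
    have "coeff p k \<in> L n k" using Suc.prems by (auto simp: L_def)
    then have "coeff p k \<in> L K k" using stab[OF Suc.prems(1)] by blast
    then obtain g where g: "coeff p k = coeff g k" "g \<in> I K" "degree g \<le> k" by (auto simp: L_def)
    have gn: "g \<in> I n" using g(2) monoD[OF \<open>mono I\<close> Suc.prems(1)] by blast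
    \<comment> \<open>For \<open>k = 0\<close> the degree cannot drop, since the zero polynomial has
      degree 0; there \<open>p\<close> and \<open>g\<close> are equal constants.\<close>
    have "p - g \<in> I K"
    proof (cases "k = 0")
      case True
      then have "p = g" using Suc.prems g by (metis degree_0_id le_zero_eq less_Suc0)
      then show ?thesis using is_submodD(1)[OF Is[of K]] by simp
    next
      case False
      have "degree (p - g) \<le> k" using Suc.prems g by (intro degree_diff_le) auto
      moreover have "coeff (p - g) k = 0" using g by simp
      ultimately have "degree (p - g) < k"
        using False by (metis degree_0 le_neq_implies_less leading_coeff_0_iff neq0_conv)
      then show ?thesis
        using Suc.IH[of "p - g"] Suc.prems is_submod_diff[OF Is R Suc.prems(2) gn] by blast
    qed
    then show ?case using is_submodD(2)[OF Is[of K] _ g(2), of "p - g"] by simp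
  qed simp
  show "\<exists>N. \<forall>n\<ge>N. I n = I N"
  proof (intro exI allI impI subset_antisym subsetI)
    show "x \<in> I K" if "K \<le> n" "x \<in> I n" for n x using eq[OF that, of "Suc (degree x)"] by simp
    show "x \<in> I n" if "K \<le> n" "x \<in> I K" for n x using that monoD[OF \<open>mono I\<close>] by blast
  qed
qed

section \<open>Noetherian property of images and finitely generated extensions\<close>

lemma is_subring_image:
  assumes "comm_ring_hom g" "is_subring S"
  shows "is_subring (g ` S)"
proof -
  interpret comm_ring_hom g by (rule assms)
  show ?thesis
    unfolding is_subring_def using is_subringD[OF assms(2)]
    by (auto simp: image_iff simp flip: hom_minus hom_mult hom_one)
qed

lemma noetherian_set_image:
  assumes "comm_ring_hom g" and S: "is_subring S" and N: "noetherian_set S"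
  shows "noetherian_set (g ` S)"
  unfolding noetherian_set_def
proof (intro allI impI)
  interpret comm_ring_hom g by (rule assms)
  fix I :: "nat \<Rightarrow> 'b set" assume I: "\<forall>n. is_submod (g ` S) (I n) \<and> I n \<subseteq> g ` S" and "mono I"
  let ?J = "\<lambda>n. {x \<in> S. g x \<in> I n}"
  have "is_submod S (?J n)" for n
    using I is_submodD[of "g ` S" "I n"] is_subringD[OF S] unfolding is_submod_def[of S]
    by (auto simp: hom_add hom_mult)
  then obtain N where N: "\<And>n. n \<ge> N \<Longrightarrow> ?J n = ?J N"
    by (rule noetherian_setD[OF N, of ?J]) (use monoD[OF \<open>mono I\<close>] in \<open>auto simp: mono_def\<close>)
  have "I n = g ` ?J n" for n using I by auto
  then show "\<exists>N. \<forall>n\<ge>N. I n = I N" using N by metis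
qed

text \<open>The ring \<open>S[x]\<close>, written as the image of the polynomial ring under
  evaluation so that the basis theorem carries over even if \<open>x\<close> satisfies algebraic
  relations.\<close>

definition adjoin :: "'b::comm_ring_1 \<Rightarrow> 'b set \<Rightarrow> 'b set" where
  "adjoin x S = (\<lambda>p. poly p x) ` {p. \<forall>i. coeff p i \<in> S}"

lemma adjoin_props:
  assumes S: "is_subring S"
  shows "is_subring (adjoin x S)" "noetherian_set S \<Longrightarrow> noetherian_set (adjoin x S)"
    "S \<subseteq> adjoin x S" "x \<in> adjoin x S"
proof -
  show "is_subring (adjoin x S)" "noetherian_set S \<Longrightarrow> noetherian_set (adjoin x S)"
    unfolding adjoin_def
    by (intro is_subring_image noetherian_set_image comm_ring_hom_poly is_subring_polys hilbert_basis S; assumption)+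
  show "S \<subseteq> adjoin x S"
  proof
    fix s assume "s \<in> S"
    then show "s \<in> adjoin x S" unfolding adjoin_def using is_subringD(1)[OF S]
      by (intro image_eqI[of _ _ "[:s:]"]) (auto simp: coeff_pCons split: nat.split)
  qed
  show "x \<in> adjoin x S"
    unfolding adjoin_def using is_subringD(1,2)[OF S]
    by (intro image_eqI[of _ _ "[:0, 1:]"]) (auto simp: coeff_pCons split: nat.split)
qed

text \<open>Applied to the constants and the finitely many variables \<open>u_ij\<close>, where
  \<open>T\<close> stands in for \<open>L[u]\<close>.\<close>

lemma noetherian_adjoin_finite:
  assumes S: "is_subring S" "noetherian_set S" and X: "finite X"
  shows "\<exists>T. is_subring T \<and> noetherian_set T \<and> S \<subseteq> T \<and> X \<subseteq> T"
  using X
proof (induction X)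
  case empty
  then show ?case using S by blast
next
  case (insert x X)
  then obtain T where T: "is_subring T" "noetherian_set T" "S \<subseteq> T" "X \<subseteq> T" by blast
  show ?case
    using adjoin_props[OF T(1), of x] T by (intro exI[of _ "adjoin x T"]) blast
qed

context noeth_local
begin

lemma noetherian_set_UNIV: "noetherian_set (UNIV :: 'a set)"
  unfolding noetherian_set_def
proof (intro allI impI)
  fix I :: "nat \<Rightarrow> 'a set" assume I: "\<forall>n. is_submod UNIV (I n) \<and> I n \<subseteq> UNIV" and "mono I"
  have "is_submod UNIV (\<Union>n. I n)"
    unfolding is_submod_def
  proof (intro conjI ballI)
    have "0 \<in> I 0" using I is_submodD(1)[of UNIV "I 0"] by simp
    then show "0 \<in> (\<Union>n. I n)" by (rule UN_I[OF UNIV_I])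
    fix x y assume "x \<in> (\<Union>n. I n)" "y \<in> (\<Union>n. I n)"
    then obtain k l where "x \<in> I k" "y \<in> I l" by blast
    then have "x \<in> I (max k l)" "y \<in> I (max k l)"
      using monoD[OF \<open>mono I\<close>, of k "max k l"] monoD[OF \<open>mono I\<close>, of l "max k l"] by auto
    then have "x + y \<in> I (max k l)" using is_submodD(2)[of UNIV "I (max k l)" x y] I by simp
    then show "x + y \<in> (\<Union>n. I n)" by (rule UN_I[OF UNIV_I])
  next
    fix s x assume "x \<in> (\<Union>n. I n)"
    then obtain k where "x \<in> I k" by blast
    then have "s * x \<in> I k" using is_submodD(3)[of UNIV "I k" s x] I by simp
    then show "s * x \<in> (\<Union>n. I n)" by (rule UN_I[OF UNIV_I])
  qed
  from finitely_generated[OF this]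
  obtain n and e :: "nat \<Rightarrow> 'a" where e: "(\<Union>n. I n) = lin_combs UNIV {..<n} e"
    by (elim exE)
  have "\<exists>k. e i \<in> I k" if "i < n" for i
    using gen_in_lin_combs[of UNIV "{..<n}" i e] that unfolding e[symmetric] by simp
  then obtain k where k: "\<And>i. i < n \<Longrightarrow> e i \<in> I (k i)" by metis
  define N where "N = Max (insert 0 (k ` {..<n}))"
  have "k i \<le> N" if "i < n" for i unfolding N_def using that by (intro Max_ge) auto
  then have "e i \<in> I N" if "i < n" for i
    using that by (intro subsetD[OF monoD[OF \<open>mono I\<close>] k[OF that]])
  then have "lin_combs UNIV {..<n} e \<subseteq> I N" using I by (intro lin_combs_minimal) auto
  then have "I l \<subseteq> I N" for l unfolding e[symmetric] by (simp add: UN_subset_iff)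
  then have "\<forall>l\<ge>N. I l = I N" using monoD[OF \<open>mono I\<close>, of N] by (intro allI impI subset_antisym) simp_all
  then show "\<exists>N. \<forall>n\<ge>N. I n = I N" by blast
qed

lemma noetherian_set_uconst: "noetherian_set (range (uconst :: 'a \<Rightarrow> 'a upoly))"
  by (rule noetherian_set_image[OF uconst_hom is_subring_UNIV noetherian_set_UNIV])

end

section \<open>Boundedness of reduction numbers\<close>

lemma reduction_step_mono:
  assumes \<aa>: "is_submod UNIV \<aa>" and q: "is_submod UNIV q"
    and red: "ipow \<aa> (n + 1) \<subseteq> iprod q (ipow \<aa> n)" and "n \<le> k"
  shows "ipow \<aa> (k + 1) \<subseteq> iprod q (ipow \<aa> k)"
  using \<open>n \<le> k\<close>
proof (induction k rule: dec_induct)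
  case (step k)
  have "ipow \<aa> (Suc k + 1) = iprod (ipow \<aa> (k + 1)) \<aa>" by simp
  also have "\<dots> \<subseteq> iprod (iprod q (ipow \<aa> k)) \<aa>"
    by (intro iprod_mono step.IH order_refl is_submod_iprod is_submod_ipow \<aa> q)
  also have "\<dots> = iprod q (ipow \<aa> (Suc k))"
    by (simp add: iprod_assoc \<aa> q is_submod_ipow)
  finally show ?case .
qed (rule red)

text \<open>The value of the generic element \<open>b_i\<close> at \<open>u = y\<close>; accordingly
  \<open>red_ideal\<close> is the specialization of the ideal of generic elements.\<close>

definition red_gen :: "(nat \<Rightarrow> 'a::comm_ring_1) \<Rightarrow> nat \<Rightarrow> (nat \<times> nat \<Rightarrow> 'a) \<Rightarrow> nat \<Rightarrow> 'a" where
  "red_gen a m y i = (\<Sum>j\<in>{1..m}. y (i, j) * a j)"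

definition red_ideal :: "(nat \<Rightarrow> 'a::comm_ring_1) \<Rightarrow> nat \<Rightarrow> nat \<Rightarrow> (nat \<times> nat \<Rightarrow> 'a) \<Rightarrow> 'a set" where
  "red_ideal a m d y = lin_combs UNIV {1..d} (red_gen a m y)"

lemma is_submod_red_ideal: "is_submod UNIV (red_ideal a m d y)"
  unfolding red_ideal_def by (rule is_submod_lin_combs) simp

context noeth_local
begin

context
  fixes a :: "nat \<Rightarrow> 'a" and m d :: nat and \<aa> :: "'a set"
  assumes \<aa>: "\<aa> = lin_combs UNIV {1..m} a"
begin

lemma is_submod_a: "is_submod UNIV \<aa>"
  unfolding \<aa> by (rule is_submod_lin_combs) simp

text \<open>If \<open>D(u)\<close> expresses the products of the generic elements with \<open>\<aa>\<^sup>n\<close> through generators of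
  \<open>\<aa>\<^sup>n\<^sup>+\<^sup>1\<close> in such a way that \<open>D(y)\<close> fixes these generators, the polynomial
  \<open>det (1 + D(u) - D(y))\<close> does the job.\<close>

lemma exists_polynomial_detecting_reduction:
  assumes red: "ipow \<aa> (n + 1) \<subseteq> iprod (red_ideal a m d y) (ipow \<aa> n)"
    and T: "is_subring T" "range uconst \<subseteq> T" "(\<lambda>(i, j). uvar i j) ` ({1..d} \<times> {1..m}) \<subseteq> T"
  shows "\<exists>f\<in>T. specialize y f = 1 \<and>
    (\<forall>z. specialize z f \<notin> \<mm> \<longrightarrow> ipow \<aa> (n + 1) \<subseteq> iprod (red_ideal a m d z) (ipow \<aa> n))"
proof -
  note P = is_submod_ipow[OF is_submod_a]
  from finitely_generated[OF P[of "n + 1"]]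
  obtain k and e :: "nat \<Rightarrow> 'a" where e: "ipow \<aa> (n + 1) = lin_combs UNIV {..<k} e"
    by (elim exE)
  have eP: "e \<alpha> \<in> ipow \<aa> (n + 1)" if "\<alpha> < k" for \<alpha>
    unfolding e using that by (intro gen_in_lin_combs) auto
  have iprod: "iprod (red_ideal a m d z) (ipow \<aa> n) = {\<Sum>i\<in>{1..d}. red_gen a m z i * Y i | Y. \<forall>i\<in>{1..d}. Y i \<in> ipow \<aa> n}" for z
    unfolding red_ideal_def by (rule iprod_lin_combs) (use P in auto)
  have "\<exists>Y. (\<forall>i\<in>{1..d}. Y i \<in> ipow \<aa> n) \<and> e \<alpha> = (\<Sum>i\<in>{1..d}. red_gen a m y i * Y i)" if "\<alpha> < k" for \<alpha>
    using subsetD[OF red eP[OF that]] unfolding iprod by blast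
  then obtain Y where Y: "\<And>\<alpha> i. \<alpha> < k \<Longrightarrow> i \<in> {1..d} \<Longrightarrow> Y \<alpha> i \<in> ipow \<aa> n"
    "\<And>\<alpha>. \<alpha> < k \<Longrightarrow> e \<alpha> = (\<Sum>i\<in>{1..d}. red_gen a m y i * Y \<alpha> i)" by metis
  have "\<exists>s. a j * Y \<alpha> i = (\<Sum>\<beta><k. s \<beta> * e \<beta>)" if "\<alpha> < k" "i \<in> {1..d}" "j \<in> {1..m}" for \<alpha> i j
  proof -
    have "a j \<in> \<aa>" unfolding \<aa> using that by (intro gen_in_lin_combs) auto
    then have "Y \<alpha> i * a j \<in> ipow \<aa> (n + 1)" using Y(1)[OF that(1,2)] by (simp add: iprodI)
    then show ?thesis unfolding e by (auto simp: lin_combs_def mult.commute)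
  qed
  then obtain s where s: "\<And>\<alpha> i j. \<alpha> < k \<Longrightarrow> i \<in> {1..d} \<Longrightarrow> j \<in> {1..m} \<Longrightarrow>
      a j * Y \<alpha> i = (\<Sum>\<beta><k. s \<alpha> i j \<beta> * e \<beta>)" by metis
  \<comment> \<open>\<open>D\<close> is linear in the variables. At any point \<open>w\<close>, the
    matrix \<open>D(w)\<close> applied to the generators \<open>e\<close> yields the sums of
    \<open>red_gen a m w i * Y \<alpha> i\<close>; at \<open>w = y\<close> these are the
    \<open>e \<alpha>\<close> themselves.\<close>
  define D where "D \<alpha> \<beta> = (\<Sum>i\<in>{1..d}. \<Sum>j\<in>{1..m}. uvar i j * uconst (s \<alpha> i j \<beta>))" for \<alpha> \<beta>
  define B where "B = mat k k (\<lambda>(\<alpha>, \<beta>). (if \<alpha> = \<beta> then 1 else 0) + D \<alpha> \<beta> - uconst (specialize y (D \<alpha> \<beta>)))"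
  have B: "B \<in> carrier_mat k k" by (simp add: B_def)
  have uT: "uvar i j \<in> T" if "i \<in> {1..d}" "j \<in> {1..m}" for i j
    using T(3) that by (auto simp: image_subset_iff)
  have DT: "D \<alpha> \<beta> \<in> T" for \<alpha> \<beta>
    unfolding D_def using T(2) uT
    by (intro is_subring_sum[OF T(1)] is_subringD(6)[OF T(1)]) auto
  have "det B \<in> T"
  proof (rule det_in_subring[OF T(1) B])
    show "B $$ (\<alpha>, \<beta>) \<in> T" if "\<alpha> < k" "\<beta> < k" for \<alpha> \<beta>
      using that T(2) is_subringD(1,2)[OF T(1)] unfolding B_def
      by (simp del: One_nat_def) (intro conjI impI is_subringD(3,5)[OF T(1)] DT; auto)
  qed
  moreover have sB: "specialize z (det B) = det (mat k k (\<lambda>(\<alpha>, \<beta>). (if \<alpha> = \<beta> then 1 else 0)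
      + specialize z (D \<alpha> \<beta>) - specialize y (D \<alpha> \<beta>)))" for z
  proof -
    interpret sp: comm_ring_hom "specialize z" by (rule specialize_hom)
    have "map_mat (specialize z) B = mat k k (\<lambda>(\<alpha>, \<beta>). (if \<alpha> = \<beta> then 1 else 0)
      + specialize z (D \<alpha> \<beta>) - specialize y (D \<alpha> \<beta>))"
      by (intro eq_matI) (auto simp: B_def sp.hom_add sp.hom_minus)
    then show ?thesis using sp.hom_det[of B] by simp
  qed
  have "specialize y (det B) = 1"
  proof -
    have "mat k k (\<lambda>(\<alpha>, \<beta>). (if \<alpha> = \<beta> then 1 else 0) + specialize y (D \<alpha> \<beta>) - specialize y (D \<alpha> \<beta>)) = (1\<^sub>m k :: 'a mat)"
      by (intro eq_matI) auto
    then show ?thesis unfolding sB by simp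
  qed
  moreover have "ipow \<aa> (n + 1) \<subseteq> iprod (red_ideal a m d z) (ipow \<aa> n)" if z: "specialize z (det B) \<notin> \<mm>" for z
  proof -
    let ?K = "iprod (red_ideal a m d z) (ipow \<aa> n)"
    have K: "is_submod UNIV ?K" by (intro is_submod_iprod is_submod_red_ideal P)
    have De: "(\<Sum>\<beta><k. specialize w (D \<alpha> \<beta>) * e \<beta>) = (\<Sum>i\<in>{1..d}. red_gen a m w i * Y \<alpha> i)" if "\<alpha> < k" for w \<alpha>
    proof -
      interpret sp: comm_ring_hom "specialize w" by (rule specialize_hom)
      have "(\<Sum>\<beta><k. specialize w (D \<alpha> \<beta>) * e \<beta>)
          = (\<Sum>\<beta><k. \<Sum>i\<in>{1..d}. \<Sum>j\<in>{1..m}. w (i, j) * (s \<alpha> i j \<beta> * e \<beta>))"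
        by (simp add: D_def sp.hom_sum sp.hom_mult sum_distrib_right mult.assoc)
      also have "\<dots> = (\<Sum>i\<in>{1..d}. \<Sum>\<beta><k. \<Sum>j\<in>{1..m}. w (i, j) * (s \<alpha> i j \<beta> * e \<beta>))"
        by (rule sum.swap)
      also have "\<dots> = (\<Sum>i\<in>{1..d}. \<Sum>j\<in>{1..m}. \<Sum>\<beta><k. w (i, j) * (s \<alpha> i j \<beta> * e \<beta>))"
        by (intro sum.cong refl sum.swap)
      also have "\<dots> = (\<Sum>i\<in>{1..d}. \<Sum>j\<in>{1..m}. w (i, j) * (a j * Y \<alpha> i))"
        using s[OF that] by (intro sum.cong refl) (simp flip: sum_distrib_left)
      also have "\<dots> = (\<Sum>i\<in>{1..d}. red_gen a m w i * Y \<alpha> i)"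
        by (simp add: red_gen_def sum_distrib_right mult.assoc)
      finally show ?thesis .
    qed
    let ?A = "mat k k (\<lambda>(\<alpha>, \<beta>). (if \<alpha> = \<beta> then 1 else 0) + specialize z (D \<alpha> \<beta>) - specialize y (D \<alpha> \<beta>))"
    \<comment> \<open>The \<open>D(y)\<close> part reproduces \<open>e \<alpha>\<close> and cancels
      the identity, leaving \<open>D(z)\<close> applied to \<open>e\<close>, which lies in
      \<open>?K\<close>.\<close>
    have "(\<Sum>\<beta><k. ?A $$ (\<alpha>, \<beta>) * e \<beta>) \<in> ?K" if \<alpha>: "\<alpha> < k" for \<alpha>
    proof -
      have "(\<Sum>\<beta><k. ?A $$ (\<alpha>, \<beta>) * e \<beta>)
        = (\<Sum>\<beta><k. (if \<alpha> = \<beta> then e \<beta> else 0) + specialize z (D \<alpha> \<beta>) * e \<beta> - specialize y (D \<alpha> \<beta>) * e \<beta>)"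
        using \<alpha> by (intro sum.cong) (auto simp: algebra_simps)
      also have "\<dots> = e \<alpha> + (\<Sum>\<beta><k. specialize z (D \<alpha> \<beta>) * e \<beta>) - (\<Sum>\<beta><k. specialize y (D \<alpha> \<beta>) * e \<beta>)"
        using \<alpha> by (simp add: sum_subtractf sum.distrib)
      also have "\<dots> = (\<Sum>i\<in>{1..d}. red_gen a m z i * Y \<alpha> i)"
        unfolding De[OF \<alpha>] Y(2)[OF \<alpha>, symmetric] by simp
      also have "\<dots> \<in> ?K" unfolding iprod using Y(1)[OF \<alpha>] by blast
      finally show ?thesis .
    qed
    then have "det ?A * e \<alpha> \<in> ?K" if "\<alpha> < k" for \<alpha>
      using that by (intro det_mult_in_submod[OF is_subring_UNIV K, of ?A k]) auto
    then have "e \<alpha> \<in> ?K" if "\<alpha> < k" for \<alpha>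
      using unit_cancel[OF K z[unfolded sB]] that by blast
    then show ?thesis unfolding e by (intro lin_combs_minimal[OF K]) auto
  qed
  ultimately show ?thesis by blast
qed

lemma reduction_numbers_bounded:
  "\<exists>N. \<forall>y n. ipow \<aa> (n + 1) \<subseteq> iprod (red_ideal a m d y) (ipow \<aa> n) \<longrightarrow>
    ipow \<aa> (N + 1) \<subseteq> iprod (red_ideal a m d y) (ipow \<aa> N)"
proof -
  obtain T where T: "is_subring T" "noetherian_set T" "range (uconst :: 'a \<Rightarrow> 'a upoly) \<subseteq> T"
    "(\<lambda>(i, j). uvar i j) ` ({1..d} \<times> {1..m}) \<subseteq> T"
    using noetherian_adjoin_finite[OF is_subring_image[OF uconst_hom is_subring_UNIV] noetherian_set_uconst,
      of "(\<lambda>(i, j). uvar i j) ` ({1..d} \<times> {1..m})"] by auto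
  define good where "good n y \<longleftrightarrow> ipow \<aa> (n + 1) \<subseteq> iprod (red_ideal a m d y) (ipow \<aa> n)" for n y
  have good_mono: "good k y" if "good n y" "n \<le> k" for n k y
    using reduction_step_mono[OF is_submod_a is_submod_red_ideal, of n a m d y k] that by (simp add: good_def)
  \<comment> \<open>\<open>I n\<close> is the ideal of the polynomials that vanish modulo
    \<open>\<mm>\<close> wherever exponent \<open>n\<close> fails; failures become fewer as
    \<open>n\<close> grows, so these ideals increase. If \<open>y\<close> succeeded only after the
    stable index, its detecting polynomial would lie in the stable ideal and yet take the value 1 at
    \<open>y\<close>.\<close>
  define I where "I n = {f \<in> T. \<forall>y. \<not> good n y \<longrightarrow> specialize y f \<in> \<mm>}" for n
  have "is_submod T (I n)" for n
    unfolding is_submod_def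
  proof (intro conjI ballI)
    interpret sp: comm_ring_hom "specialize y" for y by (rule specialize_hom)
    show "0 \<in> I n" using is_subringD(1)[OF T(1)] is_submodD(1)[OF m_submod] by (simp add: I_def)
    show "x + z \<in> I n" if "x \<in> I n" "z \<in> I n" for x z
      using that is_subringD(3)[OF T(1)] is_submodD(2)[OF m_submod] by (simp add: I_def sp.hom_add)
    show "t * x \<in> I n" if "t \<in> T" "x \<in> I n" for t x
      using that is_subringD(6)[OF T(1)] is_submodD(3)[OF m_submod] by (simp add: I_def sp.hom_mult)
  qed
  moreover have "I n \<subseteq> T" for n by (auto simp: I_def)
  moreover have "mono I" using good_mono by (fastforce simp: mono_def I_def)
  ultimately have "\<exists>N. \<forall>n\<ge>N. I n = I N"
    using T(2)[unfolded noetherian_set_def, rule_format, of I] by metis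
  then obtain N where N: "\<forall>n\<ge>N. I n = I N" by (rule exE)
  have "good N y" if y: "good n y" for n y
  proof (rule ccontr)
    assume nN: "\<not> good N y"
    obtain f where f: "f \<in> T" "specialize y f = 1" "\<And>z. specialize z f \<notin> \<mm> \<Longrightarrow> good n z"
      using exists_polynomial_detecting_reduction[OF _ T(1,3,4), of n y] y unfolding good_def by metis
    have "f \<in> I n" using f by (auto simp: I_def)
    moreover have "n \<ge> N" using good_mono[OF y, of N] nN by linarith
    ultimately have "f \<in> I N" using N by blast
    then have "specialize y f \<in> \<mm>" using nN by (simp add: I_def)
    then show False using f(2) one_notin_m by simp
  qed
  then show ?thesis unfolding good_def by blast
qed

end

end

section \<open>Independence of the generators of a minimal reduction\<close>

definition exp_degree :: "('v \<Rightarrow>\<^sub>0 nat) \<Rightarrow> nat" where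
  "exp_degree e = (\<Sum>v\<in>Poly_Mapping.keys e. Poly_Mapping.lookup e v)"

definition homogeneous_eval :: "nat \<Rightarrow> ('v \<Rightarrow> 'a::comm_ring_1) \<Rightarrow> (('v \<Rightarrow>\<^sub>0 nat) \<Rightarrow>\<^sub>0 'a) \<Rightarrow> 'a" where
  "homogeneous_eval N y f =
     (\<Sum>e\<in>Poly_Mapping.keys f. if exp_degree e = N then Poly_Mapping.lookup f e * mon_eval y e else 0)"

text \<open>Substitutes \<open>y v * t\<close> for the variable \<open>v\<close>, so that the power
  of \<open>t\<close> records the degree. For \<open>y = q\<close> this maps the polynomial ring
  into the Rees algebra.\<close>

abbreviation graded_eval :: "('v \<Rightarrow> 'a::comm_ring_1) \<Rightarrow> (('v \<Rightarrow>\<^sub>0 nat) \<Rightarrow>\<^sub>0 'a) \<Rightarrow> 'a poly" where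
  "graded_eval y \<equiv> poly_eval (\<lambda>c. [:c:]) (\<lambda>v. monom (y v) (Suc 0))"

lemma prod_monom: "(\<Prod>i\<in>A. monom (f i) (n i)) = monom (\<Prod>i\<in>A. f i :: 'a::comm_ring_1) (\<Sum>i\<in>A. n i)"
  by (induction A rule: infinite_finite_induct) (auto simp: mult_monom)

lemma mon_eval_monom: "mon_eval (\<lambda>v. monom (y v) (Suc 0)) e = monom (mon_eval y e) (exp_degree e)"
  unfolding mon_eval_def exp_degree_def by (simp add: monom_power prod_monom)

lemma coeff_graded_eval: "coeff (graded_eval y f) N = homogeneous_eval N y f"
  unfolding poly_eval_def homogeneous_eval_def coeff_sum mon_eval_monom
  by (intro sum.cong) auto

lemma homogeneous_eval_scale:
  "homogeneous_eval N (\<lambda>v. u * y v) f = u ^ N * homogeneous_eval N y f"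
proof -
  have "mon_eval (\<lambda>v. u * y v) e = u ^ exp_degree e * mon_eval y e" for e
    by (simp add: mon_eval_def exp_degree_def power_mult_distrib prod.distrib power_sum)
  then show ?thesis
    unfolding homogeneous_eval_def sum_distrib_left by (intro sum.cong) (auto simp: mult_ac)
qed

lemma poly_graded_eval: "poly (graded_eval y f) t = poly_eval (\<lambda>c. c) (\<lambda>v. t * y v) f"
  by (subst poly_eval_hom_comp[OF comm_ring_hom_poly]) (simp add: poly_monom mult.commute)

lemma is_submod_plus:
  assumes "is_submod S I" "is_submod S J"
  shows "is_submod S {x + y |x y. x \<in> I \<and> y \<in> J}"
  unfolding is_submod_def
proof (intro conjI ballI)
  show "0 \<in> {x + y |x y. x \<in> I \<and> y \<in> J}"
    using assms[THEN is_submodD(1)] by (intro CollectI exI[of _ 0]) simp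
  fix v w assume "v \<in> {x + y |x y. x \<in> I \<and> y \<in> J}" "w \<in> {x + y |x y. x \<in> I \<and> y \<in> J}"
  then obtain x y x' y' where "v = x + y" "x \<in> I" "y \<in> J" "w = x' + y'" "x' \<in> I" "y' \<in> J" by auto
  then show "v + w \<in> {x + y |x y. x \<in> I \<and> y \<in> J}"
    using is_submodD(2)[OF assms(1)] is_submodD(2)[OF assms(2)]
    by (intro CollectI exI[of _ "x + x'"] exI[of _ "y + y'"]) (simp add: algebra_simps)
next
  fix s v assume "s \<in> S" "v \<in> {x + y |x y. x \<in> I \<and> y \<in> J}"
  then obtain x y where "v = x + y" "x \<in> I" "y \<in> J" by auto
  then show "s * v \<in> {x + y |x y. x \<in> I \<and> y \<in> J}"
    using is_submodD(3)[OF assms(1)] is_submodD(3)[OF assms(2)] \<open>s \<in> S\<close>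
    by (intro CollectI exI[of _ "s * x"] exI[of _ "s * y"]) (simp add: algebra_simps)
qed

text \<open>The Rees algebra, the sum of the \<open>I^n t^n\<close>, inside the polynomials in
  \<open>t\<close>.\<close>

definition rees :: "'a::comm_ring_1 set \<Rightarrow> 'a poly set" where
  "rees I = {p. \<forall>n. coeff p n \<in> ipow I n}"

lemma is_subring_rees:
  assumes "is_submod UNIV I"
  shows "is_subring (rees I)"
  unfolding is_subring_def
proof (intro conjI ballI)
  note P = is_submod_ipow[OF assms]
  show "1 \<in> rees I" using is_submodD(1)[OF P] by (auto simp: rees_def coeff_1)
  fix x y assume xy: "x \<in> rees I" "y \<in> rees I"
  then show "x - y \<in> rees I" using is_submod_diff[OF P is_subring_UNIV] by (auto simp: rees_def)
  have "coeff x i * coeff y (n - i) \<in> ipow I n" if "i \<le> n" for i n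
    using ipow_mult[OF assms, of "coeff x i" i "coeff y (n - i)" "n - i"] xy that by (simp add: rees_def)
  then show "x * y \<in> rees I"
    unfolding rees_def by (auto simp: coeff_mult intro!: is_submod_sum[OF P])
qed

lemma monom_in_rees: "is_submod UNIV I \<Longrightarrow> c \<in> ipow I n \<Longrightarrow> monom c n \<in> rees I"
  using is_submodD(1)[OF is_submod_ipow] by (auto simp: rees_def)

lemma power_in_ipow: "x \<in> I \<Longrightarrow> x ^ k \<in> ipow I k"
  by (induction k) (simp_all add: iprodI power_Suc2 del: power_Suc)

text \<open>\<open>minimal\<close> combines two facts, that \<open>Q\<close> is a minimal reduction
  and that \<open>s\<close> is its least number of generators: fewer than \<open>s\<close> elements
  of \<open>Q\<close> never generate a reduction of \<open>\<aa>\<close>. The family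
  \<open>q\<close> continues by zero because the polynomials evaluated at it have variables of all
  natural indices.\<close>

locale minimal_generators = noeth_local \<mm> for \<mm> :: "'a::comm_ring_1 set" +
  fixes \<aa> Q :: "'a set" and q :: "nat \<Rightarrow> 'a" and s n0 :: nat
  assumes \<aa>: "is_submod UNIV \<aa>"
    and Q: "Q = lin_combs UNIV {..<s} q"
    and q0: "\<And>i. i \<ge> s \<Longrightarrow> q i = 0"
    and Qa: "Q \<subseteq> \<aa>"
    and red: "ipow \<aa> (n0 + 1) \<subseteq> iprod Q (ipow \<aa> n0)"
    and minimal: "\<And>A p n. A \<subset> {..<s} \<Longrightarrow> (\<And>i. i \<in> A \<Longrightarrow> p i \<in> Q) \<Longrightarrow>
      \<not> ipow \<aa> (n + 1) \<subseteq> iprod (lin_combs UNIV A p) (ipow \<aa> n)"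
begin

lemma is_submod_Q: "is_submod UNIV Q"
  unfolding Q by (rule is_submod_lin_combs) simp

lemma q_in_Q: "q i \<in> Q"
proof (cases "i < s")
  case True
  then show ?thesis unfolding Q by (intro gen_in_lin_combs) auto
next
  case False
  then show ?thesis using q0[of i] is_submodD(1)[OF is_submod_Q] by simp
qed

lemma ipow_add_reduction: "ipow \<aa> (n0 + N) \<subseteq> iprod (ipow Q N) (ipow \<aa> n0)"
proof (induction N)
  case 0
  then show ?case using iprod_UNIV[OF is_submod_ipow[OF \<aa>, of n0]]
      iprod_commute[OF is_submod_UNIV is_submod_ipow[OF \<aa>, of n0]] by simp
next
  case (Suc N)
  note P = is_submod_ipow[OF \<aa>] and R = is_submod_ipow[OF is_submod_Q]
  have "ipow \<aa> (n0 + Suc N) = iprod (ipow \<aa> (n0 + N)) \<aa>" by simp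
  also have "\<dots> \<subseteq> iprod (iprod (ipow Q N) (ipow \<aa> n0)) \<aa>"
    by (intro iprod_mono Suc.IH order_refl is_submod_iprod P R \<aa>)
  also have "\<dots> = iprod (ipow Q N) (ipow \<aa> (n0 + 1))"
    using iprod_assoc[OF R[of N] P[of n0] \<aa>] by simp
  also have "\<dots> \<subseteq> iprod (ipow Q N) (iprod Q (ipow \<aa> n0))"
    by (intro iprod_mono red order_refl is_submod_iprod P R is_submod_Q)
  also have "\<dots> = iprod (ipow Q (Suc N)) (ipow \<aa> n0)"
    using iprod_assoc[OF R[of N] is_submod_Q P[of n0]] by simp
  finally show ?case .
qed

lemma ipow_Q_subset: "ipow Q N \<subseteq> ipow \<aa> N"
proof (induction N)
  case (Suc N)
  then show ?case using iprod_mono[OF Suc Qa is_submod_ipow[OF \<aa>] \<aa>] by simp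
qed simp

text \<open>\<open>q'\<close> has one generator fewer than \<open>Q\<close>, and
  \<open>Q = q' + (q j)\<close>, so \<open>Q^(N+1)\<close> is contained in \<open>q' Q^N\<close>
  plus the multiples of \<open>q j ^ Suc N\<close>. By hypothesis this last power is in
  \<open>q' Q^N\<close> modulo \<open>\<mm>\<close>. Multiplying by the power \<open>n0\<close> of
  \<open>\<aa>\<close> and applying Nakayama makes \<open>q'\<close> a reduction, against
  \<open>minimal\<close>.\<close>

lemma power_generator_obstruction:
  assumes j: "j < s" and \<mu>: "\<mu> j = 1" and q': "q' = lin_combs UNIV ({..<s} - {j}) (\<lambda>i. q i - q j * \<mu> i)"
    and x: "q j ^ Suc N - x \<in> iprod \<mm> (ipow \<aa> (Suc N))" "x \<in> iprod q' (ipow Q N)"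
  shows False
proof -
  note P = is_submod_ipow[OF \<aa>] and R = is_submod_ipow[OF is_submod_Q]
  have q's: "is_submod UNIV q'" unfolding q' by (rule is_submod_lin_combs) simp
  have gQ: "q i - q j * \<mu> i \<in> Q" for i
    using is_submod_diff[OF is_submod_Q is_subring_UNIV q_in_Q] is_submodD(4)[OF is_submod_Q _ q_in_Q, of "\<mu> i" j] by blast
  have q'Q: "q' \<subseteq> Q" unfolding q' by (intro lin_combs_minimal is_submod_Q gQ)
  have dec: "\<exists>y\<in>q'. \<exists>c. z = y + c * q j" if z: "z \<in> Q" for z
  proof -
    obtain c where c: "z = (\<Sum>i<s. c i * q i)" using z unfolding Q lin_combs_def by blast
    have "z = (\<Sum>i<s. c i * (q i - q j * \<mu> i) + c i * \<mu> i * q j)"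
      unfolding c by (intro sum.cong) (auto simp: algebra_simps)
    also have "\<dots> = (\<Sum>i<s. c i * (q i - q j * \<mu> i)) + (\<Sum>i<s. c i * \<mu> i) * q j"
      by (simp add: sum.distrib sum_distrib_right)
    \<comment> \<open>The summand at \<open>j\<close> drops out because
      \<open>\<mu> j = 1\<close>.\<close>
    also have "(\<Sum>i<s. c i * (q i - q j * \<mu> i)) = (\<Sum>i\<in>{..<s} - {j}. c i * (q i - q j * \<mu> i))"
      using j \<mu> by (subst sum.remove[of _ j]) auto
    finally show ?thesis unfolding q' lin_combs_def by blast
  qed
  \<comment> \<open>In a product of elements \<open>y + c * q j\<close> every term has a factor in
    \<open>q'\<close>, except the pure power of \<open>q j\<close>.\<close>
  have decN: "ipow Q (Suc M) \<subseteq> {y + c * q j ^ Suc M | y c. y \<in> iprod q' (ipow Q M) \<and> c \<in> UNIV}" for M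
  proof (induction M)
    case 0
    show ?case
    proof
      fix z assume "z \<in> ipow Q (Suc 0)"
      then have "z \<in> Q" using iprod_UNIV[OF is_submod_Q] iprod_commute[OF is_submod_UNIV is_submod_Q] by simp
      then obtain y c where "y \<in> q'" "z = y + c * q j" using dec by blast
      then show "z \<in> {y + c * q j ^ Suc 0 | y c. y \<in> iprod q' (ipow Q 0) \<and> c \<in> UNIV}"
        using iprod_UNIV[OF q's] by (intro CollectI exI[of _ y] exI[of _ c]) simp
    qed
  next
    case (Suc M)
    let ?Z = "{y + c * q j ^ Suc (Suc M) | y c. y \<in> iprod q' (ipow Q (Suc M)) \<and> c \<in> UNIV}"
    have "v * w \<in> ?Z" if v: "v \<in> ipow Q (Suc M)" and w: "w \<in> Q" for v w
    proof -
      obtain y c where y: "y \<in> iprod q' (ipow Q M)" "v = y + c * q j ^ Suc M"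
        using subsetD[OF Suc v] by auto
      obtain y' c' where y': "y' \<in> q'" "w = y' + c' * q j" using dec[OF w] by blast
      have "y * w \<in> iprod (iprod q' (ipow Q M)) Q" using y w by (intro iprodI)
      then have 1: "y * w \<in> iprod q' (ipow Q (Suc M))"
        using iprod_assoc[OF q's R[of M] is_submod_Q] by simp
      have "y' * q j ^ Suc M \<in> iprod q' (ipow Q (Suc M))"
        by (intro iprodI y' power_in_ipow q_in_Q)
      then have 2: "c * (y' * q j ^ Suc M) \<in> iprod q' (ipow Q (Suc M))"
        by (rule is_submodD(3)[OF is_submod_iprod[OF q's R] UNIV_I])
      have "v * w = y * w + c * q j ^ Suc M * y' + c * q j ^ Suc M * (c' * q j)"
        unfolding y y' by (simp add: algebra_simps)
      then have "v * w = (y * w + c * (y' * q j ^ Suc M)) + (c * c') * q j ^ Suc (Suc M)"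
        by (simp add: mult_ac)
      moreover have "y * w + c * (y' * q j ^ Suc M) \<in> iprod q' (ipow Q (Suc M))"
        by (intro is_submodD(2)[OF is_submod_iprod[OF q's R]] 1 2)
      ultimately show ?thesis
        by (intro CollectI exI[of _ "y * w + c * (y' * q j ^ Suc M)"] exI[of _ "c * c'"]) simp
    qed
    then show ?case unfolding ipow_Suc[of Q "Suc M"]
      by (intro iprod_minimal is_submod_add_multiples is_subring_UNIV is_submod_iprod q's R UNIV_I)
  qed
  define A where "A = ipow \<aa> (n0 + Suc N)"
  define A' where "A' = iprod q' (ipow \<aa> (n0 + N))"
  have A: "is_submod UNIV A" "is_submod UNIV A'" unfolding A_def A'_def by (intro P is_submod_iprod q's)+
  have mA: "is_submod UNIV (iprod \<mm> A)" by (intro is_submod_iprod m_submod A)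
  let ?B = "{y + z | y z. y \<in> A' \<and> z \<in> iprod \<mm> A}"
  have qA': "y * t \<in> A'" if "y \<in> iprod q' (ipow Q N)" "t \<in> ipow \<aa> n0" for y t
  proof -
    have "iprod q' (ipow Q N) \<subseteq> iprod q' (ipow \<aa> N)"
      by (intro iprod_mono ipow_Q_subset order_refl q's P)
    then have "y * t \<in> iprod (iprod q' (ipow \<aa> N)) (ipow \<aa> n0)" using that by (intro iprodI) auto
    then show ?thesis
      using iprod_assoc[OF q's P[of N] P[of n0]] ipow_add[OF \<aa>, of N n0] by (simp add: A'_def add.commute)
  qed
  have mA': "y * t \<in> iprod \<mm> A" if "y \<in> iprod \<mm> (ipow \<aa> (Suc N))" "t \<in> ipow \<aa> n0" for y t
  proof -
    have "y * t \<in> iprod (iprod \<mm> (ipow \<aa> (Suc N))) (ipow \<aa> n0)" using that by (intro iprodI) auto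
    then show ?thesis
      using iprod_assoc[OF m_submod P[of "Suc N"] P[of n0]] ipow_add[OF \<aa>, of "Suc N" n0] by (simp add: A_def add.commute)
  qed
  have "v * t \<in> ?B" if v: "v \<in> ipow Q (Suc N)" and t: "t \<in> ipow \<aa> n0" for v t
  proof -
    obtain y c where y: "y \<in> iprod q' (ipow Q N)" "v = y + c * q j ^ Suc N"
      using subsetD[OF decN v] by auto
    have "v * t = (y + c * x) * t + c * ((q j ^ Suc N - x) * t)"
      unfolding y by (simp add: algebra_simps)
    moreover have "(y + c * x) * t \<in> A'"
      using is_submod_iprod[OF q's R[of N]] by (intro qA' t is_submodD(2) is_submodD(3) y x) auto
    moreover have "c * ((q j ^ Suc N - x) * t) \<in> iprod \<mm> A"
      by (intro is_submodD(3)[OF mA] mA' x t) simp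
    ultimately show ?thesis by blast
  qed
  then have "iprod (ipow Q (Suc N)) (ipow \<aa> n0) \<subseteq> ?B"
    by (rule iprod_minimal[OF is_submod_plus[OF A(2) mA]])
  then have AB: "A \<subseteq> ?B"
    using ipow_add_reduction[of "Suc N"] order_trans unfolding A_def by blast
  have "A \<subseteq> A'"
  proof (rule nakayama[OF A])
    fix v assume "v \<in> A"
    then obtain y z where "v = y + z" "y \<in> A'" "z \<in> iprod \<mm> A" using AB by blast
    then show "\<exists>y\<in>A'. v - y \<in> iprod \<mm> A" by (intro bexI[of _ y]) simp_all
  qed
  then show False
    using minimal[of "{..<s} - {j}" "\<lambda>i. q i - q j * \<mu> i" "n0 + N"] gQ j
    unfolding A_def A'_def q' by auto
qed

text \<open>If a polynomial relation with a unit value at \<open>y\<close> held modulo \<open>\<mm>\<close>, the linear change of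
  variables that sends \<open>y\<close> to a coordinate axis would make a power of one generator
  redundant and hence yield a reduction with fewer generators.\<close>

lemma generators_independent:
  fixes f :: "(nat \<Rightarrow>\<^sub>0 nat) \<Rightarrow>\<^sub>0 'a"
  assumes f: "poly_eval (\<lambda>c. c) y f \<notin> \<mm>" and y0: "\<And>i. i \<ge> s \<Longrightarrow> y i = 0"
  shows "\<exists>N. coeff (graded_eval q f) N \<notin> iprod \<mm> (ipow \<aa> N)"
proof (rule ccontr)
  assume "\<not> ?thesis"
  then have rel: "homogeneous_eval N q f \<in> iprod \<mm> (ipow \<aa> N)" for N by (simp add: coeff_graded_eval)
  note P = is_submod_ipow[OF \<aa>] and R = is_submod_ipow[OF is_submod_Q]
  \<comment> \<open>The part of degree 0 does not depend on the point, and the assumed relation in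
    degree 0 puts it in \<open>\<mm>\<close>; the degree \<open>N\<close> chosen below is therefore
    positive.\<close>
  have hom0: "homogeneous_eval 0 z f = poly_eval (\<lambda>c. c) (\<lambda>_. 0) f" for z
    using poly_graded_eval[of z f 0] by (simp add: poly_0_coeff_0 coeff_graded_eval)
  have f0: "poly_eval (\<lambda>c. c) (\<lambda>_. 0) f \<in> \<mm>"
    using rel[of 0] hom0[of q] iprod_UNIV[OF m_submod] by simp
  have "poly (graded_eval y f) 1 = poly_eval (\<lambda>c. c) y f" using poly_graded_eval[of y f 1] by simp
  then have "(\<Sum>N\<le>degree (graded_eval y f). homogeneous_eval N y f) \<notin> \<mm>"
    using f by (simp add: poly_altdef coeff_graded_eval)
  then have "\<not> (\<forall>N. homogeneous_eval N y f \<in> \<mm>)" by (metis is_submod_sum[OF m_submod])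
  then obtain N where N: "homogeneous_eval N y f \<notin> \<mm>" by blast
  then obtain M where M: "N = Suc M" using hom0 f0 by (cases N) auto
  \<comment> \<open>Otherwise \<open>y\<close> is congruent to the origin, where the value of
    \<open>f\<close> is in \<open>\<mm>\<close>.\<close>
  have "\<exists>j. y j \<notin> \<mm>"
  proof (rule ccontr)
    assume "\<not> ?thesis"
    then have "poly_eval (\<lambda>c. c) y f - poly_eval (\<lambda>c. c) (\<lambda>_. 0) f \<in> \<mm>"
      by (intro poly_eval_cong_mod[OF m_submod is_subring_UNIV]) auto
    then show False using is_submod_cancel[OF m_submod is_subring_UNIV] f f0 by blast
  qed
  then obtain j where j: "y j \<notin> \<mm>" by blast
  then have js: "j < s" using y0[of j] is_submodD(1)[OF m_submod] by (cases "j < s") auto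
  obtain u where u: "1 = y j * u" using unit_outside_m[OF j] by (metis dvdE)
  \<comment> \<open>\<open>y\<close> is scaled to have coordinate 1 at \<open>j\<close>; by
    homogeneity the value in degree \<open>N\<close> changes by the unit
    \<open>u ^ N\<close>.\<close>
  define \<mu> where "\<mu> i = u * y i" for i
  have \<mu>: "\<mu> j = 1" using u by (simp add: \<mu>_def mult.commute)
  define q' where "q' = lin_combs UNIV ({..<s} - {j}) (\<lambda>i. q i - q j * \<mu> i)"
  have q's: "is_submod UNIV q'" unfolding q'_def by (rule is_submod_lin_combs) simp
  have "u \<notin> \<mm>" using u one_notin_m m_prime[of "y j" u] by metis
  then have w: "homogeneous_eval N \<mu> f \<notin> \<mm>"
    using N m_prime m_prime_power by (simp add: \<mu>_def[abs_def] homogeneous_eval_scale)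
  \<comment> \<open>\<open>H\<close> is the ideal generated by \<open>q' t\<close> in the Rees
    algebra of \<open>Q\<close>. Modulo \<open>H\<close> each \<open>q i\<close> in degree one
    becomes \<open>q j * \<mu> i\<close>, so the degree \<open>N\<close> part of \<open>f\<close> at
    \<open>q\<close> becomes \<open>q j ^ N\<close> times a unit.\<close>
  define H where "H = {p. coeff p 0 = 0 \<and> (\<forall>n. coeff p (Suc n) \<in> iprod q' (ipow Q n))}"
  have q'Q: "q' \<subseteq> Q" unfolding q'_def
    by (intro lin_combs_minimal is_submod_Q is_submod_diff[OF is_submod_Q is_subring_UNIV] q_in_Q is_submodD(4)[OF is_submod_Q]) simp
  note K = is_submod_iprod[OF q's R]
  have H: "is_submod (rees Q) H"
    unfolding is_submod_def
  proof (intro conjI ballI)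
    show "0 \<in> H" using is_submodD(1)[OF K] by (simp add: H_def)
    show "x + z \<in> H" if "x \<in> H" "z \<in> H" for x z
      using that is_submodD(2)[OF K] by (simp add: H_def)
    show "r * x \<in> H" if r: "r \<in> rees Q" and x: "x \<in> H" for r x
    proof -
      have "coeff r i * coeff x (Suc n - i) \<in> iprod q' (ipow Q n)" if "i \<le> Suc n" for i n
      proof (cases "i = Suc n")
        case True
        then show ?thesis using x is_submodD(1)[OF K] by (simp add: H_def)
      next
        case False
        then have i: "Suc n - i = Suc (n - i)" "i \<le> n" using that by auto
        have "coeff x (Suc n - i) * coeff r i \<in> iprod (iprod q' (ipow Q (n - i))) (ipow Q i)"
          unfolding i(1) using x r by (intro iprodI) (auto simp: H_def rees_def)
        also have "\<dots> = iprod q' (ipow Q n)"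
          using iprod_assoc[OF q's R R] ipow_add[OF is_submod_Q, of "n - i" i] i(2) by simp
        finally show ?thesis by (simp add: mult.commute)
      qed
      then have "coeff (r * x) (Suc n) \<in> iprod q' (ipow Q n)" for n
        unfolding coeff_mult by (intro is_submod_sum[OF K]) simp
      moreover have "coeff (r * x) 0 = 0" using x by (simp add: coeff_mult H_def)
      ultimately show ?thesis by (simp add: H_def)
    qed
  qed
  have Q1: "ipow Q (Suc 0) = Q"
    using iprod_UNIV[OF is_submod_Q] iprod_commute[OF is_submod_UNIV is_submod_Q] by simp
  have "graded_eval q f - graded_eval (\<lambda>i. q j * \<mu> i) f \<in> H"
  proof (rule poly_eval_cong_mod[OF H is_subring_rees[OF is_submod_Q]])
    show "[:c:] \<in> rees Q" for c
      using monom_in_rees[OF is_submod_Q, of c 0] by (simp add: monom_0)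
    show "monom (q v) (Suc 0) \<in> rees Q" for v
      using q_in_Q Q1 by (intro monom_in_rees[OF is_submod_Q]) simp
    show "monom (q j * \<mu> v) (Suc 0) \<in> rees Q" for v
      using is_submodD(4)[OF is_submod_Q _ q_in_Q] Q1 by (intro monom_in_rees[OF is_submod_Q]) simp
    fix v
    have "q v - q j * \<mu> v \<in> q'"
    proof (cases "v \<in> {..<s} - {j}")
      case True
      then show ?thesis unfolding q'_def by (intro gen_in_lin_combs) auto
    next
      case False
      then have "q v - q j * \<mu> v = 0" using \<mu> q0[of v] y0[of v] by (auto simp: \<mu>_def)
      then show ?thesis using is_submodD(1)[OF q's] by simp
    qed
    then show "monom (q v) (Suc 0) - monom (q j * \<mu> v) (Suc 0) \<in> H"
      using iprod_UNIV[OF q's] is_submodD(1)[OF K]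
      by (auto simp: H_def diff_monom coeff_monom)
  qed
  then have "homogeneous_eval N q f - homogeneous_eval N (\<lambda>i. q j * \<mu> i) f \<in> iprod q' (ipow Q M)"
    unfolding coeff_graded_eval[symmetric] M by (simp add: H_def)
  then have "homogeneous_eval N q f - q j ^ N * homogeneous_eval N \<mu> f \<in> iprod q' (ipow Q M)"
    by (simp add: homogeneous_eval_scale)
  then have "homogeneous_eval N \<mu> f * q j ^ N - homogeneous_eval N q f \<in> iprod q' (ipow Q M)"
    using is_submod_neg[OF K is_subring_UNIV] by (metis minus_diff_eq mult.commute)
  moreover define x where "x = homogeneous_eval N \<mu> f * q j ^ N - homogeneous_eval N q f"
  ultimately have x: "x \<in> iprod q' (ipow Q M)"
    "homogeneous_eval N \<mu> f * q j ^ N - x \<in> iprod \<mm> (ipow \<aa> N)"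
    using rel[of N] by simp_all
  obtain t where t: "1 = homogeneous_eval N \<mu> f * t" using unit_outside_m[OF w] by (metis dvdE)
  have "t * (homogeneous_eval N \<mu> f * q j ^ N - x) = (homogeneous_eval N \<mu> f * t) * q j ^ N - t * x"
    by (simp add: algebra_simps)
  also have "\<dots> = q j ^ N - t * x" using t by simp
  finally have "q j ^ N - t * x \<in> iprod \<mm> (ipow \<aa> N)"
    using is_submodD(3)[OF is_submod_iprod[OF m_submod P] UNIV_I x(2), of t] by simp
  then show False
    using power_generator_obstruction[OF js \<mu> q'_def, of M "t * x"] is_submodD(3)[OF K UNIV_I x(1), of t] M
    by simp
qed

end

section \<open>A chain of primes in the Rees algebra\<close>

lemma monom_sum_coeff: "monom (\<Sum>i\<in>A. f i) n = (\<Sum>i\<in>A. monom (f i :: 'a::comm_monoid_add) n)"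
  by (induction A rule: infinite_finite_induct) (auto simp flip: add_monom)

text \<open>Division by \<open>t - r\<close> at a root \<open>r\<close> modulo \<open>\<mm>\<close>
  leaves a remainder in \<open>\<mm>\<close> and a quotient of smaller degree; as
  \<open>\<mm>\<close> is prime, every root not congruent to \<open>r\<close> is a root of the
  quotient.\<close>

lemma (in noeth_local) finite_roots_mod:
  fixes p :: "'a poly"
  assumes "poly p t\<^sub>0 \<notin> \<mm>"
  shows "\<exists>F. finite F \<and> (\<forall>t. poly p t \<in> \<mm> \<longrightarrow> (\<exists>r\<in>F. t - r \<in> \<mm>))"
  using assms
proof (induction "degree p" arbitrary: p rule: less_induct)
  case less
  show ?case
  proof (cases "\<exists>r. poly p r \<in> \<mm>")
    case False
    then show ?thesis by (intro exI[of _ "{}"]) auto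
  next
    case True
    then obtain r where r: "poly p r \<in> \<mm>" by blast
    let ?g = "synthetic_div p r"
    have p: "poly p t = (t - r) * poly ?g t + poly p r" for t
      using arg_cong[OF synthetic_div_correct'[of r p], of "\<lambda>p. poly p t"] by (simp add: algebra_simps)
    have "degree p \<noteq> 0"
    proof
      assume "degree p = 0"
      then obtain c where "p = [:c:]" by (rule degree_eq_zeroE)
      then show False using r less.prems by simp
    qed
    moreover have "poly ?g t\<^sub>0 \<notin> \<mm>"
      using less.prems p[of t\<^sub>0] r is_submodD(2)[OF m_submod _ r, of "(t\<^sub>0 - r) * poly ?g t\<^sub>0"] m_prime by auto
    ultimately obtain F where F: "finite F" "\<And>t. poly ?g t \<in> \<mm> \<Longrightarrow> \<exists>r\<in>F. t - r \<in> \<mm>"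
      using less.hyps[of ?g] by (auto simp: degree_synthetic_div)
    have "\<exists>r'\<in>insert r F. t - r' \<in> \<mm>" if "poly p t \<in> \<mm>" for t
    proof -
      have "(t - r) * poly ?g t \<in> \<mm>"
        using is_submod_diff[OF m_submod is_subring_UNIV that r] p[of t] by simp
      then show ?thesis using F(2) by (auto simp: m_prime)
    qed
    then show ?thesis using F(1) by (intro exI[of _ "insert r F"]) simp
  qed
qed

context minimal_generators
begin

abbreviation "polyval \<equiv> poly_eval (\<lambda>c::'a. c)"

text \<open>Defined through values, this is the ideal generated by \<open>\<mm>\<close>, the first \<open>i\<close> variables and those
  of index at least \<open>s\<close>, because the residue field is infinite; its primality is then a
  matter of moving along a line.\<close>

definition vanishing :: "nat \<Rightarrow> ((nat \<Rightarrow>\<^sub>0 nat) \<Rightarrow>\<^sub>0 'a) set" where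
  "vanishing i = {f. \<forall>y. (\<forall>j. j < i \<or> j \<ge> s \<longrightarrow> y j = 0) \<longrightarrow> polyval y f \<in> \<mm>}"

definition xvar :: "nat \<Rightarrow> (nat \<Rightarrow>\<^sub>0 nat) \<Rightarrow>\<^sub>0 'a" where
  "xvar i = Poly_Mapping.single (Poly_Mapping.single i 1) 1"

lemma polyval_hom: "comm_ring_hom (polyval y)"
  by (rule comm_ring_hom.comm_ring_hom_poly_eval[OF comm_ring_hom_ident])

lemma graded_eval_hom: "comm_ring_hom (graded_eval q)"
  by (rule comm_ring_hom.comm_ring_hom_poly_eval[OF comm_ring_hom_const_poly])

lemma polyval_xvar: "polyval y (xvar i) = y i"
  by (simp add: xvar_def comm_ring_hom.poly_eval_single[OF comm_ring_hom_ident])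

lemma graded_eval_xvar: "graded_eval q (xvar i) = monom (q i) (Suc 0)"
  by (simp add: xvar_def comm_ring_hom.poly_eval_single[OF comm_ring_hom_const_poly] one_pCons[symmetric])

lemma is_submod_vanishing: "is_submod UNIV (vanishing i)"
  unfolding is_submod_def
proof (intro conjI ballI)
  interpret p: comm_ring_hom "polyval y" for y by (rule polyval_hom)
  show "0 \<in> vanishing i" using is_submodD(1)[OF m_submod] by (simp add: vanishing_def)
  show "x + z \<in> vanishing i" if "x \<in> vanishing i" "z \<in> vanishing i" for x z
    using that is_submodD(2)[OF m_submod] by (simp add: vanishing_def p.hom_add)
  show "t * x \<in> vanishing i" if "x \<in> vanishing i" for t x
    using that is_submodD(3)[OF m_submod] by (simp add: vanishing_def p.hom_mult)
qed

lemma one_notin_vanishing: "1 \<notin> vanishing i"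
proof -
  have "polyval (\<lambda>_. 0) 1 \<notin> \<mm>" using one_notin_m by (simp add: comm_ring_hom.poly_eval_1[OF comm_ring_hom_ident])
  then show ?thesis unfolding vanishing_def by auto
qed

lemma vanishing_prime:
  assumes "f \<notin> vanishing i" "g \<notin> vanishing i"
  shows "f * g \<notin> vanishing i"
proof -
  obtain y where y: "\<forall>j. j < i \<or> j \<ge> s \<longrightarrow> y j = 0" "polyval y f \<notin> \<mm>" using assms(1) by (auto simp: vanishing_def)
  obtain z where z: "\<forall>j. j < i \<or> j \<ge> s \<longrightarrow> z j = 0" "polyval z g \<notin> \<mm>" using assms(2) by (auto simp: vanishing_def)
  \<comment> \<open>The line from \<open>y\<close> at \<open>t = 0\<close> to \<open>z\<close> at
    \<open>t = 1\<close> stays in the coordinate subspace. Neither polynomial vanishes modulo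
    \<open>\<mm>\<close> on all of it, so some \<open>t\<close> avoids the finitely many residue
    classes of roots of both.\<close>
  define line where "line h = poly_eval (\<lambda>c. [:c:]) (\<lambda>v. [:y v, z v - y v:]) h" for h :: "(nat \<Rightarrow>\<^sub>0 nat) \<Rightarrow>\<^sub>0 'a"
  have line: "poly (line h) t = polyval (\<lambda>v. y v + t * (z v - y v)) h" for h t
    unfolding line_def by (subst poly_eval_hom_comp[OF comm_ring_hom_poly]) simp
  have "poly (line f) 0 \<notin> \<mm>" "poly (line g) 1 \<notin> \<mm>" using y z by (simp_all add: line)
  from this[THEN finite_roots_mod] obtain F G where FG: "finite F" "finite G"
    "\<forall>t. poly (line f) t \<in> \<mm> \<longrightarrow> (\<exists>r\<in>F. t - r \<in> \<mm>)" "\<forall>t. poly (line g) t \<in> \<mm> \<longrightarrow> (\<exists>r\<in>G. t - r \<in> \<mm>)"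
    by (elim exE conjE)
  obtain t where t: "\<forall>r\<in>F \<union> G. t - r \<notin> \<mm>" using residue_infinite[of "F \<union> G"] FG by auto
  let ?w = "\<lambda>v. y v + t * (z v - y v)"
  interpret p: comm_ring_hom "polyval ?w" by (rule polyval_hom)
  have "poly (line f) t \<notin> \<mm>" "poly (line g) t \<notin> \<mm>" using FG(3,4) t by blast+
  then have "polyval ?w (f * g) \<notin> \<mm>" by (simp add: p.hom_mult line m_prime)
  moreover have "\<forall>j. j < i \<or> j \<ge> s \<longrightarrow> ?w j = 0" using y z by simp
  ultimately show ?thesis
    unfolding vanishing_def mem_Collect_eq not_all not_imp by (intro exI[of _ ?w] conjI)
qed

lemma vanishing_power: "f \<notin> vanishing i \<Longrightarrow> f ^ n \<notin> vanishing i"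
  by (induction n) (auto simp: one_notin_vanishing vanishing_prime)

lemma vanishing_mono: "vanishing i \<subseteq> vanishing (Suc i)"
  by (auto simp: vanishing_def)

lemma xvar_vanishing: "xvar i \<in> vanishing (Suc i)" "i < s \<Longrightarrow> xvar i \<notin> vanishing i"
proof -
  show "xvar i \<in> vanishing (Suc i)"
    using is_submodD(1)[OF m_submod] by (simp add: vanishing_def polyval_xvar)
  assume "i < s"
  then show "xvar i \<notin> vanishing i"
    using one_notin_m by (auto simp: vanishing_def polyval_xvar intro!: exI[of _ "\<lambda>j. if j = i then 1 else 0"])
qed

text \<open>Disjointness of a prime \<open>P\<close> from this set says that the preimage of
  \<open>P\<close> under \<open>graded_eval q\<close> is contained in \<open>vanishing i\<close>.
  The chain of primes carries this inclusion along instead of an exact preimage.\<close>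

definition nonvanishing_values :: "nat \<Rightarrow> 'a poly set" where
  "nonvanishing_values i = graded_eval q ` (- vanishing i)"

lemma nonvanishing_values_mult:
  "1 \<in> nonvanishing_values i"
  "x \<in> nonvanishing_values i \<Longrightarrow> y \<in> nonvanishing_values i \<Longrightarrow> x * y \<in> nonvanishing_values i"
proof -
  interpret e: comm_ring_hom "graded_eval q" by (rule graded_eval_hom)
  show "1 \<in> nonvanishing_values i"
    unfolding nonvanishing_values_def using one_notin_vanishing by (intro image_eqI[of _ _ 1]) auto
  assume "x \<in> nonvanishing_values i" "y \<in> nonvanishing_values i"
  then obtain f g where "x = graded_eval q f" "y = graded_eval q g" "f \<notin> vanishing i" "g \<notin> vanishing i"
    by (auto simp: nonvanishing_values_def)
  then show "x * y \<in> nonvanishing_values i"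
    unfolding nonvanishing_values_def using vanishing_prime
    by (intro image_eqI[of _ _ "f * g"]) (auto simp: e.hom_mult)
qed

lemma graded_eval_in_rees: "graded_eval q f \<in> rees \<aa>"
proof (rule poly_eval_in_subring[OF is_subring_rees[OF \<aa>]])
  show "[:c:] \<in> rees \<aa>" for c using monom_in_rees[OF \<aa>, of c 0] by (simp add: monom_0)
  have "iprod UNIV \<aa> = \<aa>" using iprod_UNIV[OF \<aa>] iprod_commute[OF is_submod_UNIV \<aa>] by simp
  then show "monom (q v) (Suc 0) \<in> rees \<aa>" for v
    using q_in_Q Qa by (intro monom_in_rees[OF \<aa>]) auto
qed

text \<open>The extension of \<open>\<mm>\<close> to the Rees algebra, which is the kernel of the
  projection onto the fiber ring.\<close>

definition max_rees :: "'a poly set" where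
  "max_rees = {p. \<forall>n. coeff p n \<in> iprod \<mm> (ipow \<aa> n)}"

lemma max_rees_subset: "max_rees \<subseteq> rees \<aa>"
  using iprod_subset[OF is_submod_ipow[OF \<aa>]] by (auto simp: max_rees_def rees_def)

lemma is_submod_max_rees: "is_submod (rees \<aa>) max_rees"
  unfolding is_submod_def
proof (intro conjI ballI)
  note P = is_submod_ipow[OF \<aa>] and K = is_submod_iprod[OF m_submod is_submod_ipow[OF \<aa>]]
  show "0 \<in> max_rees" using is_submodD(1)[OF K] by (simp add: max_rees_def)
  show "x + z \<in> max_rees" if "x \<in> max_rees" "z \<in> max_rees" for x z
    using that is_submodD(2)[OF K] by (simp add: max_rees_def)
  show "r * x \<in> max_rees" if r: "r \<in> rees \<aa>" and x: "x \<in> max_rees" for r x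
  proof -
    have "coeff r i * coeff x (n - i) \<in> iprod \<mm> (ipow \<aa> n)" if "i \<le> n" for i n
    proof -
      have "coeff x (n - i) * coeff r i \<in> iprod (iprod \<mm> (ipow \<aa> (n - i))) (ipow \<aa> i)"
        using x r by (intro iprodI) (auto simp: max_rees_def rees_def)
      also have "\<dots> = iprod \<mm> (ipow \<aa> n)"
        using iprod_assoc[OF m_submod P P] ipow_add[OF \<aa>, of "n - i" i] that by simp
      finally show ?thesis by (simp add: mult.commute)
    qed
    then show ?thesis
      by (auto simp: max_rees_def coeff_mult intro!: is_submod_sum[OF K])
  qed
qed

text \<open>Here the independence of the generators enters and starts the chain:
  \<open>max_rees\<close> can be enlarged to a prime that avoids
  \<open>nonvanishing_values 0\<close>.\<close>

lemma max_rees_disjoint: "max_rees \<inter> nonvanishing_values 0 = {}"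
proof -
  have "graded_eval q f \<notin> max_rees" if f: "f \<notin> vanishing 0" for f
  proof -
    obtain y where "\<forall>j. j \<ge> s \<longrightarrow> y j = 0" "polyval y f \<notin> \<mm>" using f by (auto simp: vanishing_def)
    then show ?thesis using generators_independent[of y f] by (auto simp: max_rees_def)
  qed
  then show ?thesis by (auto simp: nonvanishing_values_def)
qed

text \<open>Beyond degree \<open>n0\<close> each power of \<open>\<aa>\<close> is \<open>Q\<close>
  times the preceding one, and the generators of \<open>Q\<close> in degree one are values of
  variables; so generators of the powers up to \<open>n0\<close>, placed in their degrees,
  suffice.\<close>

lemma rees_finite_over_values:
  "\<exists>K e. (\<forall>l<K. e l \<in> rees \<aa>) \<and> rees \<aa> \<subseteq> lin_combs (range (graded_eval q)) {..<K::nat} e"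
proof -
  note P = is_submod_ipow[OF \<aa>]
  let ?T = "range (graded_eval q)"
  have T: "is_subring ?T" by (rule is_subring_image[OF graded_eval_hom is_subring_UNIV])
  have "\<exists>k g. ipow \<aa> i = lin_combs UNIV {..<k::nat} g" for i by (rule finitely_generated[OF P])
  then obtain k g where g: "\<And>i. ipow \<aa> i = lin_combs UNIV {..<k i :: nat} (g i)" by metis
  let ?A = "Sigma {..n0} (\<lambda>i. {..<k i})"
  let ?e = "\<lambda>(i, l). monom (g i l) i"
  let ?L = "lin_combs ?T ?A ?e"
  have fin: "finite ?A" by simp
  have L: "is_submod ?T ?L" by (rule is_submod_lin_combs[OF is_submod_self[OF T]])
  have const: "[:c:] \<in> ?T" for c
  proof -
    have "graded_eval q (Poly_Mapping.single 0 c) = [:c:]"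
      by (simp add: comm_ring_hom.poly_eval_single[OF comm_ring_hom_const_poly])
    then show ?thesis by (metis rangeI)
  qed
  have mon: "monom y n \<in> ?L" if "y \<in> ipow \<aa> n" for y n
    using that
  proof (induction n arbitrary: y rule: less_induct)
    case (less n)
    show ?case
    proof (cases "n \<le> n0")
      case True
      obtain c where c: "y = (\<Sum>l<k n. c l * g n l)" using less.prems unfolding g lin_combs_def by blast
      have "monom y n = (\<Sum>l<k n. [:c l:] * monom (g n l) n)"
        unfolding c monom_sum_coeff by (simp add: smult_monom)
      also have "\<dots> \<in> ?L"
      proof (intro is_submod_sum[OF L] is_submodD(3)[OF L] const)
        fix l assume "l \<in> {..<k n}"
        then show "monom (g n l) n \<in> ?L"
          using True gen_in_lin_combs[OF T fin, of "(n, l)" ?e] by simp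
      qed
      finally show ?thesis .
    next
      case False
      then obtain n' where n': "n = Suc n'" "n0 \<le> n'" by (cases n) auto
      have "y \<in> iprod Q (ipow \<aa> n')"
        using reduction_step_mono[OF \<aa> is_submod_Q red n'(2)] less.prems n'(1) by auto
      then obtain z where z: "y = (\<Sum>i<s. q i * z i)" "\<forall>i<s. z i \<in> ipow \<aa> n'"
        unfolding Q iprod_lin_combs[OF P finite_lessThan] by auto
      have "monom y n = (\<Sum>i<s. monom (q i) (Suc 0) * monom (z i) n')"
        unfolding z n' monom_sum_coeff by (simp add: mult_monom)
      also have "\<dots> \<in> ?L"
      proof (intro is_submod_sum[OF L] is_submodD(3)[OF L])
        show "monom (q i) (Suc 0) \<in> ?T" for i using graded_eval_xvar[of i] by (metis rangeI)
        show "monom (z i) n' \<in> ?L" if "i \<in> {..<s}" for i using that z n' by (intro less.IH) auto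
      qed
      finally show ?thesis .
    qed
  qed
  have RL: "rees \<aa> \<subseteq> ?L"
  proof
    fix p assume "p \<in> rees \<aa>"
    then have "(\<Sum>n\<le>degree p. monom (coeff p n) n) \<in> ?L"
      by (intro is_submod_sum[OF L] mon) (simp add: rees_def)
    then show "p \<in> ?L" by (simp add: poly_as_sum_of_monoms)
  qed
  obtain K :: nat and b where b: "?A = b ` {..<K}"
    using finite_imp_nat_seg_image_inj_on[OF fin] by (auto simp: lessThan_def)
  have "?L \<subseteq> lin_combs ?T {..<K} (\<lambda>l. ?e (b l))"
  proof (rule lin_combs_minimal[OF is_submod_lin_combs[OF is_submod_self[OF T]]])
    fix a assume "a \<in> ?A"
    then obtain l where "l < K" "a = b l" using b by auto
    then show "?e a \<in> lin_combs ?T {..<K} (\<lambda>l. ?e (b l))"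
      using gen_in_lin_combs[OF T, of "{..<K}" l "\<lambda>l. ?e (b l)"] by simp
  qed
  moreover have "?e (b l) \<in> rees \<aa>" if l: "l < K" for l
  proof -
    have "b l \<in> ?A" unfolding b using l by simp
    then obtain i j where ij: "b l = (i, j)" "j < k i" by auto
    then have "g i j \<in> ipow \<aa> i" unfolding g by (intro gen_in_lin_combs) auto
    then show ?thesis using monom_in_rees[OF \<aa>] ij by simp
  qed
  ultimately show ?thesis
    using order_trans[OF RL] by (intro exI[of _ K] exI[of _ "\<lambda>l. ?e (b l)"] conjI allI impI)
qed

definition rees_prime :: "nat \<Rightarrow> 'a poly set \<Rightarrow> bool" where
  "rees_prime i P \<longleftrightarrow> is_submod (rees \<aa>) P \<and> max_rees \<subseteq> P \<and> P \<subseteq> rees \<aa> \<and>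
     P \<inter> nonvanishing_values i = {} \<and> (\<forall>x\<in>rees \<aa>. \<forall>y\<in>rees \<aa>. x * y \<in> P \<longrightarrow> x \<in> P \<or> y \<in> P)"

lemma exists_rees_prime:
  assumes "is_submod (rees \<aa>) I" "max_rees \<subseteq> I" "I \<subseteq> rees \<aa>" "I \<inter> nonvanishing_values i = {}"
  shows "\<exists>P. rees_prime i P \<and> I \<subseteq> P"
proof -
  obtain P where "is_submod (rees \<aa>) P" "I \<subseteq> P" "P \<subseteq> rees \<aa>" "P \<inter> nonvanishing_values i = {}"
    "\<And>x y. x \<in> rees \<aa> \<Longrightarrow> y \<in> rees \<aa> \<Longrightarrow> x * y \<in> P \<Longrightarrow> x \<in> P \<or> y \<in> P"
    using exists_prime_disjoint[OF is_subring_rees[OF \<aa>] assms(1,3,4) nonvanishing_values_mult] by metis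
  then show ?thesis using assms(2) unfolding rees_prime_def by (intro exI[of _ P]) auto
qed

text \<open>The Rees algebra is integral over the subalgebra of values of \<open>graded_eval q\<close>; the
  determinant below plays the role of an integral equation of \<open>r\<close>, multiplied by powers of the
  next variable, as in the going-up theorem.\<close>

lemma rees_prime_step:
  assumes P: "rees_prime i P" and i: "i < s"
  shows "\<exists>P'. rees_prime (Suc i) P' \<and> P \<subset> P'"
proof -
  let ?R = "rees \<aa>" and ?x = "monom (q i) (Suc 0)"
  interpret e: comm_ring_hom "graded_eval q" by (rule graded_eval_hom)
  note R = is_subring_rees[OF \<aa>]
  have Ps: "is_submod ?R P" "max_rees \<subseteq> P" "P \<subseteq> ?R" "P \<inter> nonvanishing_values i = {}"
    using P by (auto simp: rees_prime_def)
  have xR: "?x \<in> ?R" using graded_eval_in_rees[of "xvar i"] by (simp only: graded_eval_xvar)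
  let ?I = "{p + r * ?x |p r. p \<in> P \<and> r \<in> ?R}"
  have I: "is_submod ?R ?I" by (rule is_submod_add_multiples[OF R Ps(1) xR])
  have PI: "P \<subseteq> ?I"
  proof
    fix p assume "p \<in> P"
    then show "p \<in> ?I" using is_subringD(1)[OF R] by (intro CollectI exI[of _ p] exI[of _ 0]) simp
  qed
  have xI: "?x \<in> ?I"
    using is_subringD(2)[OF R] is_submodD(1)[OF Ps(1)] by (intro CollectI exI[of _ 0] exI[of _ 1]) simp
  have IR: "?I \<subseteq> ?R" using Ps(3) is_subringD(3,6)[OF R] xR by auto
  have disj: "w \<notin> nonvanishing_values (Suc i)" if wI: "w \<in> ?I" for w
  proof
    assume "w \<in> nonvanishing_values (Suc i)"
    then obtain f where f: "f \<notin> vanishing (Suc i)" "w = graded_eval q f" by (auto simp: nonvanishing_values_def)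
    obtain p r where pr: "w = p + r * ?x" "p \<in> P" "r \<in> ?R" using wI by auto
    obtain K and e :: "nat \<Rightarrow> 'a poly" where e: "\<And>l. l < K \<Longrightarrow> e l \<in> ?R"
      "?R \<subseteq> lin_combs (range (graded_eval q)) {..<K} e"
      using rees_finite_over_values by metis
    have "\<exists>g. r * e l = (\<Sum>k<K. graded_eval q (g k) * e k)" if "l < K" for l
    proof -
      have "r * e l \<in> lin_combs (range (graded_eval q)) {..<K} e"
        using is_subringD(6)[OF R pr(3) e(1)[OF that]] e(2) by blast
      then obtain c where c: "r * e l = (\<Sum>k<K. c k * e k)" "\<forall>k\<in>{..<K}. c k \<in> range (graded_eval q)"
        by (auto simp: lin_combs_def)
      then have "\<forall>k\<in>{..<K}. \<exists>g. c k = graded_eval q g" by auto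
      then obtain g where "\<forall>k\<in>{..<K}. c k = graded_eval q (g k)" by metis
      then show ?thesis using c(1) by (intro exI[of _ g]) simp
    qed
    then obtain g where g: "\<And>l. l < K \<Longrightarrow> r * e l = (\<Sum>k<K. graded_eval q (g l k) * e k)" by metis
    \<comment> \<open>The value \<open>w\<close> of \<open>f\<close> is \<open>p + r * ?x\<close>,
      and \<open>g\<close> describes multiplication by \<open>r\<close> on the \<open>e l\<close>,
      so the value of \<open>A\<close> sends these to \<open>e l * p\<close>, in \<open>P\<close>.
      On the other hand \<open>det A\<close> is \<open>f ^ K\<close> modulo
      \<open>vanishing (Suc i)\<close>, hence outside that prime and outside the smaller
      \<open>vanishing i\<close>.\<close>
    define A where "A = mat K K (\<lambda>(l, k). (if l = k then f else 0) - xvar i * g l k)"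
    have A: "A \<in> carrier_mat K K" by (simp add: A_def)
    have "det A - det (f \<cdot>\<^sub>m 1\<^sub>m K) \<in> vanishing (Suc i)"
    proof (rule det_cong_mod[OF is_submod_vanishing A])
      fix l k assume "l < K" "k < K"
      then have "A $$ (l, k) - (f \<cdot>\<^sub>m 1\<^sub>m K) $$ (l, k) = (- g l k) * xvar i"
        by (simp add: A_def)
      then show "A $$ (l, k) - (f \<cdot>\<^sub>m 1\<^sub>m K) $$ (l, k) \<in> vanishing (Suc i)"
        using is_submodD(3)[OF is_submod_vanishing UNIV_I xvar_vanishing(1)] by metis
    qed simp
    moreover have "det (f \<cdot>\<^sub>m 1\<^sub>m K) = f ^ K" by simp
    ultimately have "det A \<notin> vanishing (Suc i)"
      using is_submod_cancel[OF is_submod_vanishing is_subring_UNIV] vanishing_power[OF f(1)] by metis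
    then have "det A \<notin> vanishing i" using vanishing_mono by blast
    then have detW: "graded_eval q (det A) \<in> nonvanishing_values i" by (auto simp: nonvanishing_values_def)
    let ?B = "map_mat (graded_eval q) A"
    have BR: "?B $$ (l, k) \<in> ?R" if "l < K" "k < K" for l k
      using that A graded_eval_in_rees by simp
    have Be: "(\<Sum>k<K. ?B $$ (l, k) * e k) \<in> P" if l: "l < K" for l
    proof -
      have "(\<Sum>k<K. ?B $$ (l, k) * e k)
        = (\<Sum>k<K. (if l = k then w * e k else 0) - ?x * (graded_eval q (g l k) * e k))"
        using l by (intro sum.cong) (auto simp: A_def e.hom_minus e.hom_mult e.hom_uminus graded_eval_xvar f(2) algebra_simps)
      also have "\<dots> = w * e l - ?x * (r * e l)"
        using l unfolding g[OF l] by (simp add: sum_subtractf sum_distrib_left)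
      also have "\<dots> = e l * p" unfolding pr(1) by (simp add: algebra_simps)
      also have "\<dots> \<in> P" using is_submodD(3)[OF Ps(1) e(1)[OF l] pr(2)] .
      finally show ?thesis .
    qed
    have dete: "graded_eval q (det A) * e l \<in> P" if "l < K" for l
      using det_mult_in_submod[OF R Ps(1), of ?B K e l] A BR Be that by simp
    \<comment> \<open>As 1 is a combination of the \<open>e l\<close>, the value of
      \<open>det A\<close> is itself in \<open>P\<close>, against the disjointness of
      \<open>P\<close> from \<open>nonvanishing_values i\<close>.\<close>
    obtain c where c: "1 = (\<Sum>l<K. c l * e l)" "\<forall>l\<in>{..<K}. c l \<in> range (graded_eval q)"
      using subsetD[OF e(2) is_subringD(2)[OF R]] by (auto simp: lin_combs_def)
    have "graded_eval q (det A) = graded_eval q (det A) * 1" by simp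
    also have "\<dots> = (\<Sum>l<K. c l * (graded_eval q (det A) * e l))"
      unfolding c(1) sum_distrib_left by (intro sum.cong) (auto simp: mult_ac)
    also have "\<dots> \<in> P"
    proof (intro is_submod_sum[OF Ps(1)])
      fix l assume l: "l \<in> {..<K}"
      have "range (graded_eval q) \<subseteq> ?R" using graded_eval_in_rees by blast
      then have "c l \<in> ?R" using c(2) l by (meson subsetD)
      then show "c l * (graded_eval q (det A) * e l) \<in> P"
        using l by (intro is_submodD(3)[OF Ps(1) _ dete]) simp_all
    qed
    finally show False using detW Ps(4) by blast
  qed
  have "?I \<inter> nonvanishing_values (Suc i) = {}" using disj by (intro equals0I) (elim IntE, blast)
  from exists_rees_prime[OF I order_trans[OF Ps(2) PI] IR this]
  obtain P' where P': "rees_prime (Suc i) P'" "?I \<subseteq> P'" by (elim exE conjE)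
  \<comment> \<open>Strictness: the value of the next variable is in \<open>P'\<close> but not in
    \<open>P\<close>, because \<open>xvar i\<close> is outside \<open>vanishing i\<close>.\<close>
  have "?x \<in> nonvanishing_values i"
    using xvar_vanishing(2)[OF i] graded_eval_xvar[of i] by (auto simp: nonvanishing_values_def intro: rev_image_eqI)
  then have "?x \<notin> P" using Ps(4) by blast
  moreover have "?x \<in> P'" using xI P'(2) by (rule rev_subsetD)
  moreover have "P \<subseteq> P'" using PI P'(2) by (rule order_trans)
  ultimately show ?thesis using P'(1) by blast
qed

lemma rees_prime_chain:
  "\<exists>P. (\<forall>i\<le>s. rees_prime i (P i)) \<and> (\<forall>i<s. P i \<subset> P (Suc i))"
proof -
  have "\<exists>P. rees_prime 0 P"
    using exists_rees_prime[OF is_submod_max_rees order_refl max_rees_subset max_rees_disjoint] by blast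
  then have "\<exists>f. \<forall>n. (n \<le> s \<longrightarrow> rees_prime n (f n)) \<and> (n < s \<longrightarrow> f n \<subset> f (Suc n))"
  proof (intro dependent_nat_choice)
    fix P n assume "n \<le> s \<longrightarrow> rees_prime n P"
    then show "\<exists>P'. (Suc n \<le> s \<longrightarrow> rees_prime (Suc n) P') \<and> (n < s \<longrightarrow> P \<subset> P')"
      using rees_prime_step[of n P] by (cases "n < s") auto
  qed auto
  then show ?thesis by blast
qed

end

section \<open>Primes of the fiber ring\<close>

text \<open>The correspondence for primes that contain the kernel of a surjection; the second
  conclusion is what keeps a chain strict.\<close>

lemma (in ring_hom_cring) primeideal_image:
  assumes surj: "h ` carrier R = carrier S" and P: "primeideal P R"
    and ker: "\<And>x. x \<in> carrier R \<Longrightarrow> h x = \<zero>\<^bsub>S\<^esub> \<Longrightarrow> x \<in> P"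
  shows "primeideal (h ` P) S" "\<And>x. x \<in> carrier R \<Longrightarrow> h x \<in> h ` P \<longleftrightarrow> x \<in> P"
proof -
  interpret P: primeideal P R by (rule P)
  note sub = P.additive_subgroup_axioms
  show mem: "h x \<in> h ` P \<longleftrightarrow> x \<in> P" if x: "x \<in> carrier R" for x
  proof
    assume "h x \<in> h ` P"
    then obtain p where p: "p \<in> P" "h x = h p" by auto
    then have pR: "p \<in> carrier R" by (simp add: P.a_Hcarr)
    have "h (x \<ominus> p) = \<zero>\<^bsub>S\<^esub>"
      using x pR p(2) by (simp add: a_minus_def S.r_neg)
    then have "x \<ominus> p \<in> P" using x pR by (intro ker) auto
    then have "(x \<ominus> p) \<oplus> p \<in> P" using p(1) by (rule additive_subgroup.a_closed[OF sub])
    moreover have "(x \<ominus> p) \<oplus> p = x" using x pR by (simp add: a_minus_def R.a_assoc R.l_neg)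
    ultimately show "x \<in> P" by simp
  qed auto
  have "ideal (h ` P) S"
  proof (rule idealI[OF S.ring_axioms])
    show "subgroup (h ` P) (add_monoid S)"
    proof (rule S.add.subgroupI)
      show "h ` P \<subseteq> carrier S" using P.a_Hcarr by auto
      show "h ` P \<noteq> {}" using additive_subgroup.zero_closed[OF sub] by blast
      show "\<ominus>\<^bsub>S\<^esub> x \<in> h ` P" if "x \<in> h ` P" for x
      proof -
        obtain p where p: "p \<in> P" "x = h p" using \<open>x \<in> h ` P\<close> by auto
        then have "\<ominus>\<^bsub>S\<^esub> x = h (\<ominus> p)" by (simp add: P.a_Hcarr)
        moreover have "\<ominus> p \<in> P" by (rule additive_subgroup.a_inv_closed[OF sub p(1)])
        ultimately show ?thesis by (metis imageI)
      qed
      show "x \<oplus>\<^bsub>S\<^esub> y \<in> h ` P" if xy: "x \<in> h ` P" "y \<in> h ` P" for x y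
      proof -
        obtain p r where pr: "p \<in> P" "x = h p" "r \<in> P" "y = h r" using xy by auto
        then have "x \<oplus>\<^bsub>S\<^esub> y = h (p \<oplus> r)" by (simp add: P.a_Hcarr)
        moreover have "p \<oplus> r \<in> P" by (rule additive_subgroup.a_closed[OF sub pr(1,3)])
        ultimately show ?thesis by (metis imageI)
      qed
    qed
    fix a x assume ax: "a \<in> h ` P" "x \<in> carrier S"
    obtain p where p: "p \<in> P" "a = h p" using ax(1) by auto
    obtain r where r: "r \<in> carrier R" "x = h r" using ax(2) surj by auto
    have "h (r \<otimes> p) \<in> h ` P" "h (p \<otimes> r) \<in> h ` P"
      using P.I_l_closed[OF p(1) r(1)] P.I_r_closed[OF p(1) r(1)] by auto
    then show "x \<otimes>\<^bsub>S\<^esub> a \<in> h ` P" "a \<otimes>\<^bsub>S\<^esub> x \<in> h ` P"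
      using p r by (simp_all add: P.a_Hcarr)
  qed
  then show "primeideal (h ` P) S"
  proof (rule primeidealI[OF _ S.cring_axioms])
    have "\<one> \<notin> P" using P.I_notcarr P.one_imp_carrier by auto
    then have "h \<one> \<notin> h ` P" using mem[of \<one>] by simp
    then show "carrier S \<noteq> h ` P" by (metis S.one_closed hom_one)
    fix a b assume ab: "a \<in> carrier S" "b \<in> carrier S" "a \<otimes>\<^bsub>S\<^esub> b \<in> h ` P"
    obtain x where x: "x \<in> carrier R" "a = h x" using ab(1) surj by auto
    obtain y where y: "y \<in> carrier R" "b = h y" using ab(2) surj by auto
    have "h (x \<otimes> y) \<in> h ` P" using ab(3) x y by simp
    then have "x \<otimes> y \<in> P" using mem[OF R.m_closed[OF x(1) y(1)]] by blast
    then show "a \<in> h ` P \<or> b \<in> h ` P" using P.I_prime x y by auto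
  qed
qed

section \<open>Cosets, and the projection of the Rees algebra onto the fiber ring\<close>

lemma a_r_coset_class_ring_iff: "z \<in> K +>\<^bsub>class_ring\<^esub> x \<longleftrightarrow> z - x \<in> (K :: 'a::comm_ring_1 set)"
proof
  assume "z - x \<in> K"
  then show "z \<in> K +>\<^bsub>class_ring\<^esub> x" by (auto simp: a_r_coset_def' intro!: bexI[of _ "z - x"])
qed (auto simp: a_r_coset_def')

lemma a_r_coset_class_ring_eq_iff:
  assumes K: "is_submod UNIV K"
  shows "K +>\<^bsub>class_ring\<^esub> x = K +>\<^bsub>class_ring\<^esub> y \<longleftrightarrow> x - y \<in> K"
proof
  assume eq: "K +>\<^bsub>class_ring\<^esub> x = K +>\<^bsub>class_ring\<^esub> y"
  have "x \<in> K +>\<^bsub>class_ring\<^esub> x" using is_submodD(1)[OF K] unfolding a_r_coset_class_ring_iff by simp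
  then show "x - y \<in> K" unfolding eq a_r_coset_class_ring_iff .
next
  assume xy: "x - y \<in> K"
  have "z - x \<in> K \<longleftrightarrow> z - y \<in> K" for z
    using is_submod_cancel[OF K is_subring_UNIV, of "z - y" "z - x"] xy by simp
  then show "K +>\<^bsub>class_ring\<^esub> x = K +>\<^bsub>class_ring\<^esub> y"
    by (auto simp: a_r_coset_class_ring_iff)
qed

lemma a_r_coset_class_ring_0: "K +>\<^bsub>class_ring\<^esub> 0 = (K :: 'a::comm_ring_1 set)"
  by (intro Set.set_eqI) (simp add: a_r_coset_class_ring_iff)

lemma set_add_a_r_coset_class_ring:
  fixes K :: "'a::comm_ring_1 set"
  assumes K: "is_submod UNIV K"
  shows "(K +>\<^bsub>class_ring\<^esub> x) <+>\<^bsub>class_ring\<^esub> (K +>\<^bsub>class_ring\<^esub> y) = K +>\<^bsub>class_ring\<^esub> (x + y)"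
proof (intro Set.set_eqI iffI)
  fix z assume "z \<in> (K +>\<^bsub>class_ring\<^esub> x) <+>\<^bsub>class_ring\<^esub> (K +>\<^bsub>class_ring\<^esub> y)"
  then obtain v w where "z = v + w" "v - x \<in> K" "w - y \<in> K"
    by (auto simp: set_add_def' a_r_coset_class_ring_iff)
  then show "z \<in> K +>\<^bsub>class_ring\<^esub> (x + y)"
    using is_submodD(2)[OF K, of "v - x" "w - y"] by (simp add: a_r_coset_class_ring_iff algebra_simps)
next
  fix z assume z: "z \<in> K +>\<^bsub>class_ring\<^esub> (x + y)"
  have "z - y \<in> K +>\<^bsub>class_ring\<^esub> x" "y \<in> K +>\<^bsub>class_ring\<^esub> y"
    using z is_submodD(1)[OF K] by (simp_all add: a_r_coset_class_ring_iff algebra_simps)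
  then show "z \<in> (K +>\<^bsub>class_ring\<^esub> x) <+>\<^bsub>class_ring\<^esub> (K +>\<^bsub>class_ring\<^esub> y)"
    unfolding set_add_def' by simp (intro bexI[of _ "z - y"] bexI[of _ y]; simp)
qed

context minimal_generators
begin

text \<open>The quotient map of the Rees algebra by \<open>max_rees\<close>. The fiber ring is its
  image, so its ring laws are inherited instead of being checked on families of cosets.\<close>

definition fiber_proj :: "'a poly \<Rightarrow> nat \<Rightarrow> 'a set" where
  "fiber_proj p = (\<lambda>n. iprod \<mm> (ipow \<aa> n) +>\<^bsub>class_ring\<^esub> coeff p n)"

abbreviation "fiber \<equiv> fiber_ring class_ring \<mm> \<aa>"

lemma is_submod_fiber: "is_submod UNIV (iprod \<mm> (ipow \<aa> n))"
  by (intro is_submod_iprod is_submod_ipow m_submod \<aa>)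

lemma fiber_ring_sel:
  "carrier fiber = {F. (\<forall>n. \<exists>x\<in>ipow \<aa> n. F n = iprod \<mm> (ipow \<aa> n) +>\<^bsub>class_ring\<^esub> x) \<and>
    finite {n. F n \<noteq> iprod \<mm> (ipow \<aa> n)}}"
  "F \<otimes>\<^bsub>fiber\<^esub> G = (\<lambda>n. {z. \<exists>x y. (\<forall>i. x i \<in> F i) \<and> (\<forall>i. y i \<in> G i) \<and>
    z \<in> iprod \<mm> (ipow \<aa> n) +>\<^bsub>class_ring\<^esub> (\<Sum>i\<le>n. x i * y (n - i))})"
  "\<one>\<^bsub>fiber\<^esub> = (\<lambda>n. if n = 0 then iprod \<mm> (ipow \<aa> 0) +>\<^bsub>class_ring\<^esub> 1 else iprod \<mm> (ipow \<aa> n))"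
  "\<zero>\<^bsub>fiber\<^esub> = (\<lambda>n. iprod \<mm> (ipow \<aa> n))"
  "F \<oplus>\<^bsub>fiber\<^esub> G = (\<lambda>n. F n <+>\<^bsub>class_ring\<^esub> G n)"
  by (simp_all add: fiber_ring_def Let_def class_ring_simps cong: if_cong)

lemma fiber_proj_image: "fiber_proj ` rees \<aa> = carrier fiber"
proof (intro subset_antisym subsetI)
  fix F assume "F \<in> fiber_proj ` rees \<aa>"
  then obtain p where p: "p \<in> rees \<aa>" "F = fiber_proj p" by auto
  have "n \<le> degree p" if "F n \<noteq> iprod \<mm> (ipow \<aa> n)" for n
    using that by (intro le_degree notI) (simp add: p fiber_proj_def a_r_coset_class_ring_0)
  then have "{n. F n \<noteq> iprod \<mm> (ipow \<aa> n)} \<subseteq> {..degree p}" by blast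
  then have "finite {n. F n \<noteq> iprod \<mm> (ipow \<aa> n)}" by (rule finite_subset) simp
  moreover have "\<forall>n. \<exists>x\<in>ipow \<aa> n. F n = iprod \<mm> (ipow \<aa> n) +>\<^bsub>class_ring\<^esub> x"
    using p by (auto simp: fiber_proj_def rees_def)
  ultimately show "F \<in> carrier fiber" unfolding fiber_ring_sel by simp
next
  fix F assume F: "F \<in> carrier fiber"
  let ?A = "{n. F n \<noteq> iprod \<mm> (ipow \<aa> n)}"
  have fin: "finite ?A" using F unfolding fiber_ring_sel by simp
  have "\<forall>n. \<exists>x. x \<in> ipow \<aa> n \<and> F n = iprod \<mm> (ipow \<aa> n) +>\<^bsub>class_ring\<^esub> x"
    using F unfolding fiber_ring_sel by blast
  then obtain x where x: "\<And>n. x n \<in> ipow \<aa> n" "\<And>n. F n = iprod \<mm> (ipow \<aa> n) +>\<^bsub>class_ring\<^esub> x n"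
    by metis
  define p where "p = (\<Sum>n\<in>?A. monom (x n) n)"
  have c: "coeff p n = (if n \<in> ?A then x n else 0)" for n
    unfolding p_def coeff_sum using fin by (simp add: coeff_monom)
  have "p \<in> rees \<aa>" using x(1) is_submodD(1)[OF is_submod_ipow[OF \<aa>]] by (simp add: rees_def c)
  moreover have "fiber_proj p n = F n" for n
    using x(2)[of n] by (simp add: fiber_proj_def c a_r_coset_class_ring_0)
  then have "fiber_proj p = F" by (rule ext)
  ultimately show "F \<in> fiber_proj ` rees \<aa>" by blast
qed

lemma fiber_proj_mult:
  assumes p: "p \<in> rees \<aa>" and r: "r \<in> rees \<aa>"
  shows "fiber_proj (p * r) = fiber_proj p \<otimes>\<^bsub>fiber\<^esub> fiber_proj r"
proof (intro ext Set.set_eqI)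
  note P = is_submod_ipow[OF \<aa>]
  fix n z
  let ?K = "\<lambda>n. iprod \<mm> (ipow \<aa> n)"
  have KP: "v * w \<in> ?K n" if "v \<in> ?K i" "w \<in> ipow \<aa> (n - i)" "i \<le> n" for v w i
  proof -
    have "v * w \<in> iprod (?K i) (ipow \<aa> (n - i))" using that by (intro iprodI)
    then show ?thesis using iprod_assoc[OF m_submod P P] ipow_add[OF \<aa>, of i "n - i"] that by simp
  qed
  have PK: "v * w \<in> ?K n" if "v \<in> ipow \<aa> i" "w \<in> ?K (n - i)" "i \<le> n" for v w i
    using KP[of w "n - i" v] that by (simp add: mult.commute)
  \<comment> \<open>The product in \<open>fiber_ring\<close> ranges over all representatives; a
    change of representatives moves the sum only within \<open>?K n\<close>, so a single coset
    results.\<close>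
  have cong: "(\<Sum>i\<le>n. x i * y (n - i)) - coeff (p * r) n \<in> ?K n"
    if x: "\<And>i. x i \<in> fiber_proj p i" and y: "\<And>i. y i \<in> fiber_proj r i" for x y
    unfolding coeff_mult
  proof (intro is_submod_sum_cong[OF is_submod_fiber])
    fix i assume "i \<in> {..n}"
    then have i: "i \<le> n" by simp
    have xi: "x i - coeff p i \<in> ?K i" and yi: "y (n - i) - coeff r (n - i) \<in> ?K (n - i)"
      using x[of i] y[of "n - i"] by (simp_all add: fiber_proj_def a_r_coset_class_ring_iff)
    have pP: "coeff p i \<in> ipow \<aa> i" and rP: "coeff r (n - i) \<in> ipow \<aa> (n - i)"
      using p r by (simp_all add: rees_def)
    have "(x i - coeff p i) * (y (n - i) - coeff r (n - i)) \<in> ?K n"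
      using iprod_subset[OF P] by (intro KP[OF xi _ i] subsetD[OF _ yi])
    moreover have "x i * y (n - i) - coeff p i * coeff r (n - i)
      = (x i - coeff p i) * (y (n - i) - coeff r (n - i)) + (x i - coeff p i) * coeff r (n - i)
        + coeff p i * (y (n - i) - coeff r (n - i))"
      by (simp add: algebra_simps)
    ultimately show "x i * y (n - i) - coeff p i * coeff r (n - i) \<in> ?K n"
      using KP[OF xi rP i] PK[OF pP yi i] by (simp add: is_submodD(2)[OF is_submod_fiber])
  qed
  show "z \<in> fiber_proj (p * r) n \<longleftrightarrow> z \<in> (fiber_proj p \<otimes>\<^bsub>fiber\<^esub> fiber_proj r) n"
  proof
    assume z: "z \<in> fiber_proj (p * r) n"
    have self: "coeff t i \<in> fiber_proj t i" for t i
      using is_submodD(1)[OF is_submod_fiber] by (simp add: fiber_proj_def a_r_coset_class_ring_iff)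
    have "z \<in> ?K n +>\<^bsub>class_ring\<^esub> (\<Sum>i\<le>n. coeff p i * coeff r (n - i))"
      using z by (simp add: fiber_proj_def coeff_mult)
    then show "z \<in> (fiber_proj p \<otimes>\<^bsub>fiber\<^esub> fiber_proj r) n"
      unfolding fiber_ring_sel by (intro CollectI exI[of _ "coeff p"] exI[of _ "coeff r"]) (simp add: self)
  next
    assume "z \<in> (fiber_proj p \<otimes>\<^bsub>fiber\<^esub> fiber_proj r) n"
    then obtain x y where xy: "\<And>i. x i \<in> fiber_proj p i" "\<And>i. y i \<in> fiber_proj r i"
      "z - (\<Sum>i\<le>n. x i * y (n - i)) \<in> ?K n"
      unfolding fiber_ring_sel a_r_coset_class_ring_iff by blast
    then have "z - coeff (p * r) n \<in> ?K n"
      using is_submod_diff_trans[OF is_submod_fiber _ cong] by blast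
    then show "z \<in> fiber_proj (p * r) n" by (simp add: fiber_proj_def a_r_coset_class_ring_iff)
  qed
qed

lemma fiber_proj_hom: "fiber_proj \<in> Ring.ring_hom (subring_rec (rees \<aa>)) fiber"
proof (rule ring_hom_memI)
  show "fiber_proj x \<in> carrier fiber" if "x \<in> carrier (subring_rec (rees \<aa>))" for x
    using that fiber_proj_image by auto
  show "fiber_proj (x \<otimes>\<^bsub>subring_rec (rees \<aa>)\<^esub> y) = fiber_proj x \<otimes>\<^bsub>fiber\<^esub> fiber_proj y"
    if "x \<in> carrier (subring_rec (rees \<aa>))" "y \<in> carrier (subring_rec (rees \<aa>))" for x y
    using that fiber_proj_mult by simp
  show "fiber_proj (x \<oplus>\<^bsub>subring_rec (rees \<aa>)\<^esub> y) = fiber_proj x \<oplus>\<^bsub>fiber\<^esub> fiber_proj y" for x y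
    by (simp add: fiber_ring_sel fiber_proj_def set_add_a_r_coset_class_ring[OF is_submod_fiber])
  show "fiber_proj \<one>\<^bsub>subring_rec (rees \<aa>)\<^esub> = \<one>\<^bsub>fiber\<^esub>"
    by (rule ext) (simp add: fiber_ring_sel fiber_proj_def a_r_coset_class_ring_0)
qed

lemma fiber_proj_0: "fiber_proj 0 = \<zero>\<^bsub>fiber\<^esub>"
  by (simp add: fiber_ring_sel fiber_proj_def a_r_coset_class_ring_0)

lemma ring_hom_cring_fiber_proj: "ring_hom_cring (subring_rec (rees \<aa>)) fiber fiber_proj"
proof -
  interpret R: cring "subring_rec (rees \<aa>)" by (rule cring_subring_rec[OF is_subring_rees[OF \<aa>]])
  \<comment> \<open>The image of a ring is a ring with carrier and zero replaced by their images;
    here this replacement changes nothing.\<close>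
  have "fiber\<lparr>carrier := fiber_proj ` rees \<aa>, zero := fiber_proj 0\<rparr> = fiber"
    unfolding fiber_proj_image fiber_proj_0 by simp
  then have ring: "ring fiber" using R.ring_hom_imp_img_ring[OF fiber_proj_hom] by simp
  then interpret F: ring fiber .
  have "F \<otimes>\<^bsub>fiber\<^esub> G = G \<otimes>\<^bsub>fiber\<^esub> F" if FG: "F \<in> carrier fiber" "G \<in> carrier fiber" for F G
  proof -
    obtain p r where "F = fiber_proj p" "G = fiber_proj r" "p \<in> rees \<aa>" "r \<in> rees \<aa>"
      using FG unfolding fiber_proj_image[symmetric] by blast
    then show ?thesis using fiber_proj_mult[of p r] fiber_proj_mult[of r p] by (simp add: mult.commute)
  qed
  then have "comm_monoid fiber" by (intro F.monoid_comm_monoidI)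
  then have "cring fiber" using ring by (intro cring.intro)
  then show ?thesis
    using R.cring_axioms fiber_proj_hom by (intro ring_hom_cring.intro ring_hom_cring_axioms.intro)
qed

lemma number_of_generators_le_analytic_spread: "enat s \<le> analytic_spread class_ring \<mm> \<aa>"
proof -
  interpret h: ring_hom_cring "subring_rec (rees \<aa>)" fiber fiber_proj by (rule ring_hom_cring_fiber_proj)
  note R = is_subring_rees[OF \<aa>]
  obtain P where P: "\<And>i. i \<le> s \<Longrightarrow> rees_prime i (P i)" "\<And>i. i < s \<Longrightarrow> P i \<subset> P (Suc i)"
    using rees_prime_chain by metis
  have prime: "primeideal (P i) (subring_rec (rees \<aa>))" if i: "i \<le> s" for i
  proof (rule primeidealI[OF _ cring_subring_rec[OF R]])
    have Pi: "is_submod (rees \<aa>) (P i)" "P i \<subseteq> rees \<aa>" "P i \<inter> nonvanishing_values i = {}"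
      "\<And>x y. x \<in> rees \<aa> \<Longrightarrow> y \<in> rees \<aa> \<Longrightarrow> x * y \<in> P i \<Longrightarrow> x \<in> P i \<or> y \<in> P i"
      using P(1)[OF i] unfolding rees_prime_def by blast+
    show "ideal (P i) (subring_rec (rees \<aa>))" using Pi by (simp add: ideal_subring_rec_iff[OF R])
    have "1 \<notin> P i" using Pi(3) nonvanishing_values_mult(1) by blast
    then show "carrier (subring_rec (rees \<aa>)) \<noteq> P i" using is_subringD(2)[OF R] by auto
    show "x \<in> P i \<or> y \<in> P i" if "x \<in> carrier (subring_rec (rees \<aa>))" "y \<in> carrier (subring_rec (rees \<aa>))"
      "x \<otimes>\<^bsub>subring_rec (rees \<aa>)\<^esub> y \<in> P i" for x y
      using that Pi(4) by simp
  qed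
  have ker: "x \<in> P i" if i: "i \<le> s" and x: "x \<in> carrier (subring_rec (rees \<aa>))" "fiber_proj x = \<zero>\<^bsub>fiber\<^esub>" for x i
  proof -
    have "iprod \<mm> (ipow \<aa> n) +>\<^bsub>class_ring\<^esub> coeff x n = iprod \<mm> (ipow \<aa> n) +>\<^bsub>class_ring\<^esub> 0" for n
      using fun_cong[OF x(2), of n] unfolding fiber_ring_sel a_r_coset_class_ring_0 by (simp add: fiber_proj_def)
    then have "x \<in> max_rees"
      unfolding max_rees_def a_r_coset_class_ring_eq_iff[OF is_submod_fiber] by simp
    then show ?thesis using P(1)[OF i] by (auto simp: rees_prime_def)
  qed
  have surj: "fiber_proj ` carrier (subring_rec (rees \<aa>)) = carrier fiber" using fiber_proj_image by simp
  have "primeideal (fiber_proj ` P i) fiber" if "i \<le> s" for i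
    by (rule h.primeideal_image(1)[OF surj prime[OF that] ker[OF that]])
  moreover have "fiber_proj ` P i \<subset> fiber_proj ` P (Suc i)" if i: "i < s" for i
  proof -
    obtain x where x: "x \<in> P (Suc i)" "x \<notin> P i" using P(2)[OF i] by blast
    then have xR: "x \<in> carrier (subring_rec (rees \<aa>))" using P(1)[of "Suc i"] i by (auto simp: rees_prime_def)
    have i': "i \<le> s" using i by simp
    have "fiber_proj x \<in> fiber_proj ` P i \<longleftrightarrow> x \<in> P i"
      by (rule h.primeideal_image(2)[OF surj prime[OF i'] ker[OF i'] xR])
    then have "fiber_proj x \<notin> fiber_proj ` P i" using x(2) by blast
    moreover have "fiber_proj x \<in> fiber_proj ` P (Suc i)" using x(1) by (rule imageI)
    moreover have "fiber_proj ` P i \<subseteq> fiber_proj ` P (Suc i)" using P(2)[OF i] by (intro image_mono) (rule psubset_imp_subset)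
    ultimately show ?thesis by blast
  qed
  ultimately show ?thesis
    unfolding analytic_spread_def krull_dim_def
    by (intro SUP_upper CollectI exI[of _ "\<lambda>i. fiber_proj ` P i"] conjI allI impI)
qed

end

section \<open>Generators of minimal reductions\<close>

context noeth_local
begin

lemma minimal_reduction_generators:
  assumes \<aa>: "is_submod UNIV \<aa>" and mr: "minimal_reduction class_ring \<aa> Q"
    and spread: "analytic_spread class_ring \<mm> \<aa> = enat d"
  shows "\<exists>c. Q = lin_combs UNIV {1..d} c"
proof -
  have red: "is_reduction class_ring \<aa> Q"
    and min: "\<And>Q'. is_reduction class_ring \<aa> Q' \<Longrightarrow> Q' \<subseteq> Q \<Longrightarrow> Q' = Q"
    using mr unfolding minimal_reduction_def by blast+
  have Qs: "is_submod UNIV Q" and Qa: "Q \<subseteq> \<aa>"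
    using red by (auto simp: is_reduction_def ideal_class_ring_iff)
  obtain n0 where n0: "ipow \<aa> (n0 + 1) = iprod Q (ipow \<aa> n0)" using red unfolding is_reduction_def by blast
  define gens where "gens s = (\<exists>e. Q = lin_combs UNIV {..<s::nat} e)" for s
  define s where "s = (LEAST s. gens s)"
  have "\<exists>s. gens s" using finitely_generated[OF Qs] unfolding gens_def .
  then have "gens s" unfolding s_def by (rule LeastI_ex)
  then obtain e where e: "Q = lin_combs UNIV {..<s} e" unfolding gens_def by (rule exE)
  have least: "s \<le> k" if "gens k" for k unfolding s_def using that by (rule Least_le)
  define q where "q i = (if i < s then e i else 0)" for i
  have Q: "Q = lin_combs UNIV {..<s} q" unfolding e lin_combs_def q_def by simp
  interpret minimal_generators \<mm> \<aa> Q q s n0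
  proof unfold_locales
    show "ipow \<aa> (n0 + 1) \<subseteq> iprod Q (ipow \<aa> n0)" unfolding n0 by (rule order_refl)
    fix A p n assume A: "A \<subset> {..<s}" and p: "\<And>i. i \<in> A \<Longrightarrow> p i \<in> Q"
    show "\<not> ipow \<aa> (n + 1) \<subseteq> iprod (lin_combs UNIV A p) (ipow \<aa> n)"
    proof
      assume sub: "ipow \<aa> (n + 1) \<subseteq> iprod (lin_combs UNIV A p) (ipow \<aa> n)"
      let ?Q = "lin_combs UNIV A p"
      have fin: "finite A" using A finite_subset[of A "{..<s}"] by auto
      have Q's: "is_submod UNIV ?Q" by (rule is_submod_lin_combs) simp
      have Q'Q: "?Q \<subseteq> Q" by (intro lin_combs_minimal Qs p)
      have "iprod ?Q (ipow \<aa> n) \<subseteq> ipow \<aa> (n + 1)"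
        using iprod_mono[OF order_trans[OF Q'Q Qa] order_refl \<aa> is_submod_ipow[OF \<aa>], of n]
        by (simp add: iprod_commute[OF is_submod_ipow[OF \<aa>] \<aa>])
      then have "ipow \<aa> (n + 1) = iprod ?Q (ipow \<aa> n)" using sub by (intro subset_antisym)
      then have "is_reduction class_ring \<aa> ?Q"
        using Q's Q'Q Qa unfolding is_reduction_def ideal_class_ring_iff by blast
      \<comment> \<open>Minimality of the reduction makes the smaller ideal all of \<open>Q\<close>,
        which then has \<open>card A < s\<close> generators, contradicting the choice of
        \<open>s\<close>.\<close>
      then have eq: "?Q = Q" using Q'Q by (rule min)
      obtain b where b: "A = b ` {..<card A}" "inj_on b {..<card A}"
        using ex_bij_betw_nat_finite[OF fin] by (auto simp: bij_betw_def atLeast0LessThan)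
      have "?Q = lin_combs UNIV {..<card A} (\<lambda>i. p (b i))"
        using Idl_image_eq_lin_combs[OF fin, of p] Idl_image_eq_lin_combs[of "{..<card A}" "\<lambda>i. p (b i)"] b(1)
        by (metis finite_lessThan image_image)
      then have "gens (card A)" unfolding gens_def eq by blast
      then have "s \<le> card A" by (rule least)
      then show False using psubset_card_mono[OF _ A] by simp
    qed
  qed (use \<aa> Q Qa in \<open>auto simp: q_def\<close>)
  have "s \<le> d" using number_of_generators_le_analytic_spread spread by simp
  \<comment> \<open>If \<open>s < d\<close>, the zeros \<open>q i\<close> with
    \<open>i \<ge> s\<close> pad the list; the shift by one passes from indices starting at 0 to
    indices starting at 1.\<close>
  have "Q = lin_combs UNIV {1..d} (\<lambda>i. q (i - 1))"
  proof (rule subset_antisym)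
    have c: "is_submod UNIV (lin_combs UNIV {1..d} (\<lambda>i. q (i - 1)))" by (rule is_submod_lin_combs) simp
    show "lin_combs UNIV {1..d} (\<lambda>i. q (i - 1)) \<subseteq> Q" by (intro lin_combs_minimal Qs q_in_Q)
    have "q i \<in> lin_combs UNIV {1..d} (\<lambda>i. q (i - 1))" if "i < s" for i
      using gen_in_lin_combs[of UNIV "{1..d}" "Suc i" "\<lambda>i. q (i - 1)"] that \<open>s \<le> d\<close> by simp
    then show "Q \<subseteq> lin_combs UNIV {1..d} (\<lambda>i. q (i - 1))"
      unfolding Q by (intro lin_combs_minimal c) auto
  qed
  then show ?thesis by (rule exI[of _ "\<lambda>i. q (i - 1)"])
qed

text \<open>The parameters \<open>y\<close> are the coefficients of \<open>d\<close> generators of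
  \<open>Q\<close> with respect to the \<open>a j\<close>.\<close>

lemma minimal_reduction_specialization:
  fixes a :: "nat \<Rightarrow> 'a" and m d :: nat
  assumes \<aa>: "\<aa> = lin_combs UNIV {1..m} a" and mr: "minimal_reduction class_ring \<aa> Q"
    and spread: "analytic_spread class_ring \<mm> \<aa> = enat d"
  shows "\<exists>y. Q = lin_combs UNIV {1..d} (\<lambda>i. \<Sum>j\<in>{1..m}. y (i, j) * a j)"
proof -
  have \<aa>s: "is_submod UNIV \<aa>" unfolding \<aa> by (rule is_submod_lin_combs) simp
  from minimal_reduction_generators[OF \<aa>s mr spread]
  obtain c where c: "Q = lin_combs UNIV {1..d} c" by (rule exE)
  have "Q \<subseteq> \<aa>" using mr unfolding minimal_reduction_def is_reduction_def by blast
  then have "c i \<in> \<aa>" if "i \<in> {1..d}" for i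
    using gen_in_lin_combs[of UNIV "{1..d}" i c] that unfolding c by auto
  then have "\<exists>y. c i = (\<Sum>j\<in>{1..m}. y j * a j)" if "i \<in> {1..d}" for i
    using that unfolding \<aa> lin_combs_def by blast
  then obtain y where y: "\<And>i. i \<in> {1..d} \<Longrightarrow> c i = (\<Sum>j\<in>{1..m}. y i j * a j)" by metis
  have "Q = lin_combs UNIV {1..d} (\<lambda>i. \<Sum>j\<in>{1..m}. (\<lambda>(i, j). y i j) (i, j) * a j)"
    unfolding c lin_combs_def using y by simp
  then show ?thesis by (rule exI[of _ "\<lambda>(i, j). y i j"])
qed

text \<open>The common bound on the reduction numbers makes \<open>Max\<close> a genuine maximum, so
  \<open>r\<close> dominates the reduction number of \<open>Q\<close>, and the reduction equation
  persists in higher degrees.\<close>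

lemma reduction_at_big_reduction_number:
  fixes a :: "nat \<Rightarrow> 'a" and m d :: nat
  assumes \<aa>: "\<aa> = lin_combs UNIV {1..m} a" and mr: "minimal_reduction class_ring \<aa> Q"
    and spread: "analytic_spread class_ring \<mm> \<aa> = enat d"
  defines "r \<equiv> big_reduction_number class_ring \<aa>"
  shows "ipow \<aa> (r + 1) \<subseteq> iprod Q (ipow \<aa> r)"
proof -
  have \<aa>s: "is_submod UNIV \<aa>" unfolding \<aa> by (rule is_submod_lin_combs) simp
  have red: "ipow \<aa> (reduction_number class_ring \<aa> Q + 1) = iprod Q (ipow \<aa> (reduction_number class_ring \<aa> Q))"
    and "is_submod UNIV Q" "Q \<subseteq> \<aa>" if "minimal_reduction class_ring \<aa> Q" for Q
    using that LeastI_ex[of "\<lambda>n. ipow \<aa> (n + 1) = iprod Q (ipow \<aa> n)"]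
    unfolding minimal_reduction_def is_reduction_def reduction_number_def ideal_class_ring_iff by blast+
  note mQ = this
  obtain N where N: "\<forall>y n. ipow \<aa> (n + 1) \<subseteq> iprod (red_ideal a m d y) (ipow \<aa> n) \<longrightarrow>
    ipow \<aa> (N + 1) \<subseteq> iprod (red_ideal a m d y) (ipow \<aa> N)"
    using reduction_numbers_bounded[OF \<aa>, of d] by (rule exE)
  have "reduction_number class_ring \<aa> Q' \<le> N" if Q': "minimal_reduction class_ring \<aa> Q'" for Q'
  proof -
    from minimal_reduction_specialization[OF \<aa> Q' spread]
    obtain y where "Q' = lin_combs UNIV {1..d} (\<lambda>i. \<Sum>j\<in>{1..m}. y (i, j) * a j)" by (rule exE)
    then have y: "Q' = red_ideal a m d y"
      by (simp add: red_ideal_def red_gen_def[abs_def])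
    have "ipow \<aa> (N + 1) \<subseteq> iprod Q' (ipow \<aa> N)"
      using N[rule_format, of "reduction_number class_ring \<aa> Q'" y] mQ(1)[OF Q'] unfolding y by simp
    moreover have "iprod Q' (ipow \<aa> N) \<subseteq> ipow \<aa> (N + 1)"
      using iprod_mono[OF mQ(3)[OF Q'] order_refl \<aa>s is_submod_ipow[OF \<aa>s], of N]
      by (simp add: iprod_commute[OF is_submod_ipow[OF \<aa>s] \<aa>s])
    ultimately show ?thesis unfolding reduction_number_def by (intro Least_le subset_antisym)
  qed
  then have "reduction_number class_ring \<aa> ` {q. minimal_reduction class_ring \<aa> q} \<subseteq> {..N}" by blast
  then have "finite (reduction_number class_ring \<aa> ` {q. minimal_reduction class_ring \<aa> q})"
    by (rule finite_subset) simp
  then have "reduction_number class_ring \<aa> Q \<le> r"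
    unfolding r_def big_reduction_number_def using mr by (intro Max_ge) auto
  then show ?thesis
    using reduction_step_mono[OF \<aa>s mQ(2)[OF mr]] mQ(1)[OF mr] by blast
qed

lemma specialization_in_reduction:
  fixes a :: "nat \<Rightarrow> 'a" and m d :: nat
  assumes q: "q = lin_combs UNIV {1..d} (\<lambda>i. \<Sum>j\<in>{1..m}. y (i, j) * a j)"
    and Q: "Q = Idl\<^bsub>upoly_ring d m\<^esub> (generic_element a m ` {1..d})"
    and f: "f \<in> Q"
  shows "specialize y f \<in> q"
proof -
  interpret sp: comm_ring_hom "specialize y" by (rule specialize_hom)
  have qs: "is_submod UNIV q" unfolding q by (rule is_submod_lin_combs) simp
  let ?I = "{f \<in> upolys d m. specialize y f \<in> q}"
  have "is_submod (upolys d m) ?I"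
    using is_subringD[OF is_subring_upolys[of d m]] is_submodD[OF qs] unfolding is_submod_def
    by (auto simp: sp.hom_add sp.hom_mult)
  moreover have "generic_element a m ` {1..d} \<subseteq> ?I"
    using generic_element_in_upolys[of _ d a m]
      gen_in_lin_combs[of UNIV "{1..d}" _ "\<lambda>i. \<Sum>j\<in>{1..m}. y (i, j) * a j"]
    by (auto simp: specialize_generic_element q)
  ultimately have "Q \<subseteq> ?I"
    unfolding Q upoly_ring_eq by (intro Idl_subring_rec_minimal is_subring_upolys) auto
  then show ?thesis using f by auto
qed

end

section \<open>Powers of ideals in other rings, and the two inclusions\<close>

lemma ideal_power_1:
  assumes "cring R" "ideal I R"
  shows "ideal_power R I 1 = I"
proof -
  interpret cring R by (rule assms(1))
  have "ideal_power R I 1 = carrier R \<cdot>\<^bsub>R\<^esub> I" by simp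
  also have "\<dots> = I" using ideal_prod_commute[OF oneideal assms(2)] ideal_prod_one[OF assms(2)] by simp
  finally show ?thesis .
qed

lemma power_in_ideal_power:
  assumes "1 \<in> S" "f \<in> I"
  shows "f ^ n \<in> ideal_power (subring_rec S) I n"
proof (induction n)
  case (Suc n)
  then show ?case using ideal_prod.prod[OF Suc assms(2), of "subring_rec S"] by (simp add: mult.commute)
qed (use assms in simp)

theorem theorem4p4:
  fixes a :: "nat \<Rightarrow> 'a::comm_ring_1" and m d :: nat
    and \<mm> \<aa> :: "'a set" and \<Q> \<J> :: "'a upoly set"
  assumes "noetherian_ring (class_ring :: 'a ring)"
    and "is_local_ring class_ring \<mm>"
    and "infinite (carrier (class_ring Quot \<mm>))"
    and "\<aa> = Idl\<^bsub>class_ring\<^esub> (a ` {1..m})"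
    and "analytic_spread class_ring \<mm> \<aa> = enat d"
    and "\<Q> = Idl\<^bsub>upoly_ring d m\<^esub> (generic_element a m ` {1..d})"
    and "testing_ideal a m d \<J>"
  shows "ideal_power class_ring \<aa> (big_reduction_number class_ring \<aa> + 1)
           \<subseteq> {x. uconst x \<in> ideal_saturation (upoly_ring d m) \<Q> \<J>}
       \<and> {x. uconst x \<in> ideal_saturation (upoly_ring d m) \<Q> \<J>} \<subseteq> ideal_core class_ring \<aa>"
proof -
  interpret noeth_local \<mm> using assms(1-3) by (rule noeth_localI)
  let ?S = "upolys d m :: 'a upoly set"
  define r where "r = big_reduction_number class_ring \<aa>"
  define h where "h = min_num_gens class_ring (ipow \<aa> (r + 1))"
  have \<aa>: "\<aa> = lin_combs UNIV {1..m} a" unfolding assms(4) by (rule Idl_image_eq_lin_combs) simp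
  obtain M where M: "testing_matrix a m d r M" and J: "\<J> = Idl\<^bsub>upoly_ring d m\<^esub> (minors h M)"
    using assms(7) unfolding testing_ideal_def assms(4)[symmetric] Let_def r_def h_def by blast
  obtain cs rs where cs: "distinct cs" "minimal_basis class_ring (ipow \<aa> (r + 1)) (set cs)"
    and "set rs = {1..d} \<times> monomials m r" and Mdim: "M \<in> carrier_mat (length rs) (length cs)"
    and MS: "\<And>k l. k < length rs \<Longrightarrow> l < length cs \<Longrightarrow> M $$ (k, l) \<in> ?S"
    using M unfolding testing_matrix_def assms(4)[symmetric] upoly_ring_eq by auto
  \<comment> \<open>The minimal number of generators is the length of the chosen basis, so the
    minors of order \<open>h\<close> use all columns of \<open>M\<close>.\<close>
  have h: "dim_col M = h" using length_minimal_basis[OF cs(2,1)] Mdim by (simp add: h_def)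
  have minS: "minors h M \<subseteq> ?S"
  proof
    fix f assume "f \<in> minors h M"
    then obtain I where I: "I \<subseteq> {..<length rs}" "card I = h" "f = det (mat h h (\<lambda>(k, l). M $$ (pick I k, l)))"
      using Mdim unfolding minors_all_columns[OF h] by auto
    show "f \<in> ?S" unfolding I(3)
    proof (rule det_in_subring[OF is_subring_upolys])
      fix k l assume "k < h" "l < h"
      then show "mat h h (\<lambda>(k, l). M $$ (pick I k, l)) $$ (k, l) \<in> ?S"
        using pick_less[OF I(1)] I(2) h Mdim by (auto intro!: MS)
    qed simp
  qed
  note J' = is_submod_Idl_subring_rec[OF is_subring_upolys minS, folded upoly_ring_eq J]
  have gs: "generic_element a m ` {1..d} \<subseteq> ?S" using generic_element_in_upolys by blast
  note Q' = is_submod_Idl_subring_rec[OF is_subring_upolys gs, folded upoly_ring_eq assms(6)]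
  have first: "uconst x \<in> ideal_saturation (upoly_ring d m) \<Q> \<J>" if x: "x \<in> ipow \<aa> (r + 1)" for x
  proof -
    \<comment> \<open>Already the first power of \<open>\<J>\<close> multiplies \<open>x\<close>
      into \<open>\<Q>\<close>, so the exponent 1 of the union serves.\<close>
    let ?I = "{f \<in> ?S. uconst x * f \<in> \<Q>}"
    have "is_submod ?S ?I"
      using is_subringD[OF is_subring_upolys[of d m]] is_submodD[OF Q'(1)] unfolding is_submod_def
      by (auto simp: distrib_left mult.left_commute)
    moreover have "minors h M \<subseteq> ?I"
      using uconst_mult_minor_in_generic_ideal[OF assms(4,6) M h x] minS by blast
    ultimately have "\<J> \<subseteq> ?I"
      unfolding J upoly_ring_eq by (intro Idl_subring_rec_minimal is_subring_upolys) auto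
    moreover have "ideal_power (upoly_ring d m) \<J> 1 = \<J>"
      unfolding upoly_ring_eq using J'(1,3)
      by (intro ideal_power_1 cring_subring_rec is_subring_upolys) (simp add: ideal_subring_rec_iff[OF is_subring_upolys])
    ultimately have "uconst x \<in> ideal_colon (upoly_ring d m) \<Q> (ideal_power (upoly_ring d m) \<J> 1)"
      unfolding ideal_colon_def by (auto simp: upoly_ring_eq)
    then show ?thesis unfolding ideal_saturation_def by (intro UN_I[of 1]) auto
  qed
  have second: "x \<in> q" if x: "uconst x \<in> ideal_saturation (upoly_ring d m) \<Q> \<J>"
    and q: "minimal_reduction class_ring \<aa> q" for x q
  proof -
    from minimal_reduction_specialization[OF \<aa> q assms(5)]
    obtain y where y: "q = lin_combs UNIV {1..d} (\<lambda>i. \<Sum>j\<in>{1..m}. y (i, j) * a j)" by (rule exE)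
    interpret sp: comm_ring_hom "specialize y" by (rule specialize_hom)
    have "ipow \<aa> (r + 1) \<subseteq> iprod q (ipow \<aa> r)"
      unfolding r_def by (rule reduction_at_big_reduction_number[OF \<aa> q assms(5)])
    from exists_minor_notin_m[OF assms(4) M h y this]
    obtain f where f: "f \<in> minors h M" "specialize y f \<notin> \<mm>" by (rule bexE)
    \<comment> \<open>It is enough to use this for \<open>f ^ n\<close>: its specialization is a
      power of a unit and can be cancelled in \<open>q\<close>.\<close>
    obtain n where n: "\<forall>g\<in>ideal_power (upoly_ring d m) \<J> n. uconst x * g \<in> \<Q>"
      using x unfolding ideal_saturation_def ideal_colon_def by (auto simp: upoly_ring_eq)
    have "f ^ n \<in> ideal_power (upoly_ring d m) \<J> n"
      unfolding upoly_ring_eq using f(1) J'(2) is_subringD(2)[OF is_subring_upolys]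
      by (intro power_in_ideal_power) auto
    then have "uconst x * f ^ n \<in> \<Q>" using n by blast
    then have "specialize y (uconst x * f ^ n) \<in> q" by (rule specialization_in_reduction[OF y assms(6)])
    then have "specialize y f ^ n * x \<in> q" by (simp add: sp.hom_mult sp.hom_power mult.commute)
    moreover have "is_submod UNIV q" unfolding y by (rule is_submod_lin_combs) simp
    ultimately show "x \<in> q" using unit_cancel m_prime_power[OF f(2)] by blast
  qed
  show ?thesis
    using first second unfolding r_def ideal_core_def by blast
qed

end
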